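(* Let $0<\beta\le1$. For $y\in\mathcal{N}'$ the translation operator $\tau_y$, $\tau_y\varphi(\omega)=\varphi(\omega+y)$, can be represented as $$\tau_y\varphi(\omega)=\varphi(\omega+y)=\sum_{k=0}^\infty\sum_{n=0}^\infty\binom{n+k}{k}\left\langle P_k^{\mu_\beta}(\omega),\ y^{\otimes n}\,\widehat\otimes_n\,\varphi^{(n+k)}\right\rangle$$ for every $\varphi=\sum_{n=0}^\infty\langle P_n^{\mu_\beta}(\cdot),\varphi^{(n)}\rangle\in(\mathcal{N})^1_{\mu_\beta}$. Furthermore, for any $p\ge0$ and $q>0$ with $|y|_{-(p+q)}<\infty$, it holds that $$\|\tau_y\varphi\|_p\le\frac{\|\varphi\|_{p+q}}{(1-2^{2q})^{1/2}}\exp\left(\frac{|y|^2_{-(p+q)}}{2(1-2^{2q})}\right).$$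
   Context: Setting. $\mathcal{N}\subset\mathcal{H}\subset\mathcal{N}'$ is a nuclear triple, where $\mathcal{N}$ is the projective limit of a countable family of Hilbert spaces $\mathcal{H}_p$ with norms $|\cdot|_p$ ($|\cdot|_0$ being the norm of $\mathcal{H}$), and $\mathcal{N}'$ is the union of the dual spaces $\mathcal{H}_{-p}$ with norms $|\cdot|_{-p}$; the same symbols denote the norms on complexifications and tensor powers. The subscript $\mathbb{C}$ denotes complexification, $\langle\cdot,\cdot\rangle$ is the bilinear dual pairing (also on tensor powers), and $\widehat\otimes$ is the symmetric tensor product. For $y\in\mathcal{N}'$ and $f\in\mathcal{N}_{\mathbb{C}}^{\widehat\otimes(n+k)}$, $y^{\otimes n}\widehat\otimes_nf\in\mathcal{N}_{\mathbb{C}}^{\widehat\otimes k}$ is the contraction of $f$ with $y^{\otimes n}$ in $n$ variables, i.e. $\langle x^{\otimes k},y^{\otimes n}\widehat\otimes_nf\rangle=\langle x^{\otimes k}\widehat\otimes y^{\otimes n},f\rangle$ for $x\in\mathcal{N}'$. Mittag-Leffler measure and Appell polynomials. $E_\beta(z)=\sum_{n\ge0} z^n/\Gamma(\beta n+1)$, and $\mu_\beta$ is the unique probability measure on $\mathcal{N}'$ with $\int_{\mathcal{N}'} e^{i\langle\omega,\varphi\rangle}\,d\mu_\beta(\omega)=E_\beta(-\tfrac12\langle\varphi,\varphi\rangle)$ for $\varphi\in\mathcal{N}$. The Appell polynomials are the kernels $P_n^{\mu_\beta}(\omega)\in(\mathcal{N}_{\mathbb{C}}^{\widehat\otimes n})'$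 determined by $\dfrac{e^{\langle\omega,\theta\rangle}}{E_\beta(\frac12\langle\theta,\theta\rangle)}=\sum_{n\ge0}\frac1{n!}\langle P_n^{\mu_\beta}(\omega),\theta^{\otimes n}\rangle$ for $\theta\in\mathcal{N}_{\mathbb{C}}$ near $0$. Test functions. $(\mathcal{N})^1_{\mu_\beta}$ is the projective limit over $p,q\in\mathbb{N}_0$ of the completions of the smooth polynomials $\varphi=\sum_n\langle P_n^{\mu_\beta}(\cdot),\varphi^{(n)}\rangle$, $\varphi^{(n)}\in\mathcal{N}_{\mathbb{C}}^{\widehat\otimes n}$, with respect to the norms $\|\varphi\|_{p,q,\mu_\beta}^2=\sum_n(n!)^22^{nq}|\varphi^{(n)}|_p^2$. Elements are written $\varphi(\omega)=\sum_n\langle P_n^{\mu_\beta}(\omega),\varphi^{(n)}\rangle$, $\omega\in\mathcal{N}'$. Norm in the estimate. For $\varphi=\sum_n\langle P_n^{\mu_\beta}(\cdot),\varphi^{(n)}\rangle$ and $r\ge0$, $\|\varphi\|_r^2=\sum_{n=0}^\infty n!\,|\varphi^{(n)}|_r^2$.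
   Formalization: In the norm estimate the printed 1-2^{2q}, negative for q>0, is replaced by 1-2^{-2q}, and the normalisation |ξ|_p ≤ 2^{-q}|ξ|_{p+q} for all ξ in N is assumed for the given p, q, since the corrected bound fails without it. *)

theory Defs
  imports "HOL-Analysis.Analysis"
begin

section \<open>Nuclear triples\<close>

text \<open>
  The nuclear space is the type \<open>'n\<close>, with a countable family \<open>ip p\<close> of inner products; the
  Hilbert space \<open>H\<^sub>p\<close> is the completion of \<open>'n\<close> for \<open>ip p\<close>, and \<open>H = H\<^sub>0\<close>.
  These completions are not constructed: all notions below are expressed on \<open>'n\<close>, which is dense
  in every \<open>H\<^sub>p\<close>.
\<close>

definition hnorm :: "(nat \<Rightarrow> 'n::real_vector \<Rightarrow> 'n \<Rightarrow> real) \<Rightarrow> nat \<Rightarrow> 'n \<Rightarrow> real" where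
  "hnorm ip p \<xi> = sqrt (ip p \<xi> \<xi>)"

text \<open>
  The canonical map \<open>H\<^sub>q \<rightarrow> H\<^sub>p\<close> is Hilbert-Schmidt. The sum of \<open>|e|\<^sub>p\<^sup>2\<close> over an orthonormal
  basis of \<open>H\<^sub>q\<close> is the supremum over the finite \<open>H\<^sub>q\<close>-orthonormal systems, and by density
  those contained in \<open>'n\<close> suffice.
\<close>

definition hs_embedding ::
    "(nat \<Rightarrow> 'n::real_vector \<Rightarrow> 'n \<Rightarrow> real) \<Rightarrow> nat \<Rightarrow> nat \<Rightarrow> bool" where
  "hs_embedding ip q p \<longleftrightarrow>
     (\<exists>C. \<forall>B. finite B \<and> (\<forall>e\<in>B. \<forall>e'\<in>B. ip q e e' = (if e = e' then 1 else 0)) \<longrightarrow>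
        (\<Sum>e\<in>B. (hnorm ip p e)\<^sup>2) \<le> C)"

text \<open>
  Completeness says that \<open>'n\<close> is the whole projective limit of the \<open>H\<^sub>p\<close>. The family is directed
  with Hilbert-Schmidt maps; monotonicity of the norms in \<open>p\<close> is not required.
\<close>

locale nuclear_triple =
  fixes ip :: "nat \<Rightarrow> 'n::real_vector \<Rightarrow> 'n \<Rightarrow> real"
  assumes ip_bilinear: "bilinear (ip p)"
    and ip_sym: "ip p \<xi> \<eta> = ip p \<eta> \<xi>"
    and ip_pos: "\<xi> \<noteq> 0 \<Longrightarrow> ip p \<xi> \<xi> > 0"
    and complete:
      "(\<And>p e. e > 0 \<Longrightarrow> \<exists>M. \<forall>m\<ge>M. \<forall>n\<ge>M. hnorm ip p (X m - X n) < e) \<Longrightarrow>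
       \<exists>\<xi>. \<forall>p. (\<lambda>n. hnorm ip p (X n - \<xi>)) \<longlonglongrightarrow> 0"
    and nuclear: "\<exists>p. hs_embedding ip p p1 \<and> hs_embedding ip p p2"

text \<open>\<open>x \<in> hdual ip p\<close>, i.e. \<open>x \<in> H\<^sub>-\<^sub>p\<close>, says that \<open>|x|\<^sub>-\<^sub>p < \<infinity>\<close>.\<close>

definition hdual ::
    "(nat \<Rightarrow> 'n::real_vector \<Rightarrow> 'n \<Rightarrow> real) \<Rightarrow> nat \<Rightarrow> ('n \<Rightarrow> real) set" where
  "hdual ip p = {x. linear x \<and> (\<exists>C. \<forall>\<xi>. \<bar>x \<xi>\<bar> \<le> C * hnorm ip p \<xi>)}"

definition dual_norm ::
    "(nat \<Rightarrow> 'n::real_vector \<Rightarrow> 'n \<Rightarrow> real) \<Rightarrow> nat \<Rightarrow> ('n \<Rightarrow> real) \<Rightarrow> real" where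
  "dual_norm ip p x = Sup {\<bar>x \<xi>\<bar> | \<xi>. hnorm ip p \<xi> \<le> 1}"

definition dual :: "(nat \<Rightarrow> 'n::real_vector \<Rightarrow> 'n \<Rightarrow> real) \<Rightarrow> ('n \<Rightarrow> real) set" where
  "dual ip = (\<Union>p. hdual ip p)"

text \<open>The inner product of \<open>H\<^sub>-\<^sub>p\<close>, recovered from its norm by polarization.\<close>

definition dual_ip ::
    "(nat \<Rightarrow> 'n::real_vector \<Rightarrow> 'n \<Rightarrow> real) \<Rightarrow> nat \<Rightarrow> ('n \<Rightarrow> real) \<Rightarrow> ('n \<Rightarrow> real) \<Rightarrow> real" where
  "dual_ip ip p x z =
     ((dual_norm ip p (\<lambda>\<xi>. x \<xi> + z \<xi>))\<^sup>2 - (dual_norm ip p (\<lambda>\<xi>. x \<xi> - z \<xi>))\<^sup>2) / 4"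

definition dual_orthonormal ::
    "(nat \<Rightarrow> 'n::real_vector \<Rightarrow> 'n \<Rightarrow> real) \<Rightarrow> nat \<Rightarrow> ('n \<Rightarrow> real) set \<Rightarrow> bool" where
  "dual_orthonormal ip p B \<longleftrightarrow> finite B \<and> B \<subseteq> hdual ip p \<and>
     (\<forall>x\<in>B. \<forall>z\<in>B. dual_ip ip p x z = (if x = z then 1 else 0))"


section \<open>Complexification\<close>

text \<open>The pair \<open>(a, b)\<close> stands for \<open>a + i b\<close>.\<close>

definition cnorm ::
    "(nat \<Rightarrow> 'n::real_vector \<Rightarrow> 'n \<Rightarrow> real) \<Rightarrow> nat \<Rightarrow> 'n \<times> 'n \<Rightarrow> real" where
  "cnorm ip p \<theta> = sqrt ((hnorm ip p (fst \<theta>))\<^sup>2 + (hnorm ip p (snd \<theta>))\<^sup>2)"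

definition cpair :: "('n \<Rightarrow> real) \<Rightarrow> 'n \<times> 'n \<Rightarrow> complex" where
  "cpair x \<theta> = Complex (x (fst \<theta>)) (x (snd \<theta>))"

text \<open>The bilinear (not sesquilinear) extension of the inner product of \<open>H\<close>.\<close>

definition cbilin ::
    "(nat \<Rightarrow> 'n::real_vector \<Rightarrow> 'n \<Rightarrow> real) \<Rightarrow> 'n \<times> 'n \<Rightarrow> 'n \<times> 'n \<Rightarrow> complex" where
  "cbilin ip \<theta> \<eta> =
     Complex (ip 0 (fst \<theta>) (fst \<eta>) - ip 0 (snd \<theta>) (snd \<eta>))
             (ip 0 (fst \<theta>) (snd \<eta>) + ip 0 (snd \<theta>) (fst \<eta>))"


section \<open>Symmetric tensor powers\<close>

text \<open>
  A symmetric tensor \<open>f\<close> of degree \<open>n\<close> over the complexified nuclear space is represented by the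
  symmetric form that maps \<open>[x\<^sub>1, ..., x\<^sub>n]\<close>, with \<open>x\<^sub>i\<close> in the dual space, to the pairing
  of \<open>x\<^sub>1 \<otimes> ... \<otimes> x\<^sub>n\<close> with \<open>f\<close>; it is set to \<open>0\<close> on all other lists. Under this identification
  the complexified Hilbert tensor power of \<open>H\<^sub>p\<close> is the space of Hilbert-Schmidt \<open>n\<close>-forms on its
  dual \<open>H\<^sub>-\<^sub>p\<close>, and \<open>|f|\<^sub>p\<close> is the Hilbert-Schmidt norm, i.e. the square root of the sum of
  \<open>|f [e\<^sub>i\<^sub>1, ..., e\<^sub>i\<^sub>n]|\<^sup>2\<close> over an orthonormal basis of \<open>H\<^sub>-\<^sub>p\<close>, which is the supremum over
  finite orthonormal systems. The tensor power of the nuclear space is the projective limit,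
  i.e. the space of forms for which all these norms are finite.
\<close>

type_synonym 'n form = "('n \<Rightarrow> real) list \<Rightarrow> complex"

definition hs_sums ::
    "(nat \<Rightarrow> 'n::real_vector \<Rightarrow> 'n \<Rightarrow> real) \<Rightarrow> nat \<Rightarrow> nat \<Rightarrow> 'n form \<Rightarrow> real set" where
  "hs_sums ip p n f =
     {(\<Sum>xs | set xs \<subseteq> B \<and> length xs = n. (cmod (f xs))\<^sup>2) | B. dual_orthonormal ip p B}"

definition tnorm ::
    "(nat \<Rightarrow> 'n::real_vector \<Rightarrow> 'n \<Rightarrow> real) \<Rightarrow> nat \<Rightarrow> nat \<Rightarrow> 'n form \<Rightarrow> real" where
  "tnorm ip p n f = sqrt (Sup (hs_sums ip p n f))"

definition sym_tensors ::
    "(nat \<Rightarrow> 'n::real_vector \<Rightarrow> 'n \<Rightarrow> real) \<Rightarrow> nat \<Rightarrow> 'n form set" where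
  "sym_tensors ip n = {f.
     (\<forall>xs. \<not> (length xs = n \<and> set xs \<subseteq> dual ip) \<longrightarrow> f xs = 0) \<and>
     (\<forall>xs ys. mset xs = mset ys \<longrightarrow> f xs = f ys) \<and>
     (\<forall>xs i x z a b. length xs = n \<and> set xs \<subseteq> dual ip \<and> i < n \<and> x \<in> dual ip \<and> z \<in> dual ip \<longrightarrow>
        f (xs[i := (\<lambda>\<xi>. a * x \<xi> + b * z \<xi>)]) =
          of_real a * f (xs[i := x]) + of_real b * f (xs[i := z])) \<and>
     (\<forall>p. bdd_above (hs_sums ip p n f))}"

definition tensor_power ::
    "(nat \<Rightarrow> 'n::real_vector \<Rightarrow> 'n \<Rightarrow> real) \<Rightarrow> nat \<Rightarrow> 'n \<times> 'n \<Rightarrow> 'n form" where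
  "tensor_power ip n \<theta> =
     (\<lambda>xs. if length xs = n \<and> set xs \<subseteq> dual ip then \<Prod>x\<leftarrow>xs. cpair x \<theta> else 0)"

text \<open>Contraction of \<open>f\<close> with the \<open>n\<close>-th tensor power of \<open>y\<close>.\<close>

definition contract :: "nat \<Rightarrow> ('n \<Rightarrow> real) \<Rightarrow> 'n form \<Rightarrow> 'n form" where
  "contract n y f = (\<lambda>xs. f (xs @ replicate n y))"

text \<open>
  The continuous complex-linear functionals on the symmetric tensors of degree \<open>n\<close>. Since the
  family of norms is directed, continuity is boundedness for a single one of them.
\<close>

definition tensor_dual ::
    "(nat \<Rightarrow> 'n::real_vector \<Rightarrow> 'n \<Rightarrow> real) \<Rightarrow> nat \<Rightarrow> ('n form \<Rightarrow> complex) set" where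
  "tensor_dual ip n = {T.
     (\<forall>f\<in>sym_tensors ip n. \<forall>g\<in>sym_tensors ip n. \<forall>a b.
        T (\<lambda>xs. a * f xs + b * g xs) = a * T f + b * T g) \<and>
     (\<exists>p C. \<forall>f\<in>sym_tensors ip n. cmod (T f) \<le> C * tnorm ip p n f)}"


section \<open>Appell polynomials and test functions of Mittag-Leffler analysis\<close>

definition mittag_leffler :: "real \<Rightarrow> complex \<Rightarrow> complex" where
  "mittag_leffler \<beta> z = (\<Sum>n. z ^ n / of_real (Gamma (\<beta> * real n + 1)))"

text \<open>
  \<open>P n \<omega>\<close> is the Appell kernel of degree \<open>n\<close> at \<open>\<omega>\<close>. The Mittag-Leffler measure enters only through
  its Laplace transform, the denominator of the generating function.
\<close>

definition appell_system ::
    "(nat \<Rightarrow> 'n::real_vector \<Rightarrow> 'n \<Rightarrow> real) \<Rightarrow> real \<Rightarrow>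
     (nat \<Rightarrow> ('n \<Rightarrow> real) \<Rightarrow> 'n form \<Rightarrow> complex) \<Rightarrow> bool" where
  "appell_system ip \<beta> P \<longleftrightarrow>
     (\<forall>\<omega>\<in>dual ip.
        (\<forall>n. P n \<omega> \<in> tensor_dual ip n) \<and>
        (\<exists>p \<epsilon>. \<epsilon> > 0 \<and> (\<forall>\<theta>. cnorm ip p \<theta> < \<epsilon> \<longrightarrow>
           (\<lambda>n. 1 / fact n * P n \<omega> (tensor_power ip n \<theta>)) sums
             (exp (cpair \<omega> \<theta>) / mittag_leffler \<beta> (1 / 2 * cbilin ip \<theta> \<theta>)))))"

text \<open>
  Elements of the projective limit, over \<open>p\<close> and \<open>q\<close>, of the completions of the smooth polynomials
  are given by the sequences of kernels for which all the norms are finite.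
\<close>

definition test_kernels ::
    "(nat \<Rightarrow> 'n::real_vector \<Rightarrow> 'n \<Rightarrow> real) \<Rightarrow> (nat \<Rightarrow> 'n form) set" where
  "test_kernels ip = {\<phi>. (\<forall>n. \<phi> n \<in> sym_tensors ip n) \<and>
     (\<forall>p q. summable (\<lambda>n. (fact n)\<^sup>2 * 2 ^ (n * q) * (tnorm ip p n (\<phi> n))\<^sup>2))}"

text \<open>\<open>F\<close> is the test function with kernels \<open>\<phi>\<close>; only its values on the dual space matter.\<close>

definition appell_expansion ::
    "(nat \<Rightarrow> 'n::real_vector \<Rightarrow> 'n \<Rightarrow> real) \<Rightarrow> (nat \<Rightarrow> ('n \<Rightarrow> real) \<Rightarrow> 'n form \<Rightarrow> complex) \<Rightarrow>
     (('n \<Rightarrow> real) \<Rightarrow> complex) \<Rightarrow> (nat \<Rightarrow> 'n form) \<Rightarrow> bool" where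
  "appell_expansion ip P F \<phi> \<longleftrightarrow>
     \<phi> \<in> test_kernels ip \<and> (\<forall>\<omega>\<in>dual ip. (\<lambda>n. P n \<omega> (\<phi> n)) sums F \<omega>)"

definition test_functions ::
    "(nat \<Rightarrow> 'n::real_vector \<Rightarrow> 'n \<Rightarrow> real) \<Rightarrow> (nat \<Rightarrow> ('n \<Rightarrow> real) \<Rightarrow> 'n form \<Rightarrow> complex) \<Rightarrow>
     (('n \<Rightarrow> real) \<Rightarrow> complex) set" where
  "test_functions ip P = {F. \<exists>\<phi>. appell_expansion ip P F \<phi>}"

definition appell_kernels ::
    "(nat \<Rightarrow> 'n::real_vector \<Rightarrow> 'n \<Rightarrow> real) \<Rightarrow> (nat \<Rightarrow> ('n \<Rightarrow> real) \<Rightarrow> 'n form \<Rightarrow> complex) \<Rightarrow>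
     (('n \<Rightarrow> real) \<Rightarrow> complex) \<Rightarrow> nat \<Rightarrow> 'n form" where
  "appell_kernels ip P F = (THE \<phi>. appell_expansion ip P F \<phi>)"

definition test_norm ::
    "(nat \<Rightarrow> 'n::real_vector \<Rightarrow> 'n \<Rightarrow> real) \<Rightarrow> (nat \<Rightarrow> ('n \<Rightarrow> real) \<Rightarrow> 'n form \<Rightarrow> complex) \<Rightarrow> nat \<Rightarrow>
     (('n \<Rightarrow> real) \<Rightarrow> complex) \<Rightarrow> real" where
  "test_norm ip P r F =
     sqrt (\<Sum>n. fact n * (tnorm ip r n (appell_kernels ip P F n))\<^sup>2)"

definition translate ::
    "('n \<Rightarrow> real) \<Rightarrow> (('n \<Rightarrow> real) \<Rightarrow> complex) \<Rightarrow> ('n \<Rightarrow> real) \<Rightarrow> complex" where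
  "translate y F = (\<lambda>\<omega>. F (\<lambda>\<xi>. \<omega> \<xi> + y \<xi>))"

end

theory Submission
  imports Defs "HOL-Library.Function_Algebras"
begin

text \<open>
  On elementary tensors \<open>\<theta>\<^sup>\<otimes>\<^sup>n\<close> the generating function gives
  \<open>P\<^sub>n(\<omega> + y) = \<Sum>\<^sub>k (n choose k) P\<^sub>k(\<omega>) \<otimes> y\<^sup>\<otimes>\<^sup>(\<^sup>n\<^sup>-\<^sup>k\<^sup>)\<close>. Such tensors span a dense subspace, by
  projections onto finite-dimensional subspaces of the nuclear space and polarization, so the identity
  extends to all symmetric tensors. The same approximation turns the explicit values of
  \<open>P\<^sub>n(\<omega>)\<close> on elementary tensors into a bound \<open>n! K\<^sup>n\<close> for its norm on a fixed Hilbert tensor power;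
  since the kernels of a test function decay faster than any \<open>\<rho>\<^sup>n / n!\<close>, the double series
  converges absolutely and may be summed in either order.

  The norm of a test function refers to its kernels, so these must be unique. If a test function
  vanishes, so do its Taylor coefficients at \<open>0\<close>; each of them equals the kernel of its degree plus
  contractions of kernels of higher degree, and by the decay of the kernels this triangular system
  has only the zero solution. The norm estimate is then the Cauchy-Schwarz inequality together with
  the binomial theorem.
\<close>

text \<open>No Hilbert space is completed here, so neither infinite orthonormal bases nor exact
  Riesz representatives are at hand. Estimates are made on finite orthonormal systems of
  \<open>hdual ip p\<close>, enlarged by Gram-Schmidt until they span the functionals in play; the
  inner product of the dual is reached through approximate representatives in the nuclear space.

  Continuity of \<open>P n \<omega>\<close> provides, for each n, some norm and some constant, both
  uncontrolled as n grows. The bound on a fixed Hilbert tensor power removes this dependence: the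
  uncontrolled constant only multiplies an approximation error that tends to 0 while n is fixed, and
  the constant that survives comes from the values on products of vectors and from one
  Hilbert-Schmidt embedding, which costs one factor per tensor slot.

  In the norm estimate 2^(-q) bounds the embedding of H_(p+q) into H_p. It enters squared, once per
  tensor slot, and its complement 1 - 2^(-2q) is the weight left for the contracted slots. With
  2^(2q) in its place this weight would be negative for q > 0.\<close>

instantiation "fun" :: (type, real_vector) real_vector
begin

text \<open>With pointwise operations the functionals form a real vector space, so that
  \<open>span\<close>, \<open>subspace\<close> and \<open>linear\<close> apply to the dual.\<close>

definition scaleR_fun :: "real \<Rightarrow> ('a \<Rightarrow> 'b) \<Rightarrow> 'a \<Rightarrow> 'b" where
  "scaleR_fun a f = (\<lambda>x. a *\<^sub>R f x)"

instance
  by standard (auto simp: scaleR_fun_def plus_fun_def algebra_simps)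

end

lemma scaleR_fun_apply [simp]: "(a *\<^sub>R f) x = a *\<^sub>R f x"
  by (simp add: scaleR_fun_def)

lemma sum_fun_apply: "(\<Sum>i\<in>I. f i) x = (\<Sum>i\<in>I. f i x)"
  by (induction I rule: infinite_finite_induct) auto

section \<open>Inner products on a subspace\<close>

text \<open>Relative to a subspace because \<open>dual_ip ip p\<close> is an inner product only on
  \<open>hdual ip p\<close>, inside the space of all functions. The same locale serves
  \<open>ip p\<close> on the whole nuclear space.\<close>

locale inner_product_on =
  fixes V :: "'v::real_vector set" and B :: "'v \<Rightarrow> 'v \<Rightarrow> real"
  assumes subspace_V: "subspace V"
    and add_left: "x \<in> V \<Longrightarrow> y \<in> V \<Longrightarrow> z \<in> V \<Longrightarrow> B (x + y) z = B x z + B y z"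
    and scale_left: "x \<in> V \<Longrightarrow> z \<in> V \<Longrightarrow> B (a *\<^sub>R x) z = a * B x z"
    and commute: "x \<in> V \<Longrightarrow> z \<in> V \<Longrightarrow> B x z = B z x"
    and pos: "x \<in> V \<Longrightarrow> x \<noteq> 0 \<Longrightarrow> 0 < B x x"
begin

lemma V_closed [simp, intro]:
  "0 \<in> V" "x \<in> V \<Longrightarrow> y \<in> V \<Longrightarrow> x + y \<in> V" "x \<in> V \<Longrightarrow> a *\<^sub>R x \<in> V"
  "x \<in> V \<Longrightarrow> y \<in> V \<Longrightarrow> x - y \<in> V" "(\<And>i. i \<in> I \<Longrightarrow> f i \<in> V) \<Longrightarrow> (\<Sum>i\<in>I. f i) \<in> V"
  using subspace_V by (auto intro: subspace_0 subspace_add subspace_scale subspace_diff subspace_sum)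

lemma zero_left [simp]: "z \<in> V \<Longrightarrow> B 0 z = 0"
  using scale_left[of 0 z 0] by simp

lemma diff_left: "x \<in> V \<Longrightarrow> y \<in> V \<Longrightarrow> z \<in> V \<Longrightarrow> B (x - y) z = B x z - B y z"
  using add_left[of "x - y" y z] by simp

lemma sum_left: "(\<And>i. i \<in> I \<Longrightarrow> f i \<in> V) \<Longrightarrow> z \<in> V \<Longrightarrow> B (\<Sum>i\<in>I. f i) z = (\<Sum>i\<in>I. B (f i) z)"
  by (induction I rule: infinite_finite_induct) (auto simp: add_left)

lemma nonneg: "x \<in> V \<Longrightarrow> 0 \<le> B x x"
  using pos[of x] by (cases "x = 0") auto

lemma add_right: "x \<in> V \<Longrightarrow> y \<in> V \<Longrightarrow> z \<in> V \<Longrightarrow> B z (x + y) = B z x + B z y"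
  by (simp add: commute[of z] add_left)

lemma diff_right: "x \<in> V \<Longrightarrow> y \<in> V \<Longrightarrow> z \<in> V \<Longrightarrow> B z (x - y) = B z x - B z y"
  by (simp add: commute[of z] diff_left)

lemma scale_right: "x \<in> V \<Longrightarrow> z \<in> V \<Longrightarrow> B z (a *\<^sub>R x) = a * B z x"
  by (simp add: commute[of z] scale_left)

lemma sum_right: "(\<And>i. i \<in> I \<Longrightarrow> f i \<in> V) \<Longrightarrow> z \<in> V \<Longrightarrow> B z (\<Sum>i\<in>I. f i) = (\<Sum>i\<in>I. B z (f i))"
  by (simp add: commute[of z] sum_left)

lemma cauchy_schwarz_squared:
  assumes "x \<in> V" "y \<in> V"
  shows "(B x y)\<^sup>2 \<le> B x x * B y y"
proof (cases "y = 0")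
  case True
  then show ?thesis using assms by (simp add: commute[of x 0])
next
  case False
  then have y: "B y y > 0" using pos assms by simp
  define t where "t = B x y / B y y"
  have "0 \<le> B (x - t *\<^sub>R y) (x - t *\<^sub>R y)" using assms by (intro nonneg) auto
  also have "\<dots> = B x x - 2 * t * B x y + t\<^sup>2 * B y y"
    using assms by (simp add: diff_left diff_right scale_left scale_right commute[of y x]
        power2_eq_square algebra_simps)
  also have "\<dots> = B x x - (B x y)\<^sup>2 / B y y"
    using y by (simp add: t_def power2_eq_square field_simps)
  finally show ?thesis using y by (simp add: field_simps)
qed

lemma cauchy_schwarz: "x \<in> V \<Longrightarrow> y \<in> V \<Longrightarrow> \<bar>B x y\<bar> \<le> sqrt (B x x) * sqrt (B y y)"
  using real_sqrt_le_mono[OF cauchy_schwarz_squared, of x y] by (simp add: real_sqrt_mult)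

definition orthonormal :: "'v set \<Rightarrow> bool" where
  "orthonormal E \<longleftrightarrow> finite E \<and> E \<subseteq> V \<and> (\<forall>e\<in>E. \<forall>e'\<in>E. B e e' = (if e = e' then 1 else 0))"

lemma orthonormalD:
  assumes "orthonormal E"
  shows "finite E" "e \<in> E \<Longrightarrow> e \<in> V" "e \<in> E \<Longrightarrow> e' \<in> E \<Longrightarrow> B e e' = (if e = e' then 1 else 0)"
  using assms by (auto simp: orthonormal_def)

lemma span_V: "E \<subseteq> V \<Longrightarrow> x \<in> span E \<Longrightarrow> x \<in> V"
  using span_minimal[OF _ subspace_V] by blast

lemma sum_coeff:
  assumes "orthonormal E" "e \<in> E"
  shows "B (\<Sum>e\<in>E. c e *\<^sub>R e) e = c e"
proof -
  have "B (\<Sum>e\<in>E. c e *\<^sub>R e) e = (\<Sum>e'\<in>E. if e = e' then c e' else 0)"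
    using orthonormalD(2)[OF assms(1)] assms(2) orthonormalD(3)[OF assms(1) _ assms(2)]
    by (subst sum_left) (auto simp: scale_left intro!: sum.cong)
  then show ?thesis using orthonormalD(1)[OF assms(1)] assms(2) by simp
qed

lemma expansion:
  assumes "orthonormal E" "x \<in> span E"
  shows "x = (\<Sum>e\<in>E. B x e *\<^sub>R e)"
proof -
  obtain c where "x = (\<Sum>e\<in>E. c e *\<^sub>R e)"
    using assms span_finite[of E] orthonormalD(1) by blast
  then show ?thesis using sum_coeff[OF assms(1)] by (simp cong: sum.cong)
qed

lemma sum_norm:
  assumes "orthonormal E"
  shows "B (\<Sum>e\<in>E. c e *\<^sub>R e) (\<Sum>e\<in>E. c e *\<^sub>R e) = (\<Sum>e\<in>E. (c e)\<^sup>2)"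
proof -
  have "B (\<Sum>e\<in>E. c e *\<^sub>R e) (\<Sum>e\<in>E. c e *\<^sub>R e) = (\<Sum>e\<in>E. c e * B (\<Sum>e\<in>E. c e *\<^sub>R e) e)"
    using orthonormalD[OF assms] by (subst sum_right) (auto simp: scale_right)
  also have "\<dots> = (\<Sum>e\<in>E. (c e)\<^sup>2)"
    by (intro sum.cong refl) (simp only: sum_coeff[OF assms] power2_eq_square)
  finally show ?thesis .
qed

lemma parseval:
  assumes "orthonormal E" "x \<in> span E"
  shows "B x x = (\<Sum>e\<in>E. (B x e)\<^sup>2)"
  using sum_norm[OF assms(1), of "B x"] expansion[OF assms] by simp

lemma residual:
  assumes "orthonormal E" "x \<in> V"
  defines "r \<equiv> x - (\<Sum>e\<in>E. B x e *\<^sub>R e)"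
  shows "r \<in> V" "e \<in> E \<Longrightarrow> B r e = 0" "B r r = B x x - (\<Sum>e\<in>E. (B x e)\<^sup>2)"
proof -
  let ?s = "\<Sum>e\<in>E. B x e *\<^sub>R e"
  have sV: "?s \<in> V" using orthonormalD[OF assms(1)] by auto
  show rV: "r \<in> V" using sV assms(2) by (auto simp: r_def)
  show r0: "B r e = 0" if "e \<in> E" for e
    using sum_coeff[OF assms(1) that, of "B x"] that orthonormalD[OF assms(1)] assms(2) sV
    by (simp add: r_def diff_left)
  have "B x ?s = (\<Sum>e\<in>E. (B x e)\<^sup>2)"
    using orthonormalD[OF assms(1)] assms(2)
    by (subst sum_right) (auto simp: scale_right power2_eq_square)
  then show "B r r = B x x - (\<Sum>e\<in>E. (B x e)\<^sup>2)"
    using sum_norm[OF assms(1), of "B x"] sV assms(2)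
    by (simp add: r_def diff_left diff_right commute[of ?s x])
qed

text \<open>One Gram-Schmidt step. That u lies outside E matters when a sum over
  \<open>insert u E\<close> has to split off its new term.\<close>

lemma orthonormal_insert_residual:
  assumes "orthonormal E" "x \<in> V"
  defines "r \<equiv> x - (\<Sum>e\<in>E. B x e *\<^sub>R e)"
  assumes "r \<noteq> 0"
  defines "u \<equiv> (1 / sqrt (B r r)) *\<^sub>R r"
  shows "orthonormal (insert u E)" "u \<notin> E"
proof -
  note r = residual[OF assms(1,2), folded r_def]
  have rr: "B r r > 0" using pos r(1) assms(4) by simp
  have uV: "u \<in> V" using r by (simp add: u_def)
  have uu: "B u u = 1"
    using rr r(1) by (simp add: u_def scale_left scale_right)
  have ue: "B u e = 0" "B e u = 0" if "e \<in> E" for e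
    using r that orthonormalD[OF assms(1)] uV by (auto simp: u_def scale_left scale_right commute[of e])
  show "orthonormal (insert u E)" "u \<notin> E"
    using uu ue uV assms(1) by (auto simp: orthonormal_def)
qed

text \<open>Gram-Schmidt started from E. This takes the place of orthonormal bases: whatever
  finitely many vectors an argument involves, one finite system spans them.\<close>

lemma orthonormal_extend:
  assumes "orthonormal E" "finite X" "X \<subseteq> V"
  shows "\<exists>E'. orthonormal E' \<and> E \<subseteq> E' \<and> X \<subseteq> span E' \<and> E' \<subseteq> span (E \<union> X)"
  using assms(2,3)
proof (induction X rule: finite_induct)
  case empty
  then show ?case using assms(1) by (intro exI[of _ E]) (auto intro: span_base)
next
  case (insert x X)
  then obtain E' where E': "orthonormal E'" "E \<subseteq> E'" "X \<subseteq> span E'" "E' \<subseteq> span (E \<union> X)" by auto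
  define r where "r = x - (\<Sum>e\<in>E'. B x e *\<^sub>R e)"
  have sub: "span (E \<union> X) \<subseteq> span (E \<union> insert x X)" by (intro span_mono) auto
  have s: "(\<Sum>e\<in>E'. B x e *\<^sub>R e) \<in> span E'" by (intro span_sum span_scale span_base)
  show ?case
  proof (cases "r = 0")
    case True
    then have "x \<in> span E'" using s by (simp add: r_def)
    then show ?thesis using E' sub by (intro exI[of _ E']) auto
  next
    case False
    define u where "u = (1 / sqrt (B r r)) *\<^sub>R r"
    have xV: "x \<in> V" using insert by simp
    have rr: "B r r > 0" using pos residual(1)[OF E'(1) xV] False by (simp add: r_def)
    have "x = (\<Sum>e\<in>E'. B x e *\<^sub>R e) + sqrt (B r r) *\<^sub>R u"
      using rr by (simp add: u_def r_def)
    also have "\<dots> \<in> span (insert u E')"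
      using s span_mono[of E' "insert u E'"] by (intro span_add) (auto intro: span_scale span_base)
    finally have x: "x \<in> span (insert u E')" .
    have "u \<in> span (E \<union> insert x X)"
      unfolding u_def r_def using s E'(4) sub span_minimal[OF _ subspace_span, of E' "E \<union> insert x X"]
      by (intro span_scale span_diff) (auto intro: span_base)
    then show ?thesis
      using orthonormal_insert_residual(1)[OF E'(1) xV, folded r_def, OF False, folded u_def] x E' sub
        span_mono[of E' "insert u E'"]
      by (intro exI[of _ "insert u E'"]) auto
  qed
qed

end

section \<open>The dual norms are Hilbertian\<close>

context nuclear_triple
begin

abbreviation hn :: "nat \<Rightarrow> 'n \<Rightarrow> real" where "hn \<equiv> hnorm ip"
abbreviation dn :: "nat \<Rightarrow> ('n \<Rightarrow> real) \<Rightarrow> real" where "dn \<equiv> dual_norm ip"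

lemma linear_ip: "linear (ip p \<xi>)"
  using ip_bilinear[of p] by (simp add: bilinear_def)

sublocale N: inner_product_on UNIV "ip p" for p
  by unfold_locales
    (auto simp: bilinear_ladd[OF ip_bilinear] bilinear_lmul[OF ip_bilinear] ip_pos intro: ip_sym)

lemma hn_nonneg [simp]: "0 \<le> hn p \<xi>"
  by (simp add: hnorm_def N.nonneg)

lemma hn_pos: "\<xi> \<noteq> 0 \<Longrightarrow> 0 < hn p \<xi>"
  by (simp add: hnorm_def N.pos)

lemma hn_zero [simp]: "hn p 0 = 0"
  by (simp add: hnorm_def)

lemma hn_square: "(hn p \<xi>)\<^sup>2 = ip p \<xi> \<xi>"
  by (simp add: hnorm_def N.nonneg)

lemma hn_scale: "hn p (a *\<^sub>R \<xi>) = \<bar>a\<bar> * hn p \<xi>"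
proof -
  have "ip p (a *\<^sub>R \<xi>) (a *\<^sub>R \<xi>) = a\<^sup>2 * ip p \<xi> \<xi>"
    by (simp add: N.scale_left N.scale_right power2_eq_square)
  then show ?thesis by (simp add: hnorm_def real_sqrt_mult)
qed

lemma ip_le: "\<bar>ip p \<xi> \<eta>\<bar> \<le> hn p \<xi> * hn p \<eta>"
  using N.cauchy_schwarz by (simp add: hnorm_def)

lemma hdualI: "linear x \<Longrightarrow> (\<And>\<xi>. \<bar>x \<xi>\<bar> \<le> C * hn p \<xi>) \<Longrightarrow> x \<in> hdual ip p"
  by (auto simp: hdual_def)

lemma hdual_linear: "x \<in> hdual ip p \<Longrightarrow> linear x"
  by (simp add: hdual_def)

lemma dn_bdd: "x \<in> hdual ip p \<Longrightarrow> bdd_above {\<bar>x \<xi>\<bar> | \<xi>. hn p \<xi> \<le> 1}"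
proof -
  assume "x \<in> hdual ip p"
  then obtain C where C: "\<And>\<xi>. \<bar>x \<xi>\<bar> \<le> C * hn p \<xi>" by (auto simp: hdual_def)
  have "\<bar>x \<xi>\<bar> \<le> \<bar>C\<bar>" if "hn p \<xi> \<le> 1" for \<xi>
  proof -
    have "C * hn p \<xi> \<le> \<bar>C\<bar> * 1" using that by (intro mult_mono) auto
    then show ?thesis using C[of \<xi>] by simp
  qed
  then show ?thesis by (intro bdd_aboveI[of _ "\<bar>C\<bar>"]) auto
qed

lemma dn_bound:
  assumes "x \<in> hdual ip p"
  shows "\<bar>x \<xi>\<bar> \<le> dn p x * hn p \<xi>"
proof (cases "\<xi> = 0")
  case True
  then show ?thesis using assms by (simp add: hdual_def linear_0)
next
  case False
  then have h: "hn p \<xi> > 0" by (rule hn_pos)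
  have "\<bar>x ((1 / hn p \<xi>) *\<^sub>R \<xi>)\<bar> \<le> dn p x"
    unfolding dual_norm_def using h
    by (intro cSup_upper dn_bdd assms CollectI exI[of _ "(1 / hn p \<xi>) *\<^sub>R \<xi>"]) (auto simp: hn_scale)
  moreover have "x ((1 / hn p \<xi>) *\<^sub>R \<xi>) = x \<xi> / hn p \<xi>"
    using assms by (simp add: hdual_def linear_cmul)
  ultimately show ?thesis using h by (simp add: field_simps)
qed

lemma dn_least: "0 \<le> C \<Longrightarrow> (\<And>\<xi>. \<bar>x \<xi>\<bar> \<le> C * hn p \<xi>) \<Longrightarrow> dn p x \<le> C"
  unfolding dual_norm_def
proof (rule cSup_least)
  show "{\<bar>x \<xi>\<bar> |\<xi>. hn p \<xi> \<le> 1} \<noteq> {}" by (auto intro!: exI[of _ 0])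
next
  fix v assume "0 \<le> C" "\<And>\<xi>. \<bar>x \<xi>\<bar> \<le> C * hn p \<xi>" "v \<in> {\<bar>x \<xi>\<bar> |\<xi>. hn p \<xi> \<le> 1}"
  then show "v \<le> C" by (smt (verit) mem_Collect_eq mult_left_le)
qed

lemma dn_nonneg: "x \<in> hdual ip p \<Longrightarrow> 0 \<le> dn p x"
  unfolding dual_norm_def
  by (rule order_trans[OF abs_ge_zero[of "x 0"]]) (rule cSup_upper, auto intro!: dn_bdd exI[of _ 0])

lemma subspace_hdual: "subspace (hdual ip p)"
proof (rule subspaceI)
  show "0 \<in> hdual ip p"
    by (rule hdualI[of _ 0]) (auto simp: zero_fun_def linear_zero)
next
  fix x z assume xz: "x \<in> hdual ip p" "z \<in> hdual ip p"
  have "\<bar>(x + z) \<xi>\<bar> \<le> (dn p x + dn p z) * hn p \<xi>" for \<xi>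
    using dn_bound[OF xz(1), of \<xi>] dn_bound[OF xz(2), of \<xi>] by (simp add: distrib_right)
  moreover have "linear (x + z)"
    using xz linear_compose_add[of x z] by (simp add: hdual_def plus_fun_def)
  ultimately show "x + z \<in> hdual ip p" by (rule hdualI[rotated])
next
  fix a x assume x: "x \<in> hdual ip p"
  have "\<bar>(a *\<^sub>R x) \<xi>\<bar> \<le> (\<bar>a\<bar> * dn p x) * hn p \<xi>" for \<xi>
    using mult_left_mono[OF dn_bound[OF x, of \<xi>], of "\<bar>a\<bar>"] by (simp add: abs_mult mult.assoc)
  moreover have "linear (a *\<^sub>R x)"
    using x linear_compose_scale_right[of x a] by (simp add: hdual_def scaleR_fun_def)
  ultimately show "a *\<^sub>R x \<in> hdual ip p" by (rule hdualI[rotated])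
qed

lemmas hdual_closed [simp, intro] = subspace_0[OF subspace_hdual] subspace_add[OF subspace_hdual]
  subspace_scale[OF subspace_hdual] subspace_diff[OF subspace_hdual] subspace_sum[OF subspace_hdual]

lemma dn_triangle:
  assumes "x \<in> hdual ip p" "z \<in> hdual ip p"
  shows "dn p (x + z) \<le> dn p x + dn p z"
proof (rule dn_least)
  fix \<xi>
  show "\<bar>(x + z) \<xi>\<bar> \<le> (dn p x + dn p z) * hn p \<xi>"
    using dn_bound[OF assms(1), of \<xi>] dn_bound[OF assms(2), of \<xi>] by (simp add: distrib_right)
qed (use assms dn_nonneg in auto)

lemma dn_scale_le:
  assumes "x \<in> hdual ip p"
  shows "dn p (a *\<^sub>R x) \<le> \<bar>a\<bar> * dn p x"
proof (rule dn_least)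
  fix \<xi>
  show "\<bar>(a *\<^sub>R x) \<xi>\<bar> \<le> (\<bar>a\<bar> * dn p x) * hn p \<xi>"
    using mult_left_mono[OF dn_bound[OF assms, of \<xi>], of "\<bar>a\<bar>"] by (simp add: abs_mult mult.assoc)
qed (use assms dn_nonneg in auto)

lemma dn_minus: "dn p (- x) = dn p x"
  by (simp add: dual_norm_def)

lemma dn_abs_diff:
  assumes "x \<in> hdual ip p" "z \<in> hdual ip p"
  shows "\<bar>dn p x - dn p z\<bar> \<le> dn p (x - z)"
proof -
  have "dn p x \<le> dn p (x - z) + dn p z" "dn p z \<le> dn p (z - x) + dn p x"
    using dn_triangle[of "x - z" p z] dn_triangle[of "z - x" p x] assms by simp_all
  then show ?thesis using dn_minus[of p "x - z"] by simp
qed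

lemma ip_hdual: "ip p \<xi> \<in> hdual ip p"
  using ip_le by (intro hdualI[OF linear_ip, of _ _ "hn p \<xi>"])

lemma dn_zero [simp]: "dn p 0 = 0"
  using dn_scale_le[OF hdual_closed(1), of p 0] dn_nonneg[OF hdual_closed(1), of p] by simp

lemma dn_ip: "dn p (ip p \<xi>) = hn p \<xi>"
proof (rule antisym)
  show "dn p (ip p \<xi>) \<le> hn p \<xi>" by (rule dn_least) (auto simp: ip_le)
  show "hn p \<xi> \<le> dn p (ip p \<xi>)"
    using dn_bound[OF ip_hdual, of p \<xi> \<xi>] hn_pos[of \<xi> p] dn_nonneg[OF ip_hdual, of p \<xi>]
    by (cases "\<xi> = 0") (auto simp: hn_square[symmetric] power2_eq_square)
qed

text \<open>A near-maximizer \<open>\<xi>\<close> of the concave functional \<open>2 x \<xi> - |\<xi>|\<^sup>2\<close> nearly represents \<open>x\<close>.\<close>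

lemma approximate_riesz:
  assumes x: "x \<in> hdual ip p" and "\<delta> > 0"
  shows "\<exists>\<xi>. dn p (x - ip p \<xi>) \<le> \<delta>"
proof -
  define q where "q \<xi> = 2 * x \<xi> - (hn p \<xi>)\<^sup>2" for \<xi>
  have "q \<xi> \<le> (dn p x)\<^sup>2" for \<xi>
  proof -
    have "0 \<le> (dn p x - hn p \<xi>)\<^sup>2" by simp
    then show ?thesis using dn_bound[OF x, of \<xi>] by (simp add: q_def power2_diff)
  qed
  then have bdd: "bdd_above (range q)" by (auto intro!: bdd_aboveI[of _ "(dn p x)\<^sup>2"])
  have "Sup (range q) - \<delta>\<^sup>2 < Sup (range q)" using assms by simp
  then obtain \<xi> where \<xi>: "q \<xi> > Sup (range q) - \<delta>\<^sup>2"
    using less_cSup_iff[OF _ bdd, of "Sup (range q) - \<delta>\<^sup>2"] by auto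
  have "\<bar>(x - ip p \<xi>) \<zeta>\<bar> \<le> \<delta> * hn p \<zeta>" for \<zeta>
  proof (cases "\<zeta> = 0")
    case True
    then show ?thesis using x by (simp add: hdual_def linear_0 N.commute[of \<xi> 0])
  next
    case False
    define a where "a = x \<zeta> - ip p \<xi> \<zeta>"
    have h: "ip p \<zeta> \<zeta> > 0" using False by (rule ip_pos)
    \<comment> \<open>The step length that maximizes the gain of q along \<zeta>. The gain is then
      \<open>a\<^sup>2 / ip p \<zeta> \<zeta>\<close>, and near-maximality of \<xi> bounds it by
      \<open>\<delta>\<^sup>2\<close>.\<close>
    define s where "s = a / ip p \<zeta> \<zeta>"
    have "q (\<xi> + s *\<^sub>R \<zeta>) \<le> Sup (range q)" using bdd by (intro cSup_upper) auto
    then have "q (\<xi> + s *\<^sub>R \<zeta>) - q \<xi> \<le> \<delta>\<^sup>2" using \<xi> by simp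
    moreover have "q (\<xi> + s *\<^sub>R \<zeta>) - q \<xi> = 2 * s * a - s\<^sup>2 * ip p \<zeta> \<zeta>"
      using linear_add[OF hdual_linear[OF x]] linear_cmul[OF hdual_linear[OF x]]
      unfolding q_def hn_square a_def
      by (simp add: N.add_left N.add_right N.scale_left N.scale_right
          N.commute[of \<zeta> \<xi>] power2_eq_square algebra_simps)
    moreover have "\<dots> = a\<^sup>2 / ip p \<zeta> \<zeta>" using h by (simp add: s_def power2_eq_square field_simps)
    ultimately have "a\<^sup>2 / ip p \<zeta> \<zeta> \<le> \<delta>\<^sup>2" by linarith
    then have "a\<^sup>2 \<le> \<delta>\<^sup>2 * ip p \<zeta> \<zeta>" using h by (simp add: pos_divide_le_eq)
    also have "\<dots> = (\<delta> * hn p \<zeta>)\<^sup>2" by (simp add: power_mult_distrib hn_square)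
    finally have "\<bar>a\<bar> \<le> \<delta> * hn p \<zeta>" using assms by (simp add: abs_le_square_iff[symmetric])
    then show ?thesis by (simp add: a_def)
  qed
  then show ?thesis using assms by (intro exI[of _ \<xi>] dn_least) auto
qed

text \<open>The representative of x lies in the completion of the nuclear space for
  \<open>ip p\<close>; a sequence approaching it stands in for it, since only limits of norms and
  inner products are needed.\<close>

definition riesz_seq :: "nat \<Rightarrow> ('n \<Rightarrow> real) \<Rightarrow> (nat \<Rightarrow> 'n) \<Rightarrow> bool" where
  "riesz_seq p x X \<longleftrightarrow> (\<lambda>n. dn p (x - ip p (X n))) \<longlonglongrightarrow> 0"

lemma riesz_seq_ex:
  assumes "x \<in> hdual ip p"
  shows "\<exists>X. riesz_seq p x X"
proof -
  have "\<forall>n. \<exists>\<xi>. dn p (x - ip p \<xi>) \<le> 1 / real (Suc n)"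
    using approximate_riesz[OF assms] by simp
  then obtain X where X: "\<And>n. dn p (x - ip p (X n)) \<le> 1 / real (Suc n)" by metis
  have "(\<lambda>n. dn p (x - ip p (X n))) \<longlonglongrightarrow> 0"
    by (rule tendsto_sandwich[OF _ _ tendsto_const LIMSEQ_inverse_real_of_nat])
      (use X in \<open>auto intro!: dn_nonneg assms ip_hdual hdual_closed always_eventually simp: inverse_eq_divide\<close>)
  then show ?thesis by (auto simp: riesz_seq_def)
qed

lemma ip_add_fun: "ip p (\<xi> + \<eta>) = ip p \<xi> + ip p \<eta>"
  by (auto simp: N.add_left)

lemma ip_scale_fun: "ip p (a *\<^sub>R \<xi>) = a *\<^sub>R ip p \<xi>"
  by (auto simp: N.scale_left)

lemma riesz_seq_comb:
  assumes "x \<in> hdual ip p" "z \<in> hdual ip p" "riesz_seq p x X" "riesz_seq p z Z"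
  shows "riesz_seq p (a *\<^sub>R x + b *\<^sub>R z) (\<lambda>n. a *\<^sub>R X n + b *\<^sub>R Z n)"
  unfolding riesz_seq_def
proof (rule tendsto_sandwich[OF _ _ tendsto_const])
  have "(\<lambda>n. \<bar>a\<bar> * dn p (x - ip p (X n)) + \<bar>b\<bar> * dn p (z - ip p (Z n))) \<longlonglongrightarrow> \<bar>a\<bar> * 0 + \<bar>b\<bar> * 0"
    using assms(3,4) unfolding riesz_seq_def by (intro tendsto_intros)
  then show "(\<lambda>n. \<bar>a\<bar> * dn p (x - ip p (X n)) + \<bar>b\<bar> * dn p (z - ip p (Z n))) \<longlonglongrightarrow> 0" by simp
  have "dn p (a *\<^sub>R x + b *\<^sub>R z - ip p (a *\<^sub>R X n + b *\<^sub>R Z n))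
      \<le> \<bar>a\<bar> * dn p (x - ip p (X n)) + \<bar>b\<bar> * dn p (z - ip p (Z n))" for n
  proof -
    have u: "x - ip p (X n) \<in> hdual ip p" "z - ip p (Z n) \<in> hdual ip p"
      using assms ip_hdual by (auto intro: hdual_closed)
    have "a *\<^sub>R x + b *\<^sub>R z - ip p (a *\<^sub>R X n + b *\<^sub>R Z n)
        = a *\<^sub>R (x - ip p (X n)) + b *\<^sub>R (z - ip p (Z n))"
      by (simp add: ip_add_fun ip_scale_fun algebra_simps)
    then have "dn p (a *\<^sub>R x + b *\<^sub>R z - ip p (a *\<^sub>R X n + b *\<^sub>R Z n))
        \<le> dn p (a *\<^sub>R (x - ip p (X n))) + dn p (b *\<^sub>R (z - ip p (Z n)))"
      using u dn_triangle by (simp add: hdual_closed)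
    then show ?thesis using dn_scale_le[OF u(1), of a] dn_scale_le[OF u(2), of b] by linarith
  qed
  then show "\<forall>\<^sub>F n in sequentially. dn p (a *\<^sub>R x + b *\<^sub>R z - ip p (a *\<^sub>R X n + b *\<^sub>R Z n))
      \<le> \<bar>a\<bar> * dn p (x - ip p (X n)) + \<bar>b\<bar> * dn p (z - ip p (Z n))" by simp
  show "\<forall>\<^sub>F n in sequentially. 0 \<le> dn p (a *\<^sub>R x + b *\<^sub>R z - ip p (a *\<^sub>R X n + b *\<^sub>R Z n))"
    using assms ip_hdual by (intro always_eventually allI dn_nonneg) (auto intro!: hdual_closed)
qed

lemma riesz_seq_norm:
  assumes "x \<in> hdual ip p" "riesz_seq p x X"
  shows "(\<lambda>n. hn p (X n)) \<longlonglongrightarrow> dn p x"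
proof -
  have lim: "(\<lambda>n. dn p (x - ip p (X n))) \<longlonglongrightarrow> 0" using assms(2) by (simp add: riesz_seq_def)
  have "norm (hn p (X n) - dn p x) \<le> dn p (x - ip p (X n))" for n
    using dn_abs_diff[OF assms(1) ip_hdual, of "X n"] by (simp add: dn_ip abs_minus_commute)
  then have "(\<lambda>n. hn p (X n) - dn p x) \<longlonglongrightarrow> 0"
    by (intro Lim_null_comparison[OF _ lim] always_eventually allI)
  then show ?thesis by (rule LIM_zero_cancel)
qed

text \<open>The polarization identity holds for the approximants, and both of its norms converge.
  Through this limit \<open>dual_ip\<close>, defined by norms alone, inherits bilinearity and
  symmetry from \<open>ip p\<close>.\<close>

lemma riesz_seq_dual_ip:
  assumes "x \<in> hdual ip p" "z \<in> hdual ip p" "riesz_seq p x X" "riesz_seq p z Z"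
  shows "(\<lambda>n. ip p (X n) (Z n)) \<longlonglongrightarrow> dual_ip ip p x z"
proof -
  have plus: "(\<lambda>n. hn p (X n + Z n)) \<longlonglongrightarrow> dn p (x + z)"
    using riesz_seq_norm[OF _ riesz_seq_comb[OF assms, of 1 1]] assms by (simp add: hdual_closed)
  have minus: "(\<lambda>n. hn p (X n - Z n)) \<longlonglongrightarrow> dn p (x - z)"
    using riesz_seq_norm[OF _ riesz_seq_comb[OF assms, of 1 "-1"]] assms by (simp add: hdual_closed)
  have pol: "ip p (X n) (Z n) = ((hn p (X n + Z n))\<^sup>2 - (hn p (X n - Z n))\<^sup>2) / 4" for n
    by (simp add: hn_square N.add_left N.add_right N.diff_left N.diff_right N.commute[of "Z n" "X n"])
  have "(\<lambda>n. ip p (X n) (Z n)) \<longlonglongrightarrow> ((dn p (x + z))\<^sup>2 - (dn p (x - z))\<^sup>2) / 4"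
    unfolding pol by (intro tendsto_intros plus minus) auto
  then show ?thesis by (simp add: dual_ip_def plus_fun_def fun_diff_def)
qed

lemma dual_ip_self: "x \<in> hdual ip p \<Longrightarrow> dual_ip ip p x x = (dn p x)\<^sup>2"
proof -
  assume x: "x \<in> hdual ip p"
  obtain X where X: "riesz_seq p x X" using riesz_seq_ex[OF x] by auto
  have "(\<lambda>n. ip p (X n) (X n)) \<longlonglongrightarrow> (dn p x)\<^sup>2"
    unfolding hn_square[symmetric] by (intro tendsto_intros riesz_seq_norm x X)
  then show ?thesis using riesz_seq_dual_ip[OF x x X X] LIMSEQ_unique by blast
qed

lemma dual_ip_comb:
  assumes "x \<in> hdual ip p" "y \<in> hdual ip p" "z \<in> hdual ip p"
  shows "dual_ip ip p (a *\<^sub>R x + b *\<^sub>R y) z = a * dual_ip ip p x z + b * dual_ip ip p y z"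
proof -
  obtain X Y Z where r: "riesz_seq p x X" "riesz_seq p y Y" "riesz_seq p z Z"
    using riesz_seq_ex assms by meson
  have "(\<lambda>n. ip p (a *\<^sub>R X n + b *\<^sub>R Y n) (Z n)) \<longlonglongrightarrow> dual_ip ip p (a *\<^sub>R x + b *\<^sub>R y) z"
    using assms r by (intro riesz_seq_dual_ip riesz_seq_comb) (auto intro: hdual_closed)
  moreover have "(\<lambda>n. a * ip p (X n) (Z n) + b * ip p (Y n) (Z n)) \<longlonglongrightarrow>
      a * dual_ip ip p x z + b * dual_ip ip p y z"
    by (intro tendsto_intros riesz_seq_dual_ip assms r)
  ultimately show ?thesis
    by (simp add: N.add_left N.scale_left) (metis LIMSEQ_unique)
qed

text \<open>Reproducing property: \<open>ip p \<xi>\<close> is represented exactly, by the constant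
  sequence \<xi>, so pairing with it is evaluation at \<xi>.\<close>

lemma dual_ip_ip: "x \<in> hdual ip p \<Longrightarrow> dual_ip ip p x (ip p \<xi>) = x \<xi>"
proof -
  assume x: "x \<in> hdual ip p"
  obtain X where X: "riesz_seq p x X" using riesz_seq_ex[OF x] by auto
  have c: "riesz_seq p (ip p \<xi>) (\<lambda>_. \<xi>)"
    by (simp add: riesz_seq_def)
  have lim: "(\<lambda>n. ip p (X n) \<xi>) \<longlonglongrightarrow> dual_ip ip p x (ip p \<xi>)"
    by (rule riesz_seq_dual_ip[OF x ip_hdual X c])
  have "(\<lambda>n. dn p (x - ip p (X n)) * hn p \<xi>) \<longlonglongrightarrow> 0 * hn p \<xi>"
    using X unfolding riesz_seq_def by (intro tendsto_intros)
  then have lim0: "(\<lambda>n. dn p (x - ip p (X n)) * hn p \<xi>) \<longlonglongrightarrow> 0" by simp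
  have "norm (ip p (X n) \<xi> - x \<xi>) \<le> dn p (x - ip p (X n)) * hn p \<xi>" for n
    using dn_bound[of "x - ip p (X n)" p \<xi>] x ip_hdual by (simp add: hdual_closed abs_minus_commute)
  then have "(\<lambda>n. ip p (X n) \<xi> - x \<xi>) \<longlonglongrightarrow> 0"
    by (intro Lim_null_comparison[OF _ lim0] always_eventually allI)
  then show ?thesis by (rule LIMSEQ_unique[OF lim LIM_zero_cancel])
qed

sublocale D: inner_product_on "hdual ip p" "dual_ip ip p" for p
proof
  fix x z assume xz: "x \<in> hdual ip p" "z \<in> hdual ip p"
  obtain X Z where r: "riesz_seq p x X" "riesz_seq p z Z" using riesz_seq_ex xz by meson
  then show "dual_ip ip p x z = dual_ip ip p z x"
    using riesz_seq_dual_ip[OF xz r] riesz_seq_dual_ip[OF xz(2,1) r(2,1)]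
    by (simp add: N.commute[of "Z _"]) (metis LIMSEQ_unique)
next
  fix x assume x: "x \<in> hdual ip p" "x \<noteq> 0"
  then obtain \<xi> where "x \<xi> \<noteq> 0" by (auto simp: fun_eq_iff)
  then have "dn p x \<noteq> 0" using dn_bound[OF x(1), of \<xi>] by auto
  then show "0 < dual_ip ip p x x" using x by (simp add: dual_ip_self)
next
  fix x z a assume "x \<in> hdual ip p" "z \<in> hdual ip p"
  then show "dual_ip ip p (a *\<^sub>R x) z = a * dual_ip ip p x z"
    using dual_ip_comb[of x p x z a 0] by simp
next
  fix x y z assume "x \<in> hdual ip p" "y \<in> hdual ip p" "z \<in> hdual ip p"
  then show "dual_ip ip p (x + y) z = dual_ip ip p x z + dual_ip ip p y z"
    using dual_ip_comb[of x p y z 1 1] by simp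
qed (rule subspace_hdual)

lemma dual_orthonormal_iff: "dual_orthonormal ip p E \<longleftrightarrow> D.orthonormal p E"
  by (auto simp: dual_orthonormal_def D.orthonormal_def)

end

section \<open>Sums over lists\<close>

definition lists_of :: "'a set \<Rightarrow> nat \<Rightarrow> 'a list set" where
  "lists_of E n = {xs. set xs \<subseteq> E \<and> length xs = n}"

lemma finite_lists_of [simp]: "finite E \<Longrightarrow> finite (lists_of E n)"
  unfolding lists_of_def by (rule finite_lists_length_eq)

lemma lists_of_0 [simp]: "lists_of E 0 = {[]}"
  by (auto simp: lists_of_def)

lemma lists_of_mono: "E \<subseteq> E' \<Longrightarrow> lists_of E n \<subseteq> lists_of E' n"
  by (auto simp: lists_of_def)

lemma sum_lists_of_Suc:
  "(\<Sum>xs\<in>lists_of E (Suc n). h xs) = (\<Sum>x\<in>E. \<Sum>xs\<in>lists_of E n. h (x # xs))"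
proof -
  have eq: "lists_of E (Suc n) = (\<lambda>(x, xs). x # xs) ` (E \<times> lists_of E n)"
    by (force simp: lists_of_def length_Suc_conv image_iff)
  show ?thesis
    unfolding eq sum.cartesian_product
    by (subst sum.reindex) (auto simp: inj_on_def intro!: sum.cong)
qed

lemma sum_lists_of_append:
  "(\<Sum>xs\<in>lists_of E (n + k). h xs) = (\<Sum>xs\<in>lists_of E n. \<Sum>ys\<in>lists_of E k. h (xs @ ys))"
  by (induction n arbitrary: h) (simp_all add: sum_lists_of_Suc)

lemma sum_lists_of_prod:
  fixes h :: "'a \<Rightarrow> 'b::comm_semiring_1"
  shows "(\<Sum>xs\<in>lists_of E n. \<Prod>x\<leftarrow>xs. h x) = (\<Sum>x\<in>E. h x) ^ n"
  by (induction n) (simp_all add: sum_lists_of_Suc sum_distrib_left[symmetric] sum_distrib_right)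

lemma cmod_sum_le_cauchy_schwarz:
  fixes c z :: "'a \<Rightarrow> complex"
  shows "(cmod (\<Sum>i\<in>I. c i * z i))\<^sup>2 \<le> (\<Sum>i\<in>I. (cmod (c i))\<^sup>2) * (\<Sum>i\<in>I. (cmod (z i))\<^sup>2)"
proof -
  have "cmod (\<Sum>i\<in>I. c i * z i) \<le> (\<Sum>i\<in>I. cmod (c i) * cmod (z i))"
    using norm_sum[of "\<lambda>i. c i * z i" I] by (simp add: norm_mult)
  then have "(cmod (\<Sum>i\<in>I. c i * z i))\<^sup>2 \<le> (\<Sum>i\<in>I. cmod (c i) * cmod (z i))\<^sup>2"
    by (intro power_mono) auto
  also have "\<dots> \<le> (\<Sum>i\<in>I. (cmod (c i))\<^sup>2) * (\<Sum>i\<in>I. (cmod (z i))\<^sup>2)"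
    by (rule Cauchy_Schwarz_ineq_sum)
  finally show ?thesis .
qed

text \<open>The sum that \<open>hs_sums\<close> collects, for a single system E. It is kept for
  arbitrary E so that systems can be enlarged and exchanged before a supremum is taken.\<close>

definition hs :: "('n \<Rightarrow> real) set \<Rightarrow> nat \<Rightarrow> 'n form \<Rightarrow> real" where
  "hs E n f = (\<Sum>xs\<in>lists_of E n. (cmod (f xs))\<^sup>2)"

lemma hs_nonneg [simp]: "0 \<le> hs E n f"
  by (simp add: hs_def sum_nonneg)

lemma hs_Suc: "hs E (Suc n) f = (\<Sum>x\<in>E. hs E n (\<lambda>xs. f (x # xs)))"
  by (simp add: hs_def sum_lists_of_Suc)

lemma hs_append: "hs E (n + k) f = (\<Sum>xs\<in>lists_of E n. hs E k (\<lambda>ys. f (xs @ ys)))"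
  by (simp add: hs_def sum_lists_of_append)

lemma hs_mono: "finite E' \<Longrightarrow> E \<subseteq> E' \<Longrightarrow> hs E n f \<le> hs E' n f"
  unfolding hs_def by (intro sum_mono2 lists_of_mono) auto

lemma sqrt_hs: "sqrt (hs E n f) = L2_set (\<lambda>xs. cmod (f xs)) (lists_of E n)"
  by (simp add: hs_def L2_set_def)

lemma sqrt_hs_triangle: "sqrt (hs E n (\<lambda>xs. f xs + g xs)) \<le> sqrt (hs E n f) + sqrt (hs E n g)"
proof -
  have "L2_set (\<lambda>xs. cmod (f xs + g xs)) (lists_of E n)
      \<le> L2_set (\<lambda>xs. cmod (f xs) + cmod (g xs)) (lists_of E n)"
    by (intro L2_set_mono norm_triangle_ineq) auto
  also have "\<dots> \<le> L2_set (\<lambda>xs. cmod (f xs)) (lists_of E n) + L2_set (\<lambda>xs. cmod (g xs)) (lists_of E n)"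
    by (rule L2_set_triangle_ineq)
  finally show ?thesis by (simp add: sqrt_hs)
qed

lemma hs_scale: "hs E n (\<lambda>xs. a * f xs) = (cmod a)\<^sup>2 * hs E n f"
  by (simp add: hs_def norm_mult power_mult_distrib sum_distrib_left)

section \<open>Multilinear forms on the dual space\<close>

context nuclear_triple
begin

text \<open>One-element orthonormal systems show that the operator norm is at most the
  Hilbert-Schmidt norm.\<close>

lemma hs_embedding_bound:
  assumes "hs_embedding ip q p"
  shows "\<exists>c\<ge>1. \<forall>\<xi>. hn p \<xi> \<le> c * hn q \<xi>"
proof -
  obtain C where C: "\<And>E. N.orthonormal q E \<Longrightarrow> (\<Sum>e\<in>E. (hn p e)\<^sup>2) \<le> C"
    using assms unfolding hs_embedding_def N.orthonormal_def by (auto 4 3)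
  have "hn p \<xi> \<le> max 1 (sqrt C) * hn q \<xi>" for \<xi>
  proof (cases "\<xi> = 0")
    case False
    then have h: "hn q \<xi> > 0" by (rule hn_pos)
    define e where "e = (1 / hn q \<xi>) *\<^sub>R \<xi>"
    have "ip q e e = 1"
      using h by (simp add: hn_square[symmetric]) (simp add: e_def hn_scale)
    then have "(hn p e)\<^sup>2 \<le> C" using C[of "{e}"] by (simp add: N.orthonormal_def)
    then have "hn p e \<le> sqrt C" by (rule real_le_rsqrt)
    also have "\<dots> \<le> max 1 (sqrt C)" by simp
    finally show ?thesis using h by (simp add: e_def hn_scale field_simps)
  qed simp
  then show ?thesis by (intro exI[of _ "max 1 (sqrt C)"]) auto
qed

text \<open>The norms need not increase with the index, so comparison up to a constant replaces the
  order of the indices.\<close>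

definition dominates :: "nat \<Rightarrow> nat \<Rightarrow> bool" where
  "dominates q p \<longleftrightarrow> (\<exists>c\<ge>1. \<forall>\<xi>. hn p \<xi> \<le> c * hn q \<xi>)"

lemma dominates_refl [simp]: "dominates p p"
  unfolding dominates_def by (intro exI[of _ 1]) auto

lemma dominates_trans: "dominates r q \<Longrightarrow> dominates q p \<Longrightarrow> dominates r p"
  unfolding dominates_def
proof (elim exE conjE)
  fix c d :: real
  assume *: "1 \<le> c" "1 \<le> d" "\<forall>\<xi>. hn q \<xi> \<le> c * hn r \<xi>" "\<forall>\<xi>. hn p \<xi> \<le> d * hn q \<xi>"
  have "hn p \<xi> \<le> (d * c) * hn r \<xi>" for \<xi>
  proof -
    have "hn p \<xi> \<le> d * hn q \<xi>" using * by simp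
    also have "\<dots> \<le> d * (c * hn r \<xi>)" using * by (intro mult_left_mono) auto
    finally show ?thesis by (simp add: mult.assoc)
  qed
  moreover have "1 \<le> d * c" using *(1,2) mult_mono[of 1 d 1 c] by simp
  ultimately show "\<exists>c\<ge>1. \<forall>\<xi>. hn p \<xi> \<le> c * hn r \<xi>" by blast
qed

lemma hs_directed: "\<exists>q. hs_embedding ip q p1 \<and> hs_embedding ip q p2 \<and> dominates q p1 \<and> dominates q p2"
  using nuclear[of p1 p2] hs_embedding_bound unfolding dominates_def by blast

lemma directed: "\<exists>q. dominates q p1 \<and> dominates q p2"
  using hs_directed by blast

lemma hdual_bound:
  assumes "\<And>\<xi>. hn p \<xi> \<le> c * hn q \<xi>" "0 \<le> c" "x \<in> hdual ip p"
  shows "x \<in> hdual ip q" "dn q x \<le> c * dn p x"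
proof -
  have *: "\<bar>x \<xi>\<bar> \<le> (c * dn p x) * hn q \<xi>" for \<xi>
  proof -
    have "\<bar>x \<xi>\<bar> \<le> dn p x * hn p \<xi>" by (rule dn_bound[OF assms(3)])
    also have "\<dots> \<le> dn p x * (c * hn q \<xi>)" using assms dn_nonneg by (intro mult_left_mono) auto
    finally show ?thesis by (simp add: algebra_simps)
  qed
  show "x \<in> hdual ip q" by (rule hdualI[OF hdual_linear[OF assms(3)] *])
  show "dn q x \<le> c * dn p x" using assms dn_nonneg * by (intro dn_least) auto
qed

lemma dominates_hdual: "dominates q p \<Longrightarrow> hdual ip p \<subseteq> hdual ip q"
  unfolding dominates_def by (auto intro: hdual_bound(1))

lemma dualI: "x \<in> hdual ip p \<Longrightarrow> x \<in> dual ip"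
  by (auto simp: dual_def)

text \<open>The spaces \<open>hdual ip q\<close> form a directed union. Having q beyond a prescribed
  p lets one index serve the functionals and a norm at the same time.\<close>

lemma finite_subset_dual:
  assumes "finite X" "X \<subseteq> dual ip"
  shows "\<exists>q. dominates q p \<and> X \<subseteq> hdual ip q"
  using assms
proof (induction X rule: finite_induct)
  case empty
  then show ?case using dominates_refl by blast
next
  case (insert x X)
  then obtain q r where "dominates q p" "X \<subseteq> hdual ip q" "x \<in> hdual ip r" by (auto simp: dual_def)
  moreover obtain s where "dominates s q" "dominates s r" using directed by blast
  ultimately show ?case using dominates_hdual dominates_trans by blast
qed

lemma subspace_dual: "subspace (dual ip)"
proof (rule subspaceI)
  show "0 \<in> dual ip" by (rule dualI[OF hdual_closed(1)])
next
  fix x z assume "x \<in> dual ip" "z \<in> dual ip"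
  then obtain q where "{x, z} \<subseteq> hdual ip q" using finite_subset_dual[of "{x, z}" 0] by auto
  then show "x + z \<in> dual ip" by (intro dualI[of _ q]) auto
next
  fix c x assume "x \<in> dual ip"
  then show "c *\<^sub>R x \<in> dual ip" by (auto simp: dual_def)
qed

lemmas dual_closed [simp, intro] = subspace_0[OF subspace_dual] subspace_add[OF subspace_dual]
  subspace_scale[OF subspace_dual] subspace_diff[OF subspace_dual] subspace_sum[OF subspace_dual]

lemma dual_linear: "x \<in> dual ip \<Longrightarrow> linear x"
  by (auto simp: dual_def hdual_def)

lemma ip_dual: "ip p \<xi> \<in> dual ip"
  by (rule dualI[OF ip_hdual])

text \<open>Real-linearity is asked only on the dual space, because forms are cut off to 0 outside
  it.\<close>

definition dual_linear_map :: "(('n \<Rightarrow> real) \<Rightarrow> complex) \<Rightarrow> bool" where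
  "dual_linear_map g \<longleftrightarrow> (\<forall>x\<in>dual ip. \<forall>z\<in>dual ip. \<forall>a b.
     g (a *\<^sub>R x + b *\<^sub>R z) = of_real a * g x + of_real b * g z)"

lemma dual_linear_map_sum:
  assumes "dual_linear_map g" "finite I" "\<And>i. i \<in> I \<Longrightarrow> h i \<in> dual ip"
  shows "g (\<Sum>i\<in>I. c i *\<^sub>R h i) = (\<Sum>i\<in>I. of_real (c i) * g (h i))"
  using assms(2,3)
proof (induction I rule: finite_induct)
  case empty
  have "g (0 *\<^sub>R 0 + 0 *\<^sub>R 0) = of_real 0 * g 0 + of_real 0 * g 0"
    using assms(1) unfolding dual_linear_map_def by blast
  then have "g 0 = 0" by simp
  then show ?case by (simp only: sum.empty)
next
  case (insert i I)
  have "g (c i *\<^sub>R h i + 1 *\<^sub>R (\<Sum>i\<in>I. c i *\<^sub>R h i))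
      = of_real (c i) * g (h i) + of_real 1 * g (\<Sum>i\<in>I. c i *\<^sub>R h i)"
    using assms(1)[unfolded dual_linear_map_def, rule_format, of "h i" "\<Sum>i\<in>I. c i *\<^sub>R h i" "c i" 1]
      insert.prems by auto
  moreover have "g (\<Sum>i\<in>I. c i *\<^sub>R h i) = (\<Sum>i\<in>I. of_real (c i) * g (h i))"
    using insert.IH insert.prems by blast
  ultimately show ?case
    by (simp only: sum.insert[OF insert.hyps] scaleR_one of_real_1 mult_1)
qed

text \<open>For real \<open>g\<close>, apply the bound on \<open>A\<close> to \<open>\<Sum>e\<in>E. g (A e) *\<^sub>R e\<close>.\<close>

lemma hs_slot:
  assumes E: "D.orthonormal r E" and E': "D.orthonormal s E'"
    and A: "linear A" "\<And>e. e \<in> E \<Longrightarrow> A e \<in> span E'" "\<And>x. x \<in> hdual ip r \<Longrightarrow> dn s (A x) \<le> a * dn r x"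
    and g: "dual_linear_map g" and a: "0 \<le> a"
  shows "(\<Sum>e\<in>E. (cmod (g (A e)))\<^sup>2) \<le> a\<^sup>2 * (\<Sum>e\<in>E'. (cmod (g e))\<^sup>2)"
proof -
  note E = D.orthonormalD[OF E] E and E' = D.orthonormalD[OF E'] E'
  have dual: "e \<in> dual ip" if "e \<in> E \<union> E'" for e
    using that E E' dualI by blast
  have AE: "A e \<in> hdual ip s" if "e \<in> E" for e
    using A(2)[OF that] D.span_V[of E' s] E' by blast
  have real: "(\<Sum>e\<in>E. (h (A e))\<^sup>2) \<le> a\<^sup>2 * (\<Sum>e\<in>E'. (h e)\<^sup>2)"
    if h: "\<And>c k (I :: ('n \<Rightarrow> real) set). finite I \<Longrightarrow> (\<And>i. i \<in> I \<Longrightarrow> k i \<in> dual ip) \<Longrightarrow> h (\<Sum>i\<in>I. c i *\<^sub>R k i) = (\<Sum>i\<in>I. c i * h (k i))"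
    for h :: "_ \<Rightarrow> real"
  proof -
    define S where "S = (\<Sum>e\<in>E. (h (A e))\<^sup>2)"
    define v where "v = (\<Sum>e\<in>E. h (A e) *\<^sub>R e)"
    have v: "v \<in> hdual ip r" using E by (auto simp: v_def)
    have Av: "A v = (\<Sum>e\<in>E. h (A e) *\<^sub>R A e)"
      using A(1) by (simp add: v_def linear_sum linear_cmul)
    have Avs: "A v \<in> span E'" unfolding Av using A(2) by (intro span_sum span_scale)
    have Avd: "A v \<in> hdual ip s" using D.span_V[OF _ Avs] E' by blast
    have "S = h (A v)"
      unfolding Av S_def power2_eq_square using E(1) AE dualI by (intro h[symmetric]) blast+
    also have "\<dots> = (\<Sum>e\<in>E'. dual_ip ip s (A v) e * h e)"
      using dual E' by (subst D.expansion[OF E'(4) Avs]) (rule h, auto)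
    finally have "S\<^sup>2 = (\<Sum>e\<in>E'. dual_ip ip s (A v) e * h e)\<^sup>2" by simp
    also have "\<dots> \<le> (\<Sum>e\<in>E'. (dual_ip ip s (A v) e)\<^sup>2) * (\<Sum>e\<in>E'. (h e)\<^sup>2)"
      by (rule Cauchy_Schwarz_ineq_sum)
    also have "(\<Sum>e\<in>E'. (dual_ip ip s (A v) e)\<^sup>2) = (dn s (A v))\<^sup>2"
      using D.parseval[OF E'(4) Avs] dual_ip_self[OF Avd] by simp
    also have "\<dots> \<le> (a * dn r v)\<^sup>2"
      using A(3)[OF v] dn_nonneg[OF Avd] by (intro power_mono)
    also have "\<dots> = a\<^sup>2 * S"
      using D.sum_norm[OF E(4), of "\<lambda>e. h (A e)"] dual_ip_self[OF v]
      by (simp add: v_def S_def power_mult_distrib)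
    finally have "S * S \<le> S * (a\<^sup>2 * (\<Sum>e\<in>E'. (h e)\<^sup>2))"
      by (simp add: power2_eq_square mult_right_mono sum_nonneg algebra_simps)
    moreover have "0 \<le> S" by (simp add: S_def sum_nonneg)
    ultimately have "S \<le> a\<^sup>2 * (\<Sum>e\<in>E'. (h e)\<^sup>2)"
      by (cases "S = 0") (auto simp: sum_nonneg mult_le_cancel_left)
    then show ?thesis by (simp add: S_def)
  qed
  \<comment> \<open>The auxiliary vector built from the values of g needs real coefficients, so real
    and imaginary part are estimated separately and their squares added.\<close>
  have "(\<Sum>e\<in>E. (Re (g (A e)))\<^sup>2) \<le> a\<^sup>2 * (\<Sum>e\<in>E'. (Re (g e))\<^sup>2)"
    by (intro real) (simp add: dual_linear_map_sum[OF g])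
  moreover have "(\<Sum>e\<in>E. (Im (g (A e)))\<^sup>2) \<le> a\<^sup>2 * (\<Sum>e\<in>E'. (Im (g e))\<^sup>2)"
    by (intro real) (simp add: dual_linear_map_sum[OF g])
  ultimately show ?thesis by (simp add: cmod_power2 sum.distrib algebra_simps)
qed

section \<open>Multilinear forms and exchange of orthonormal systems\<close>

definition multilinear :: "nat \<Rightarrow> 'n form \<Rightarrow> bool" where
  "multilinear n f \<longleftrightarrow> (\<forall>us vs. length us + Suc (length vs) = n \<and> set us \<subseteq> dual ip \<and> set vs \<subseteq> dual ip \<longrightarrow>
     dual_linear_map (\<lambda>x. f (us @ x # vs)))"

lemma multilinearD:
  "multilinear n f \<Longrightarrow> length us + Suc (length vs) = n \<Longrightarrow> set us \<subseteq> dual ip \<Longrightarrow> set vs \<subseteq> dual ip \<Longrightarrow>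
     dual_linear_map (\<lambda>x. f (us @ x # vs))"
  unfolding multilinear_def by blast

lemma multilinear_Cons:
  "multilinear (Suc n) f \<Longrightarrow> length xs = n \<Longrightarrow> set xs \<subseteq> dual ip \<Longrightarrow> dual_linear_map (\<lambda>x. f (x # xs))"
  using multilinearD[of "Suc n" f "[]" xs] by simp

lemma multilinear_append:
  assumes "multilinear (n + k) f" "set xs \<subseteq> dual ip" "length xs = n"
  shows "multilinear k (\<lambda>ys. f (xs @ ys))"
  unfolding multilinear_def
proof (intro allI impI)
  fix us vs assume "length us + Suc (length vs) = k \<and> set us \<subseteq> dual ip \<and> set vs \<subseteq> dual ip"
  then show "dual_linear_map (\<lambda>x. f (xs @ us @ x # vs))"
    using multilinearD[OF assms(1), of "xs @ us" vs] assms by simp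
qed

lemma multilinear_head:
  "multilinear (Suc n) f \<Longrightarrow> x \<in> dual ip \<Longrightarrow> multilinear n (\<lambda>xs. f (x # xs))"
  using multilinear_append[of 1 n f "[x]"] by simp

lemma lists_of_dual: "E \<subseteq> dual ip \<Longrightarrow> xs \<in> lists_of E n \<Longrightarrow> set xs \<subseteq> dual ip \<and> length xs = n"
  by (auto simp: lists_of_def)

lemma orthonormal_dual: "D.orthonormal p E \<Longrightarrow> E \<subseteq> dual ip"
  using dualI by (auto simp: D.orthonormal_def)

text \<open>The slots are exchanged one at a time: \<open>hs_slot\<close> treats the first argument
  and the induction hypothesis the others, each slot costing \<open>c\<^sup>2\<close>. For r = s and
  c = 1 it follows that a system with the larger span has the larger sum.\<close>

lemma hs_span_le:
  assumes "D.orthonormal r E" "D.orthonormal s E'" "E \<subseteq> span E'"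
    and "\<And>x. x \<in> hdual ip r \<Longrightarrow> dn s x \<le> c * dn r x" "0 \<le> c"
  shows "multilinear n f \<Longrightarrow> hs E n f \<le> c ^ (2 * n) * hs E' n f"
proof (induction n arbitrary: f)
  case 0
  then show ?case by (simp add: hs_def)
next
  case (Suc n)
  note dual = orthonormal_dual[OF assms(1)] orthonormal_dual[OF assms(2)]
  have "hs E (Suc n) f \<le> (\<Sum>x\<in>E. c ^ (2 * n) * hs E' n (\<lambda>xs. f (x # xs)))"
    unfolding hs_Suc using dual Suc by (intro sum_mono Suc.IH multilinear_head) auto
  also have "\<dots> = c ^ (2 * n) * (\<Sum>xs\<in>lists_of E' n. \<Sum>x\<in>E. (cmod (f (x # xs)))\<^sup>2)"
    unfolding hs_def sum_distrib_left[symmetric] by (subst sum.swap) simp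
  also have "\<dots> \<le> c ^ (2 * n) * (\<Sum>xs\<in>lists_of E' n. c\<^sup>2 * (\<Sum>x\<in>E'. (cmod (f (x # xs)))\<^sup>2))"
  proof (intro mult_left_mono sum_mono)
    fix xs assume "xs \<in> lists_of E' n"
    then have "dual_linear_map (\<lambda>x. f (x # xs))"
      using lists_of_dual[OF dual(2)] by (intro multilinear_Cons[OF Suc.prems]) auto
    then show "(\<Sum>x\<in>E. (cmod (f (x # xs)))\<^sup>2) \<le> c\<^sup>2 * (\<Sum>x\<in>E'. (cmod (f (x # xs)))\<^sup>2)"
      using hs_slot[OF assms(1,2) linear_id, of c "\<lambda>x. f (x # xs)"] assms(3-5) by auto
  qed (use assms(5) in simp_all)
  also have "\<dots> = c ^ (2 * Suc n) * hs E' (Suc n) f"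
    unfolding hs_Suc unfolding hs_def sum_distrib_left[symmetric]
    by (subst sum.swap) (simp add: power2_eq_square)
  finally show ?case .
qed

lemma orthonormal_empty [simp]: "D.orthonormal p {}"
  by (simp add: D.orthonormal_def)

section \<open>Hilbert-Schmidt norms of symmetric tensors\<close>

lemma hs_sums_eq: "hs_sums ip p n f = {hs E n f | E. D.orthonormal p E}"
  by (simp add: hs_sums_def hs_def lists_of_def dual_orthonormal_iff)

text \<open>Splitting a list around one entry replaces the list update of the definition; this form
  is the one that recursion over argument lists can use.\<close>

lemma sym_tensors_iff:
  "f \<in> sym_tensors ip n \<longleftrightarrow>
     (\<forall>xs. \<not> (length xs = n \<and> set xs \<subseteq> dual ip) \<longrightarrow> f xs = 0) \<and>
     (\<forall>xs ys. mset xs = mset ys \<longrightarrow> f xs = f ys) \<and> multilinear n f \<and>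
     (\<forall>p. bdd_above (hs_sums ip p n f))"
proof -
  have comb: "(\<lambda>\<xi>. a * x \<xi> + b * z \<xi>) = a *\<^sub>R x + b *\<^sub>R z" for a b and x z :: "'n \<Rightarrow> real"
    by auto
  have "(\<forall>xs i x z a b. length xs = n \<and> set xs \<subseteq> dual ip \<and> i < n \<and> x \<in> dual ip \<and> z \<in> dual ip \<longrightarrow>
        f (xs[i := (\<lambda>\<xi>. a * x \<xi> + b * z \<xi>)]) =
          of_real a * f (xs[i := x]) + of_real b * f (xs[i := z])) \<longleftrightarrow> multilinear n f" (is "?L \<longleftrightarrow> _")
  proof
    assume L: ?L
    show "multilinear n f"
      unfolding multilinear_def dual_linear_map_def
    proof (intro allI impI ballI)
      fix us vs :: "('n \<Rightarrow> real) list" and x z a b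
      assume *: "length us + Suc (length vs) = n \<and> set us \<subseteq> dual ip \<and> set vs \<subseteq> dual ip"
        "x \<in> dual ip" "z \<in> dual ip"
      show "f (us @ (a *\<^sub>R x + b *\<^sub>R z) # vs) = of_real a * f (us @ x # vs) + of_real b * f (us @ z # vs)"
        using L[rule_format, of "us @ x # vs" "length us" x z a b] * by (simp add: comb)
    qed
  next
    assume R: "multilinear n f"
    show ?L
    proof (intro allI impI)
      fix xs i x z a b assume *: "length xs = n \<and> set xs \<subseteq> dual ip \<and> i < n \<and> x \<in> dual ip \<and> z \<in> dual ip"
      have "dual_linear_map (\<lambda>x. f (take i xs @ x # drop (Suc i) xs))"
        using * set_take_subset[of i xs] set_drop_subset[of "Suc i" xs] by (intro multilinearD[OF R]) auto
      then show "f (xs[i := (\<lambda>\<xi>. a * x \<xi> + b * z \<xi>)]) =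
          of_real a * f (xs[i := x]) + of_real b * f (xs[i := z])"
        using * unfolding comb dual_linear_map_def by (simp add: upd_conv_take_nth_drop)
    qed
  qed
  then show ?thesis by (simp add: sym_tensors_def)
qed

lemma sym_tensorsD:
  assumes "f \<in> sym_tensors ip n"
  shows "\<not> (length xs = n \<and> set xs \<subseteq> dual ip) \<Longrightarrow> f xs = 0" "mset xs = mset ys \<Longrightarrow> f xs = f ys"
    "multilinear n f" "bdd_above (hs_sums ip p n f)"
proof -
  note * = assms[unfolded sym_tensors_iff]
  from * show "\<not> (length xs = n \<and> set xs \<subseteq> dual ip) \<Longrightarrow> f xs = 0" by blast
  from * show "mset xs = mset ys \<Longrightarrow> f xs = f ys" by blast
  from * show "multilinear n f" by blast
  from * have "\<forall>p. bdd_above (hs_sums ip p n f)" by (elim conjE)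
  then show "bdd_above (hs_sums ip p n f)" ..
qed

abbreviation tn :: "nat \<Rightarrow> nat \<Rightarrow> 'n form \<Rightarrow> real" where "tn \<equiv> tnorm ip"

lemma tn_least:
  assumes "\<And>E. D.orthonormal p E \<Longrightarrow> hs E n f \<le> c\<^sup>2" "0 \<le> c"
  shows "tn p n f \<le> c"
proof -
  have "Sup (hs_sums ip p n f) \<le> c\<^sup>2"
    using assms orthonormal_empty unfolding hs_sums_eq by (intro cSup_least) blast+
  then show ?thesis
    unfolding tnorm_def using assms(2) real_sqrt_le_mono[of _ "c\<^sup>2"] by simp
qed

lemma hs_sums_bdd: "(\<And>E. D.orthonormal p E \<Longrightarrow> hs E n f \<le> c) \<Longrightarrow> bdd_above (hs_sums ip p n f)"
  unfolding hs_sums_eq by (intro bdd_aboveI[of _ c]) auto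

lemma Sup_hs_sums_nonneg: "bdd_above (hs_sums ip p n f) \<Longrightarrow> 0 \<le> Sup (hs_sums ip p n f)"
proof -
  assume "bdd_above (hs_sums ip p n f)"
  then have "hs {} n f \<le> Sup (hs_sums ip p n f)"
    using orthonormal_empty by (intro cSup_upper) (auto simp: hs_sums_eq)
  then show ?thesis using hs_nonneg[of "{}" n f] by linarith
qed

lemma tn_nonneg [simp]: "f \<in> sym_tensors ip n \<Longrightarrow> 0 \<le> tn p n f"
  unfolding tnorm_def using sym_tensorsD(4) Sup_hs_sums_nonneg by simp

lemma hs_le_tn:
  assumes "bdd_above (hs_sums ip p n f)" "D.orthonormal p E"
  shows "hs E n f \<le> (tn p n f)\<^sup>2"
proof -
  have "hs E n f \<le> Sup (hs_sums ip p n f)"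
    using assms by (intro cSup_upper) (auto simp: hs_sums_eq)
  then show ?thesis using Sup_hs_sums_nonneg[OF assms(1)] by (simp add: tnorm_def)
qed

lemma hs_sum_bound:
  assumes "hs E n f \<le> c\<^sup>2" "hs E n g \<le> d\<^sup>2" "0 \<le> c" "0 \<le> d"
  shows "hs E n (\<lambda>xs. a * f xs + b * g xs) \<le> (cmod a * c + cmod b * d)\<^sup>2"
proof -
  have "sqrt (hs E n (\<lambda>xs. a * f xs + b * g xs)) \<le> cmod a * sqrt (hs E n f) + cmod b * sqrt (hs E n g)"
    using sqrt_hs_triangle[of E n "\<lambda>xs. a * f xs" "\<lambda>xs. b * g xs"] by (simp add: hs_scale real_sqrt_mult)
  also have "\<dots> \<le> cmod a * c + cmod b * d"
    using assms by (intro add_mono mult_left_mono real_le_lsqrt) auto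
  finally show ?thesis
    using assms by (simp add: sqrt_le_D)
qed

lemma sym_tensors_comb:
  assumes f: "f \<in> sym_tensors ip n" and g: "g \<in> sym_tensors ip n"
  shows "(\<lambda>xs. a * f xs + b * g xs) \<in> sym_tensors ip n"
    "tn p n (\<lambda>xs. a * f xs + b * g xs) \<le> cmod a * tn p n f + cmod b * tn p n g"
proof -
  have bound: "hs E n (\<lambda>xs. a * f xs + b * g xs) \<le> (cmod a * tn p n f + cmod b * tn p n g)\<^sup>2"
    if "D.orthonormal p E" for p E
    using assms that by (intro hs_sum_bound hs_le_tn sym_tensorsD(4)) auto
  have ml: "multilinear n (\<lambda>xs. a * f xs + b * g xs)"
    using sym_tensorsD(3)[OF f] sym_tensorsD(3)[OF g]
    unfolding multilinear_def dual_linear_map_def by (auto simp: algebra_simps)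
  have bdd: "bdd_above (hs_sums ip p n (\<lambda>xs. a * f xs + b * g xs))" for p
    by (rule hs_sums_bdd[OF bound])
  have sym: "a * f xs + b * g xs = a * f ys + b * g ys" if "mset xs = mset ys" for xs ys
    using sym_tensorsD(2)[OF f that] sym_tensorsD(2)[OF g that] by simp
  have out: "a * f xs + b * g xs = 0" if "\<not> (length xs = n \<and> set xs \<subseteq> dual ip)" for xs
    using sym_tensorsD(1)[OF f that] sym_tensorsD(1)[OF g that] by simp
  show "(\<lambda>xs. a * f xs + b * g xs) \<in> sym_tensors ip n"
    unfolding sym_tensors_iff using ml bdd sym out by blast
  show "tn p n (\<lambda>xs. a * f xs + b * g xs) \<le> cmod a * tn p n f + cmod b * tn p n g"
    using bound f g by (intro tn_least) auto
qed

lemma sym_tensors_zero [simp]: "(\<lambda>_. 0) \<in> sym_tensors ip n" "tn p n (\<lambda>_. 0) = 0"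
proof -
  have h: "hs E n (\<lambda>_. 0) = 0" for E by (simp add: hs_def)
  have bdd: "bdd_above (hs_sums ip p n (\<lambda>_. 0))" for p
    by (rule hs_sums_bdd[of _ _ _ 0]) (simp add: h)
  have ml: "multilinear n (\<lambda>_. 0)" by (simp add: multilinear_def dual_linear_map_def)
  show s: "(\<lambda>_. 0) \<in> sym_tensors ip n" unfolding sym_tensors_iff using bdd ml by blast
  have "tn p n (\<lambda>_. 0) \<le> 0" by (rule tn_least) (auto simp: h)
  then show "tn p n (\<lambda>_. 0) = 0" using tn_nonneg[OF s, of p] by linarith
qed

lemma sym_tensors_scale:
  assumes "f \<in> sym_tensors ip n"
  shows "(\<lambda>xs. a * f xs) \<in> sym_tensors ip n" "tn p n (\<lambda>xs. a * f xs) \<le> cmod a * tn p n f"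
  using sym_tensors_comb[OF assms assms, where a = a and b = 0] by auto

lemma sym_tensors_sum:
  assumes "finite I" "\<And>i. i \<in> I \<Longrightarrow> f i \<in> sym_tensors ip n"
  shows "(\<lambda>xs. \<Sum>i\<in>I. c i * f i xs) \<in> sym_tensors ip n \<and>
    tn p n (\<lambda>xs. \<Sum>i\<in>I. c i * f i xs) \<le> (\<Sum>i\<in>I. cmod (c i) * tn p n (f i))"
  using assms
proof (induction I rule: finite_induct)
  case (insert i I)
  then have IH: "(\<lambda>xs. \<Sum>i\<in>I. c i * f i xs) \<in> sym_tensors ip n"
    "tn p n (\<lambda>xs. \<Sum>i\<in>I. c i * f i xs) \<le> (\<Sum>i\<in>I. cmod (c i) * tn p n (f i))" by auto
  show ?case
    using sym_tensors_comb(1)[OF insert.prems[of i] IH(1), where a = "c i" and b = 1] insert.hyps IH(2)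
      sym_tensors_comb(2)[OF insert.prems[of i] IH(1), where a = "c i" and b = 1 and p = p] by auto
qed simp

text \<open>Duality reverses the comparison: a finite orthonormal system of
  \<open>hdual ip p\<close> lies in \<open>hdual ip q\<close>, where Gram-Schmidt gives a system
  that spans it. The exchange costs one factor c per slot.\<close>

lemma tn_dominated:
  assumes f: "f \<in> sym_tensors ip n" and c: "\<And>\<xi>. hn p \<xi> \<le> c * hn q \<xi>" "0 \<le> c"
  shows "tn p n f \<le> c ^ n * tn q n f"
proof (rule tn_least)
  fix E assume E: "D.orthonormal p E"
  have "E \<subseteq> hdual ip q" using E hdual_bound(1)[OF c] by (auto simp: D.orthonormal_def)
  then obtain E' where E': "D.orthonormal q E'" "E \<subseteq> span E'"
    using D.orthonormal_extend[of q "{}" E] D.orthonormalD(1)[OF E] by auto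
  have "hs E n f \<le> c ^ (2 * n) * hs E' n f"
    using hdual_bound(2)[OF c] c(2) by (intro hs_span_le[OF E E'] sym_tensorsD(3)[OF f])
  also have "\<dots> \<le> c ^ (2 * n) * (tn q n f)\<^sup>2"
    using c(2) by (intro mult_left_mono hs_le_tn[OF sym_tensorsD(4)[OF f] E'(1)]) auto
  finally show "hs E n f \<le> (c ^ n * tn q n f)\<^sup>2" by (simp add: power_mult_distrib power_mult[symmetric] mult.commute)
qed (use assms in auto)

text \<open>The same exchange of systems as in \<open>tn_dominated\<close>, but for a form not yet
  known to be a tensor: it reduces the finiteness of all norms to that of dominating ones.\<close>

lemma bdd_dominated:
  assumes ml: "multilinear n f" and "dominates q p" and bdd: "bdd_above (hs_sums ip q n f)"
  shows "bdd_above (hs_sums ip p n f)"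
proof -
  obtain c where c: "1 \<le> c" "\<And>\<xi>. hn p \<xi> \<le> c * hn q \<xi>" using assms(2) by (auto simp: dominates_def)
  have c0: "0 \<le> c" using c by simp
  show ?thesis
  proof (rule hs_sums_bdd)
    fix E assume E: "D.orthonormal p E"
    have "E \<subseteq> hdual ip q" using E hdual_bound(1)[OF c(2) c0] by (auto simp: D.orthonormal_def)
    then obtain E' where E': "D.orthonormal q E'" "E \<subseteq> span E'"
      using D.orthonormal_extend[of q "{}" E] D.orthonormalD(1)[OF E] by auto
    have "hs E n f \<le> c ^ (2 * n) * hs E' n f"
      using hdual_bound(2)[OF c(2) c0] c0 by (intro hs_span_le[OF E E'] ml)
    also have "\<dots> \<le> c ^ (2 * n) * (tn q n f)\<^sup>2"
      using c0 by (intro mult_left_mono hs_le_tn[OF bdd E'(1)]) auto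
    finally show "hs E n f \<le> c ^ (2 * n) * (tn q n f)\<^sup>2" .
  qed
qed

text \<open>After E is enlarged to span x, the first argument can be expanded in the system.
  Cauchy-Schwarz in the coordinates of x splits off \<open>(dn p x)\<^sup>2\<close> and leaves the
  sum for the whole form.\<close>

lemma hs_head_le:
  assumes ml: "multilinear (Suc n) f" and bdd: "bdd_above (hs_sums ip p (Suc n) f)"
    and x: "x \<in> hdual ip p" and E: "D.orthonormal p E"
  shows "hs E n (\<lambda>xs. f (x # xs)) \<le> (dn p x * tn p (Suc n) f)\<^sup>2"
proof -
  obtain E' where E': "D.orthonormal p E'" "E \<subseteq> E'" "x \<in> span E'"
    using D.orthonormal_extend[OF E, of "{x}"] x by auto
  have dual: "E' \<subseteq> dual ip" using orthonormal_dual[OF E'(1)] .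
  have fin: "finite E'" using E'(1) by (auto simp: D.orthonormal_def)
  have "hs E n (\<lambda>xs. f (x # xs)) \<le> hs E' n (\<lambda>xs. f (x # xs))"
    using hs_mono[OF fin E'(2)] .
  also have "\<dots> \<le> (\<Sum>xs\<in>lists_of E' n. (dn p x)\<^sup>2 * (\<Sum>e\<in>E'. (cmod (f (e # xs)))\<^sup>2))"
    unfolding hs_def
  proof (rule sum_mono)
    fix xs assume xs: "xs \<in> lists_of E' n"
    have "dual_linear_map (\<lambda>x. f (x # xs))"
      using lists_of_dual[OF dual xs] by (intro multilinear_Cons[OF ml]) auto
    then have "f (x # xs) = (\<Sum>e\<in>E'. of_real (dual_ip ip p x e) * f (e # xs))"
      using dual_linear_map_sum[of "\<lambda>x. f (x # xs)" E' "\<lambda>e. e" "dual_ip ip p x"]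
        D.expansion[OF E'(1,3)] dual fin by auto
    then have "(cmod (f (x # xs)))\<^sup>2
        \<le> (\<Sum>e\<in>E'. (cmod (of_real (dual_ip ip p x e)))\<^sup>2) * (\<Sum>e\<in>E'. (cmod (f (e # xs)))\<^sup>2)"
      by (simp only: cmod_sum_le_cauchy_schwarz)
    also have "(\<Sum>e\<in>E'. (cmod (of_real (dual_ip ip p x e)))\<^sup>2) = (dn p x)\<^sup>2"
      using D.parseval[OF E'(1,3)] dual_ip_self[OF x] by simp
    finally show "(cmod (f (x # xs)))\<^sup>2 \<le> (dn p x)\<^sup>2 * (\<Sum>e\<in>E'. (cmod (f (e # xs)))\<^sup>2)" .
  qed
  also have "\<dots> = (dn p x)\<^sup>2 * hs E' (Suc n) f"
    unfolding hs_Suc unfolding hs_def sum_distrib_left[symmetric] by (subst sum.swap) simp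
  also have "\<dots> \<le> (dn p x)\<^sup>2 * (tn p (Suc n) f)\<^sup>2"
    by (intro mult_left_mono hs_le_tn[OF bdd E'(1)]) auto
  finally show ?thesis by (simp add: power_mult_distrib)
qed

lemma sym_tensors_head:
  assumes f: "f \<in> sym_tensors ip (Suc n)" and x: "x \<in> dual ip"
  shows "(\<lambda>xs. f (x # xs)) \<in> sym_tensors ip n"
    "x \<in> hdual ip p \<Longrightarrow> tn p n (\<lambda>xs. f (x # xs)) \<le> dn p x * tn p (Suc n) f"
proof -
  note fD = sym_tensorsD[OF f]
  have ml: "multilinear n (\<lambda>xs. f (x # xs))" using fD(3) x by (rule multilinear_head)
  have "bdd_above (hs_sums ip p n (\<lambda>xs. f (x # xs)))" for p
  proof -
    \<comment> \<open>The direct estimate needs x in \<open>hdual ip q\<close>; an arbitrary index p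
      is dominated by such a q.\<close>
    obtain q where q: "dominates q p" "x \<in> hdual ip q" using finite_subset_dual[of "{x}" p] x by auto
    show ?thesis
      by (rule bdd_dominated[OF ml q(1)], rule hs_sums_bdd, rule hs_head_le[OF fD(3,4) q(2)])
  qed
  moreover have "f (x # xs) = f (x # ys)" if "mset xs = mset ys" for xs ys
    using that by (intro fD(2)) simp
  moreover have "f (x # xs) = 0" if "\<not> (length xs = n \<and> set xs \<subseteq> dual ip)" for xs
    using that by (intro fD(1)) auto
  ultimately show "(\<lambda>xs. f (x # xs)) \<in> sym_tensors ip n"
    unfolding sym_tensors_iff using ml by blast
  show "tn p n (\<lambda>xs. f (x # xs)) \<le> dn p x * tn p (Suc n) f" if "x \<in> hdual ip p"
    using hs_head_le[OF fD(3,4) that] dn_nonneg[OF that] f by (intro tn_least) auto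
qed

lemma sym_tensors_append:
  assumes "f \<in> sym_tensors ip (n + k)" "length xs = n" "set xs \<subseteq> dual ip"
  shows "(\<lambda>ys. f (xs @ ys)) \<in> sym_tensors ip k"
  using assms
proof (induction xs arbitrary: n f)
  case (Cons x xs)
  have n: "n = Suc (length xs)" using Cons.prems(2) by simp
  have "f \<in> sym_tensors ip (Suc (length xs + k))" "x \<in> dual ip"
    using Cons.prems(1,3) by (simp_all add: n)
  from Cons.IH[OF sym_tensors_head(1)[OF this]] show ?case using Cons.prems(3) by simp
qed simp

text \<open>Symmetry moves a copy of y from the end of the list to its front, which makes
  contraction an iterated evaluation in the first slot.\<close>

lemma contract_Suc:
  assumes "f \<in> sym_tensors ip m"
  shows "contract (Suc n) y f = contract n y (\<lambda>xs. f (y # xs))"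
  unfolding contract_def by (intro ext sym_tensorsD(2)[OF assms]) simp

lemma sym_tensors_contract:
  assumes "f \<in> sym_tensors ip (n + k)" "y \<in> dual ip"
  shows "contract n y f \<in> sym_tensors ip k"
    "y \<in> hdual ip p \<Longrightarrow> tn p k (contract n y f) \<le> dn p y ^ n * tn p (n + k) f"
proof -
  have *: "contract n y f \<in> sym_tensors ip k \<and>
    (y \<in> hdual ip p \<longrightarrow> tn p k (contract n y f) \<le> dn p y ^ n * tn p (n + k) f)" for p
    using assms(1)
  proof (induction n arbitrary: f)
    case (Suc n)
    then have f: "f \<in> sym_tensors ip (Suc (n + k))" by simp
    note h = sym_tensors_head[OF f assms(2)]
    show ?case
    proof (intro conjI impI)
      show "contract (Suc n) y f \<in> sym_tensors ip k"
        using Suc.IH[OF h(1)] contract_Suc[OF f] by simp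
      assume y: "y \<in> hdual ip p"
      have "tn p k (contract (Suc n) y f) \<le> dn p y ^ n * tn p (n + k) (\<lambda>xs. f (y # xs))"
        using Suc.IH[OF h(1)] contract_Suc[OF f] y by simp
      also have "\<dots> \<le> dn p y ^ n * (dn p y * tn p (Suc (n + k)) f)"
        using h(2)[OF y] dn_nonneg[OF y] by (intro mult_left_mono) auto
      finally show "tn p k (contract (Suc n) y f) \<le> dn p y ^ Suc n * tn p (Suc n + k) f"
          by (simp add: algebra_simps)
    qed
  qed (simp add: contract_def)
  from * show "contract n y f \<in> sym_tensors ip k" by blast
  from * show "y \<in> hdual ip p \<Longrightarrow> tn p k (contract n y f) \<le> dn p y ^ n * tn p (n + k) f" by blast
qed

lemma sym_tensors_eval:
  assumes "f \<in> sym_tensors ip n" "length xs = n" "set xs \<subseteq> hdual ip p"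
  shows "cmod (f xs) \<le> tn p n f * (\<Prod>x\<leftarrow>xs. dn p x)"
  using assms
proof (induction xs arbitrary: n f)
  case Nil
  then have "hs {} 0 f \<le> (tn p 0 f)\<^sup>2"
    using sym_tensorsD(4) orthonormal_empty by (intro hs_le_tn) auto
  then show ?case using Nil by (auto simp: hs_def abs_le_square_iff[symmetric])
next
  case (Cons x xs)
  then have f: "f \<in> sym_tensors ip (Suc (length xs))" and x: "x \<in> dual ip" "x \<in> hdual ip p"
    and xs: "set xs \<subseteq> hdual ip p" and n: "n = Suc (length xs)" by (auto intro: dualI)
  have pos: "0 \<le> (\<Prod>x\<leftarrow>xs. dn p x)" using xs by (induction xs) (auto simp: dn_nonneg)
  have "cmod (f (x # xs)) \<le> tn p (length xs) (\<lambda>xs. f (x # xs)) * (\<Prod>x\<leftarrow>xs. dn p x)"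
    by (rule Cons.IH[OF sym_tensors_head(1)[OF f x(1)] refl xs])
  also have "\<dots> \<le> (dn p x * tn p (Suc (length xs)) f) * (\<Prod>x\<leftarrow>xs. dn p x)"
    using sym_tensors_head(2)[OF f x] pos by (intro mult_right_mono)
  finally show ?case by (simp add: n algebra_simps)
qed

end

section \<open>Symmetric multilinear maps\<close>

text \<open>Over an arbitrary vector space, because two kinds of maps are polarized: forms on
  functionals, and functionals of a product of nuclear vectors.\<close>

definition multilinear_on :: "'v::real_vector set \<Rightarrow> nat \<Rightarrow> ('v list \<Rightarrow> complex) \<Rightarrow> bool" where
  "multilinear_on D n \<Phi> \<longleftrightarrow> (\<forall>us vs x z a b.
     length us + Suc (length vs) = n \<and> set us \<subseteq> D \<and> set vs \<subseteq> D \<and> x \<in> D \<and> z \<in> D \<longrightarrow>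
     \<Phi> (us @ (a *\<^sub>R x + b *\<^sub>R z) # vs) = of_real a * \<Phi> (us @ x # vs) + of_real b * \<Phi> (us @ z # vs))"

definition symmetric_on :: "'v set \<Rightarrow> nat \<Rightarrow> ('v list \<Rightarrow> complex) \<Rightarrow> bool" where
  "symmetric_on D n \<Phi> \<longleftrightarrow> (\<forall>xs ys. mset xs = mset ys \<and> length xs = n \<and> set xs \<subseteq> D \<longrightarrow> \<Phi> xs = \<Phi> ys)"

lemma multilinear_onD:
  assumes "multilinear_on D n \<Phi>" "length us + Suc (length vs) = n" "set us \<subseteq> D" "set vs \<subseteq> D" "x \<in> D" "z \<in> D"
  shows "\<Phi> (us @ (a *\<^sub>R x + b *\<^sub>R z) # vs) = of_real a * \<Phi> (us @ x # vs) + of_real b * \<Phi> (us @ z # vs)"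
  using assms unfolding multilinear_on_def by blast

lemma symmetric_onD:
  "symmetric_on D n \<Phi> \<Longrightarrow> mset xs = mset ys \<Longrightarrow> length xs = n \<Longrightarrow> set xs \<subseteq> D \<Longrightarrow> \<Phi> xs = \<Phi> ys"
  unfolding symmetric_on_def by blast

text \<open>Linearity in one of the m equal entries writes the map as A(t) + t B(t), where A and B
  have only m - 1 varying entries. At t = 0 the derivative is A'(0) + B(0), and all m contributions
  agree by symmetry.\<close>

lemma polarization_derivative:
  assumes D: "subspace D" and ml: "multilinear_on D n \<Phi>" and sym: "symmetric_on D n \<Phi>"
    and "\<eta> \<in> D" "\<theta> \<in> D" "set L \<subseteq> D" "length L + m = n"
  shows "((\<lambda>t. \<Phi> (L @ replicate m (\<eta> + t *\<^sub>R \<theta>))) has_vector_derivative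
    (of_nat m * \<Phi> (L @ \<theta> # replicate (m - 1) \<eta>))) (at 0)"
  using assms(6,7)
proof (induction m arbitrary: L)
  case (Suc m)
  let ?A = "\<lambda>t. \<Phi> ((L @ [\<eta>]) @ replicate m (\<eta> + t *\<^sub>R \<theta>))"
  let ?B = "\<lambda>t. \<Phi> ((L @ [\<theta>]) @ replicate m (\<eta> + t *\<^sub>R \<theta>))"
  have inD: "\<eta> + t *\<^sub>R \<theta> \<in> D" for t
    using D assms(4,5) by (intro subspace_add subspace_scale)
  have split: "\<Phi> (L @ replicate (Suc m) (\<eta> + t *\<^sub>R \<theta>)) = ?A t + of_real t * ?B t" for t
    using multilinear_onD[OF ml, of L "replicate m (\<eta> + t *\<^sub>R \<theta>)" \<eta> \<theta> 1 t] Suc.prems assms(4,5) inD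
    by (auto simp: set_replicate_conv_if)
  have "(?A has_vector_derivative of_nat m * \<Phi> ((L @ [\<eta>]) @ \<theta> # replicate (m - 1) \<eta>)) (at 0)"
    using Suc.prems assms(4) by (intro Suc.IH) auto
  moreover have "(?B has_vector_derivative of_nat m * \<Phi> ((L @ [\<theta>]) @ \<theta> # replicate (m - 1) \<eta>)) (at 0)"
    using Suc.prems assms(5) by (intro Suc.IH) auto
  ultimately have "((\<lambda>t. ?A t + of_real t * ?B t) has_vector_derivative
      of_nat m * \<Phi> ((L @ [\<eta>]) @ \<theta> # replicate (m - 1) \<eta>) +
      (of_real 0 * (of_nat m * \<Phi> ((L @ [\<theta>]) @ \<theta> # replicate (m - 1) \<eta>)) + 1 * ?B 0)) (at 0)"
    by (intro has_vector_derivative_add has_vector_derivative_mult)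
      (auto intro!: derivative_eq_intros)
  \<comment> \<open>For m = 0 both sides carry the factor 0, which also makes the truncated
    subtraction harmless; otherwise symmetry moves \<eta> behind \<theta>.\<close>
  moreover have "of_nat m * \<Phi> ((L @ [\<eta>]) @ \<theta> # replicate (m - 1) \<eta>) = of_nat m * \<Phi> (L @ \<theta> # replicate m \<eta>)"
  proof (cases m)
    case (Suc k)
    have "\<Phi> ((L @ [\<eta>]) @ \<theta> # replicate k \<eta>) = \<Phi> (L @ \<theta> # replicate m \<eta>)"
      using Suc.prems assms(4,5) Suc
      by (intro symmetric_onD[OF sym]) (auto simp: set_replicate_conv_if)
    then show ?thesis by (simp add: Suc)
  qed simp
  ultimately show ?case by (simp only: split) (simp add: algebra_simps)
qed simp

text \<open>The function that vanishes on the diagonal has vanishing derivatives, and each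
  derivative frees one diagonal entry while the rest still ranges over the diagonal. After n
  derivatives all entries are free.\<close>

lemma polarization:
  assumes D: "subspace D" and ml: "multilinear_on D n \<Phi>" and sym: "symmetric_on D n \<Phi>"
    and diag: "\<And>\<theta>. \<theta> \<in> D \<Longrightarrow> \<Phi> (replicate n \<theta>) = 0"
    and "set xs \<subseteq> D" "length xs = n"
  shows "\<Phi> xs = 0"
proof -
  have "\<forall>\<eta>\<in>D. \<Phi> (L @ replicate (n - k) \<eta>) = 0" if "set L \<subseteq> D" "length L = k" "k \<le> n" for L k
    using that
  proof (induction k arbitrary: L)
    case 0
    then show ?case using diag by simp
  next
    case (Suc k)
    then obtain L' \<theta> where L: "L = L' @ [\<theta>]" by (cases L rule: rev_cases) auto
    have IH: "\<forall>\<eta>\<in>D. \<Phi> (L' @ replicate (n - k) \<eta>) = 0" using Suc L by (intro Suc.IH) auto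
    show ?case
    proof
      fix \<eta> assume \<eta>: "\<eta> \<in> D"
      have \<theta>: "\<theta> \<in> D" using L Suc by auto
      have "\<eta> + t *\<^sub>R \<theta> \<in> D" for t using D \<eta> \<theta> by (intro subspace_add subspace_scale)
      then have zero: "(\<lambda>t. \<Phi> (L' @ replicate (n - k) (\<eta> + t *\<^sub>R \<theta>))) = (\<lambda>_. 0)"
        using IH by auto
      have "((\<lambda>_::real. 0::complex) has_vector_derivative
          (of_nat (n - k) * \<Phi> (L' @ \<theta> # replicate (n - k - 1) \<eta>))) (at 0)"
        using polarization_derivative[OF D ml sym \<eta> \<theta>, of L' "n - k"] Suc.prems L by (simp only: zero) auto
      then have "of_nat (n - k) * \<Phi> (L' @ \<theta> # replicate (n - k - 1) \<eta>) = 0"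
        using vector_derivative_unique_at has_vector_derivative_const by blast
      then show "\<Phi> (L @ replicate (n - Suc k) \<eta>) = 0" using Suc.prems L by auto
    qed
  qed
  from this[of xs n] show ?thesis using assms(5,6) subspace_0[OF D] by auto
qed

text \<open>The sum and not the mean over the permutations, whence the factor n! on the
  diagonal.\<close>

definition symmetrize :: "nat \<Rightarrow> ('v list \<Rightarrow> complex) \<Rightarrow> 'v list \<Rightarrow> complex" where
  "symmetrize n \<Psi> xs = (\<Sum>\<sigma> | \<sigma> permutes {..<n}. \<Psi> (permute_list \<sigma> xs))"

lemma symmetrize_symmetric: "symmetric_on D n (symmetrize n \<Psi>)"
  unfolding symmetric_on_def
proof (intro allI impI)
  fix xs ys :: "'a list" assume *: "mset xs = mset ys \<and> length xs = n \<and> set xs \<subseteq> D"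
  then obtain \<tau> where \<tau>: "\<tau> permutes {..<length ys}" "permute_list \<tau> ys = xs"
    using mset_eq_permutation by blast
  have len: "length ys = n" using * by (metis mset_eq_length)
  have "symmetrize n \<Psi> xs = (\<Sum>\<sigma> | \<sigma> permutes {..<n}. \<Psi> (permute_list (\<tau> \<circ> \<sigma>) ys))"
    unfolding symmetrize_def
    by (intro sum.cong refl) (simp add: permute_list_compose len \<tau>(2))
  also have "\<dots> = symmetrize n \<Psi> ys"
    unfolding symmetrize_def using \<tau>(1) len by (intro setum_permutations_compose_left[symmetric]) simp
  finally show "symmetrize n \<Psi> xs = symmetrize n \<Psi> ys" .
qed

text \<open>A permutation sends the variable entry to one fixed place and leaves x out of all
  others. Hence permuting the arguments preserves linearity in each slot.\<close>

lemma permute_list_insert: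
  assumes "\<sigma> permutes {..<n}" "length us + Suc (length vs) = n"
  shows "\<exists>us' vs'. length us' + Suc (length vs') = n \<and> set us' \<subseteq> set us \<union> set vs \<and> set vs' \<subseteq> set us \<union> set vs \<and>
     (\<forall>x. permute_list \<sigma> (us @ x # vs) = us' @ x # vs')"
proof -
  define j where "j = inv \<sigma> (length us)"
  have j: "\<sigma> j = length us" "j < n"
    using permutes_inverses(1)[OF assms(1)] permutes_in_image[OF permutes_inv[OF assms(1)], of "length us"] assms(2)
    by (auto simp: j_def)
  have other: "\<sigma> i \<noteq> length us" if "i \<noteq> j" for i
    using j(1) permutes_inj[OF assms(1)] that by (metis injD)
  \<comment> \<open>The placeholder \<open>undefined\<close> is met only at the index j, which is
    the place of x and is excluded whenever the values of \<open>ys\<close> are used.\<close>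
  define ys where "ys = (\<lambda>i. (us @ undefined # vs) ! \<sigma> i)"
  have ys: "ys i \<in> set us \<union> set vs" if "i < n" "i \<noteq> j" for i
  proof -
    have s: "\<sigma> i < n" using that(1) permutes_in_image[OF assms(1), of i] by simp
    have "\<sigma> i < length us \<or> (\<exists>k<length vs. \<sigma> i = length us + Suc k)"
      using s other[OF that(2)] assms(2)
      by (cases "\<sigma> i < length us") (auto intro!: exI[of _ "\<sigma> i - Suc (length us)"])
    then show ?thesis by (auto simp: ys_def nth_append)
  qed
  define us' where "us' = map ys [0..<j]"
  define vs' where "vs' = map ys [Suc j..<n]"
  have "permute_list \<sigma> (us @ x # vs) = us' @ x # vs'" for x
  proof (rule nth_equalityI)
    show "length (permute_list \<sigma> (us @ x # vs)) = length (us' @ x # vs')"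
      using assms(2) j by (simp add: us'_def vs'_def)
  next
    fix i assume "i < length (permute_list \<sigma> (us @ x # vs))"
    then have i: "i < n" using assms(2) by simp
    have p: "permute_list \<sigma> (us @ x # vs) ! i = (us @ x # vs) ! \<sigma> i"
      using assms i by (intro permute_list_nth) auto
    consider "i < j" | "i = j" | "j < i" by linarith
    then show "permute_list \<sigma> (us @ x # vs) ! i = (us' @ x # vs') ! i"
    proof cases
      case 1
      then have "(us' @ x # vs') ! i = ys i" by (simp add: us'_def nth_append)
      moreover have "ys i = (us @ x # vs) ! \<sigma> i" using other[of i] 1 by (auto simp: ys_def nth_append nth_Cons')
      ultimately show ?thesis using p by simp
    next
      case 2
      then show ?thesis using p j by (simp add: us'_def nth_append)
    next
      case 3
      then have "(us' @ x # vs') ! i = ys i" using i by (simp add: us'_def vs'_def nth_append nth_Cons')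
      moreover have "ys i = (us @ x # vs) ! \<sigma> i" using other[of i] 3 by (auto simp: ys_def nth_append nth_Cons')
      ultimately show ?thesis using p by simp
    qed
  qed
  moreover have "set us' \<subseteq> set us \<union> set vs" "set vs' \<subseteq> set us \<union> set vs"
    unfolding us'_def vs'_def set_map by (rule image_subsetI, rule ys; use j(2) in simp)+
  moreover have "length us' + Suc (length vs') = n" using j by (simp add: us'_def vs'_def)
  ultimately show ?thesis by blast
qed

lemma symmetrize_multilinear:
  assumes "multilinear_on D n \<Psi>"
  shows "multilinear_on D n (symmetrize n \<Psi>)"
  unfolding multilinear_on_def
proof (intro allI impI)
  fix us vs x z a b
  assume *: "length us + Suc (length vs) = n \<and> set us \<subseteq> D \<and> set vs \<subseteq> D \<and> x \<in> D \<and> z \<in> D"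
  have "\<Psi> (permute_list \<sigma> (us @ (a *\<^sub>R x + b *\<^sub>R z) # vs)) =
      of_real a * \<Psi> (permute_list \<sigma> (us @ x # vs)) + of_real b * \<Psi> (permute_list \<sigma> (us @ z # vs))"
    if "\<sigma> permutes {..<n}" for \<sigma>
  proof -
    have "length us + Suc (length vs) = n" using * by simp
    from permute_list_insert[OF that this] obtain us' vs' where
      p: "length us' + Suc (length vs') = n" "set us' \<subseteq> set us \<union> set vs" "set vs' \<subseteq> set us \<union> set vs"
        "\<forall>x. permute_list \<sigma> (us @ x # vs) = us' @ x # vs'"
      by blast
    have "set us' \<subseteq> D" "set vs' \<subseteq> D" using p(2,3) * by blast+
    then show ?thesis using multilinear_onD[OF assms p(1)] * p(4) by simp
  qed
  then show "symmetrize n \<Psi> (us @ (a *\<^sub>R x + b *\<^sub>R z) # vs) =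
      of_real a * symmetrize n \<Psi> (us @ x # vs) + of_real b * symmetrize n \<Psi> (us @ z # vs)"
    unfolding symmetrize_def sum_distrib_left sum.distrib[symmetric] by (intro sum.cong) auto
qed

lemma symmetrize_replicate: "symmetrize n \<Psi> (replicate n x) = fact n * \<Psi> (replicate n x)"
proof -
  have "permute_list \<sigma> (replicate n x) = replicate n x" if "\<sigma> permutes {..<n}" for \<sigma>
    using that permutes_in_image[OF that]
    by (intro nth_equalityI) (auto simp: permute_list_nth)
  then have "symmetrize n \<Psi> (replicate n x) = (\<Sum>\<sigma> | \<sigma> permutes {..<n}. \<Psi> (replicate n x))"
    unfolding symmetrize_def by (intro sum.cong) auto
  then show ?thesis by (simp add: card_permutations)
qed

text \<open>Polarization of the difference. It allows a symmetric map to be computed from any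
  multilinear formula with the right diagonal, symmetric or not.\<close>

lemma symmetric_eq_symmetrize:
  assumes D: "subspace D" and \<Phi>: "multilinear_on D n \<Phi>" "symmetric_on D n \<Phi>" and \<Psi>: "multilinear_on D n \<Psi>"
    and diag: "\<And>\<theta>. \<theta> \<in> D \<Longrightarrow> \<Phi> (replicate n \<theta>) = \<Psi> (replicate n \<theta>)"
    and xs: "set xs \<subseteq> D" "length xs = n"
  shows "fact n * \<Phi> xs = symmetrize n \<Psi> xs"
proof -
  define \<Delta> where "\<Delta> ys = fact n * \<Phi> ys - symmetrize n \<Psi> ys" for ys
  note s = symmetrize_multilinear[OF \<Psi>] symmetrize_symmetric[of D n \<Psi>]
  have 1: "multilinear_on D n \<Delta>"
    unfolding multilinear_on_def \<Delta>_def
  proof (intro allI impI)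
    fix us vs x z a b
    assume *: "length us + Suc (length vs) = n \<and> set us \<subseteq> D \<and> set vs \<subseteq> D \<and> x \<in> D \<and> z \<in> D"
    then show "fact n * \<Phi> (us @ (a *\<^sub>R x + b *\<^sub>R z) # vs) - symmetrize n \<Psi> (us @ (a *\<^sub>R x + b *\<^sub>R z) # vs) =
       of_real a * (fact n * \<Phi> (us @ x # vs) - symmetrize n \<Psi> (us @ x # vs)) +
       of_real b * (fact n * \<Phi> (us @ z # vs) - symmetrize n \<Psi> (us @ z # vs))"
      using multilinear_onD[OF \<Phi>(1), of us vs x z a b] multilinear_onD[OF s(1), of us vs x z a b]
      by (simp add: algebra_simps)
  qed
  have 2: "symmetric_on D n \<Delta>"
    using \<Phi>(2) s(2) unfolding symmetric_on_def \<Delta>_def by metis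
  have 3: "\<Delta> (replicate n \<theta>) = 0" if "\<theta> \<in> D" for \<theta>
    using diag[OF that] by (simp add: \<Delta>_def symmetrize_replicate)
  from polarization[OF D 1 2 3 xs] show ?thesis by (simp add: \<Delta>_def)
qed

section \<open>Symmetrized elementary tensors\<close>

text \<open>The pairing of the elementary tensors built from the functionals \<open>xs\<close> and
  from the vectors L.\<close>

definition list_pair :: "('a \<Rightarrow> real) list \<Rightarrow> 'a list \<Rightarrow> real" where
  "list_pair xs L = (\<Prod>(x, \<xi>)\<leftarrow>zip xs L. x \<xi>)"

lemma list_pair_Nil [simp]: "list_pair [] L = 1"
  by (simp add: list_pair_def)

lemma list_pair_Cons [simp]: "list_pair (x # xs) (\<xi> # L) = x \<xi> * list_pair xs L"
  by (simp add: list_pair_def)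

lemma list_pair_append:
  "length us = length K \<Longrightarrow> list_pair (us @ vs) (K @ L) = list_pair us K * list_pair vs L"
  by (simp add: list_pair_def)

lemma list_pair_replicate: "length xs = n \<Longrightarrow> list_pair xs (replicate n \<xi>) = (\<Prod>x\<leftarrow>xs. x \<xi>)"
  by (induction xs arbitrary: n) auto

lemma prod_list_permute:
  fixes f :: "'a \<Rightarrow> 'b::comm_monoid_mult"
  assumes "mset xs = mset ys"
  shows "(\<Prod>x\<leftarrow>xs. f x) = (\<Prod>x\<leftarrow>ys. f x)"
  by (metis assms mset_map prod_mset_prod_list)

lemma list_pair_permute:
  assumes "\<sigma> permutes {..<n}" "length xs = n" "length L = n"
  shows "list_pair (permute_list \<sigma> xs) (permute_list \<sigma> L) = list_pair xs L"
proof -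
  have "mset (permute_list \<sigma> (zip xs L)) = mset (zip xs L)" using assms by simp
  then have "mset (zip (permute_list \<sigma> xs) (permute_list \<sigma> L)) = mset (zip xs L)"
    using assms by (subst permute_list_zip[symmetric]) auto
  then show ?thesis unfolding list_pair_def by (rule prod_list_permute)
qed

text \<open>Permuting the functionals by \<sigma> amounts to permuting the vectors by its inverse,
  and the sum over all \<sigma> is invariant under inversion. So one expression is symmetric and
  multilinear in both lists.\<close>

lemma symmetrize_list_pair_swap:
  assumes "length xs = n" "length L = n"
  shows "symmetrize n (\<lambda>xs. of_real (list_pair xs L)) xs = symmetrize n (\<lambda>L. of_real (list_pair xs L)) L"
proof -
  have "list_pair (permute_list \<sigma> xs) L = list_pair xs (permute_list (inv \<sigma>) L)" if "\<sigma> permutes {..<n}" for \<sigma>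
  proof -
    have "list_pair xs (permute_list (inv \<sigma>) L)
        = list_pair (permute_list \<sigma> xs) (permute_list \<sigma> (permute_list (inv \<sigma>) L))"
      using that assms by (simp add: list_pair_permute)
    also have "permute_list \<sigma> (permute_list (inv \<sigma>) L) = L"
      using that assms by (subst permute_list_compose[symmetric]) (auto simp: permutes_inv_o)
    finally show ?thesis by simp
  qed
  then show ?thesis
    unfolding symmetrize_def by (subst (2) sum_permutations_inverse) (intro sum.cong, auto)
qed

context nuclear_triple
begin

lemma multilinear_iff: "multilinear n f \<longleftrightarrow> multilinear_on (dual ip) n f"
  unfolding multilinear_def multilinear_on_def dual_linear_map_def by blast

text \<open>This is n! times the symmetric tensor product of the n vectors in L.\<close>

definition sym_prod :: "'n list \<Rightarrow> 'n form" where
  "sym_prod L xs = (if length xs = length L \<and> set xs \<subseteq> dual ip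
     then symmetrize (length L) (\<lambda>xs. of_real (list_pair xs L)) xs else 0)"

lemma list_pair_multilinear_left: "multilinear_on D (length L) (\<lambda>xs. of_real (list_pair xs L))"
  unfolding multilinear_on_def
proof (intro allI impI)
  fix us vs :: "('a \<Rightarrow> real) list" and x z a b
  assume *: "length us + Suc (length vs) = length L \<and> set us \<subseteq> D \<and> set vs \<subseteq> D \<and> x \<in> D \<and> z \<in> D"
  then have i: "length us < length L" by linarith
  obtain K \<xi> M where L: "L = K @ \<xi> # M" "length K = length us"
    using id_take_nth_drop[OF i] i by (intro that) auto
  have p: "list_pair (us @ w # vs) L = list_pair us K * (w \<xi> * list_pair vs M)" for w
    using L by (simp add: list_pair_append)
  show "complex_of_real (list_pair (us @ (a *\<^sub>R x + b *\<^sub>R z) # vs) L) =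
     of_real a * of_real (list_pair (us @ x # vs) L) + of_real b * of_real (list_pair (us @ z # vs) L)"
    unfolding p by (simp add: algebra_simps)
qed

lemma list_pair_multilinear_right:
  assumes "set xs \<subseteq> dual ip"
  shows "multilinear_on UNIV (length xs) (\<lambda>L. of_real (list_pair xs L))"
  unfolding multilinear_on_def
proof (intro allI impI)
  fix us vs :: "'n list" and \<xi> \<eta> :: 'n and a b
  assume *: "length us + Suc (length vs) = length xs \<and> set us \<subseteq> UNIV \<and> set vs \<subseteq> UNIV \<and> \<xi> \<in> UNIV \<and> \<eta> \<in> UNIV"
  then have i: "length us < length xs" by linarith
  obtain K x M where L: "xs = K @ x # M" "length K = length us"
    using id_take_nth_drop[OF i] i by (intro that) auto
  have "linear x" using L assms by (intro dual_linear) auto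
  have p: "list_pair xs (us @ w # vs) = list_pair K us * (x w * list_pair M vs)" for w
    using L by (simp add: list_pair_append)
  show "complex_of_real (list_pair xs (us @ (a *\<^sub>R \<xi> + b *\<^sub>R \<eta>) # vs)) =
     of_real a * of_real (list_pair xs (us @ \<xi> # vs)) + of_real b * of_real (list_pair xs (us @ \<eta> # vs))"
    unfolding p using \<open>linear x\<close> by (simp add: linear_add linear_cmul algebra_simps)
qed

lemma hs_product_bound:
  assumes "\<And>xs. xs \<in> lists_of E n \<Longrightarrow> cmod (f xs) \<le> M * (\<Prod>x\<leftarrow>xs. w x)" "0 \<le> M"
    "\<And>x. x \<in> E \<Longrightarrow> 0 \<le> w x" "finite E"
  shows "hs E n f \<le> M\<^sup>2 * (\<Sum>x\<in>E. (w x)\<^sup>2) ^ n"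
proof -
  have "hs E n f \<le> (\<Sum>xs\<in>lists_of E n. (M * (\<Prod>x\<leftarrow>xs. w x))\<^sup>2)"
    unfolding hs_def using assms by (intro sum_mono power_mono) auto
  also have "\<dots> = M\<^sup>2 * (\<Sum>xs\<in>lists_of E n. (\<Prod>x\<leftarrow>xs. (w x)\<^sup>2))"
  proof -
    have "(\<Prod>x\<leftarrow>xs. w x)\<^sup>2 = (\<Prod>x\<leftarrow>xs. (w x)\<^sup>2)" for xs
      by (induction xs) (auto simp: power_mult_distrib)
    then show ?thesis by (simp add: power_mult_distrib sum_distrib_left)
  qed
  finally show ?thesis by (simp add: sum_lists_of_prod)
qed

text \<open>Bessel's inequality for the functional \<open>ip p \<xi>\<close>, whose coordinate along
  e is \<open>e \<xi>\<close> by \<open>dual_ip_ip\<close>.\<close>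

lemma bessel:
  assumes "D.orthonormal p E"
  shows "(\<Sum>x\<in>E. (x \<xi>)\<^sup>2) \<le> (hn p \<xi>)\<^sup>2"
proof -
  have "0 \<le> dual_ip ip p (ip p \<xi>) (ip p \<xi>) - (\<Sum>e\<in>E. (dual_ip ip p (ip p \<xi>) e)\<^sup>2)"
    using D.nonneg[OF D.residual(1)[OF assms ip_hdual]] unfolding D.residual(3)[OF assms ip_hdual] .
  moreover have "dual_ip ip p (ip p \<xi>) e = e \<xi>" if "e \<in> E" for e
    using D.commute[OF ip_hdual D.orthonormalD(2)[OF assms that]] dual_ip_ip[OF D.orthonormalD(2)[OF assms that]]
    by simp
  ultimately show ?thesis by (simp add: dual_ip_ip ip_hdual hn_square)
qed

text \<open>Each factor is bounded by a sum over all vectors of L. The loss is harmless, and the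
  bound no longer sees the order of the arguments, so it is the same for all permutations and its
  squares factor over the slots.\<close>

lemma abs_list_pair_le: "length xs = length L \<Longrightarrow> \<bar>list_pair xs L\<bar> \<le> (\<Prod>x\<leftarrow>xs. \<Sum>\<xi>\<in>set L. \<bar>x \<xi>\<bar>)"
proof -
  have "\<bar>list_pair xs L\<bar> \<le> (\<Prod>x\<leftarrow>xs. \<Sum>\<xi>\<in>S. \<bar>x \<xi>\<bar>)" if "length xs = length L" "set L \<subseteq> S" "finite S" for S
    using that
  proof (induction xs L rule: list_induct2)
    case (Cons x xs \<xi> L)
    have "\<bar>x \<xi>\<bar> \<le> (\<Sum>\<xi>\<in>S. \<bar>x \<xi>\<bar>)" using Cons by (intro member_le_sum) auto
    moreover have "\<bar>list_pair xs L\<bar> \<le> (\<Prod>x\<leftarrow>xs. \<Sum>\<xi>\<in>S. \<bar>x \<xi>\<bar>)" using Cons by simp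
    ultimately show ?case by (auto simp: abs_mult intro!: mult_mono sum_nonneg)
  qed simp
  then show "length xs = length L \<Longrightarrow> ?thesis" by simp
qed

lemma sym_prod_tensor: "sym_prod L \<in> sym_tensors ip (length L)"
proof -
  let ?n = "length L"
  let ?S = "symmetrize ?n (\<lambda>xs. of_real (list_pair xs L)) :: ('n \<Rightarrow> real) list \<Rightarrow> complex"
  have "multilinear ?n (sym_prod L)"
    unfolding multilinear_iff multilinear_on_def
  proof (intro allI impI)
    fix us vs :: "('n \<Rightarrow> real) list" and x z a b
    assume *: "length us + Suc (length vs) = ?n \<and> set us \<subseteq> dual ip \<and> set vs \<subseteq> dual ip \<and> x \<in> dual ip \<and> z \<in> dual ip"
    then have "w \<in> dual ip \<Longrightarrow> sym_prod L (us @ w # vs) = ?S (us @ w # vs)" for w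
      by (simp add: sym_prod_def)
    then show "sym_prod L (us @ (a *\<^sub>R x + b *\<^sub>R z) # vs) =
       of_real a * sym_prod L (us @ x # vs) + of_real b * sym_prod L (us @ z # vs)"
      using multilinear_onD[OF symmetrize_multilinear[OF list_pair_multilinear_left[of "dual ip" L]], of us vs x z a b] *
      by simp
  qed
  moreover have "sym_prod L xs = sym_prod L ys" if "mset xs = mset ys" for xs ys
  proof -
    have "length xs = length ys" "set xs = set ys" using that mset_eq_length mset_eq_setD by blast+
    then show ?thesis
      using symmetric_onD[OF symmetrize_symmetric that, of ?n UNIV] by (auto simp: sym_prod_def)
  qed
  moreover have "bdd_above (hs_sums ip p ?n (sym_prod L))" for p
  proof (rule hs_sums_bdd)
    fix E assume E: "D.orthonormal p E"
    define w where "w x = (\<Sum>\<xi>\<in>set L. \<bar>x \<xi>\<bar>)" for x :: "'n \<Rightarrow> real"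
    have w0: "0 \<le> w x" for x by (simp add: w_def sum_nonneg)
    have bnd: "cmod (sym_prod L xs) \<le> fact ?n * (\<Prod>x\<leftarrow>xs. w x)" if "xs \<in> lists_of E ?n" for xs
    proof -
      have len: "length xs = ?n" "set xs \<subseteq> dual ip" using lists_of_dual[OF orthonormal_dual[OF E] that] by auto
      have "cmod (sym_prod L xs) \<le> (\<Sum>\<sigma> | \<sigma> permutes {..<?n}. \<bar>list_pair (permute_list \<sigma> xs) L\<bar>)"
        using len unfolding sym_prod_def symmetrize_def
        by (simp add: order_trans[OF norm_sum])
      also have "\<dots> \<le> (\<Sum>\<sigma> | \<sigma> permutes {..<?n}. (\<Prod>x\<leftarrow>xs. w x))"
      proof (rule sum_mono)
        fix \<sigma> assume "\<sigma> \<in> {\<sigma>. \<sigma> permutes {..<?n}}"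
        then have "mset (permute_list \<sigma> xs) = mset xs" using len by simp
        then have "(\<Prod>x\<leftarrow>permute_list \<sigma> xs. w x) = (\<Prod>x\<leftarrow>xs. w x)" by (rule prod_list_permute)
        then show "\<bar>list_pair (permute_list \<sigma> xs) L\<bar> \<le> (\<Prod>x\<leftarrow>xs. w x)"
          using abs_list_pair_le[of "permute_list \<sigma> xs" L] len by (simp add: w_def)
      qed
      finally show ?thesis by (simp add: card_permutations)
    qed
    have sq: "(\<Sum>x\<in>E. (w x)\<^sup>2) \<le> real (card (set L)) * (\<Sum>\<xi>\<in>set L. (hn p \<xi>)\<^sup>2)"
    proof -
      have "(\<Sum>x\<in>E. (w x)\<^sup>2) \<le> (\<Sum>x\<in>E. (\<Sum>\<xi>\<in>set L. \<bar>x \<xi>\<bar>\<^sup>2) * real (card (set L)))"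
        unfolding w_def by (intro sum_mono sum_squared_le_sum_of_squares)
      also have "\<dots> = real (card (set L)) * (\<Sum>\<xi>\<in>set L. \<Sum>x\<in>E. (x \<xi>)\<^sup>2)"
        unfolding sum_distrib_right[symmetric] by (subst sum.swap) simp
      also have "\<dots> \<le> real (card (set L)) * (\<Sum>\<xi>\<in>set L. (hn p \<xi>)\<^sup>2)"
        by (intro mult_left_mono sum_mono bessel E) auto
      finally show ?thesis .
    qed
    have "hs E ?n (sym_prod L) \<le> (fact ?n)\<^sup>2 * (\<Sum>x\<in>E. (w x)\<^sup>2) ^ ?n"
      using bnd w0 D.orthonormalD(1)[OF E] by (intro hs_product_bound) auto
    also have "\<dots> \<le> (fact ?n)\<^sup>2 * (real (card (set L)) * (\<Sum>\<xi>\<in>set L. (hn p \<xi>)\<^sup>2)) ^ ?n"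
      using sq by (intro mult_left_mono power_mono sum_nonneg) auto
    finally show "hs E ?n (sym_prod L) \<le> (fact ?n)\<^sup>2 * (real (card (set L)) * (\<Sum>\<xi>\<in>set L. (hn p \<xi>)\<^sup>2)) ^ ?n" .
  qed
  moreover have "sym_prod L xs = 0" if "\<not> (length xs = ?n \<and> set xs \<subseteq> dual ip)" for xs
    using that by (auto simp: sym_prod_def)
  ultimately show ?thesis unfolding sym_tensors_iff by blast
qed

lemma sym_prod_eq:
  "sym_prod L xs = (if length xs = length L \<and> set xs \<subseteq> dual ip
     then symmetrize (length L) (\<lambda>L. of_real (list_pair xs L)) L else 0)"
  by (simp add: sym_prod_def symmetrize_list_pair_swap)

lemma sym_prod_comb:
  "sym_prod (us @ (a *\<^sub>R \<xi> + b *\<^sub>R \<eta>) # vs) =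
     (\<lambda>xs. of_real a * sym_prod (us @ \<xi> # vs) xs + of_real b * sym_prod (us @ \<eta> # vs) xs)"
proof
  fix xs
  show "sym_prod (us @ (a *\<^sub>R \<xi> + b *\<^sub>R \<eta>) # vs) xs =
     of_real a * sym_prod (us @ \<xi> # vs) xs + of_real b * sym_prod (us @ \<eta> # vs) xs"
  proof (cases "length xs = length us + Suc (length vs) \<and> set xs \<subseteq> dual ip")
    case True
    then show ?thesis
      using multilinear_onD[OF symmetrize_multilinear[OF list_pair_multilinear_right[of xs]], of us vs \<xi> \<eta> a b]
      by (simp add: sym_prod_eq)
  qed (auto simp: sym_prod_def)
qed

lemma sym_prod_cong:
  assumes "mset K = mset L"
  shows "sym_prod K = sym_prod L"
proof
  fix xs
  have "length K = length L" using assms by (rule mset_eq_length)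
  then show "sym_prod K xs = sym_prod L xs"
    using symmetric_onD[OF symmetrize_symmetric assms, of "length K" UNIV] by (simp add: sym_prod_eq)
qed

lemma sym_prod_replicate:
  "sym_prod (replicate n \<theta>) = (\<lambda>xs. fact n * tensor_power ip n (\<theta>, 0) xs)"
proof
  fix xs
  show "sym_prod (replicate n \<theta>) xs = fact n * tensor_power ip n (\<theta>, 0) xs"
  proof (cases "length xs = n \<and> set xs \<subseteq> dual ip")
    case True
    have "(\<Prod>x\<leftarrow>xs. cpair x (\<theta>, 0)) = of_real (\<Prod>x\<leftarrow>xs. x \<theta>)"
      using True dual_linear[THEN linear_0]
      by (induction xs arbitrary: n) (auto simp: cpair_def complex_of_real_def complex_eq_iff)
    then show ?thesis
      using True by (simp add: sym_prod_eq symmetrize_replicate list_pair_replicate tensor_power_def)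
  qed (auto simp: sym_prod_def tensor_power_def)
qed

lemma tensor_power_tensor: "tensor_power ip n (\<theta>, 0) \<in> sym_tensors ip n"
proof -
  have "(\<lambda>xs. (1 / fact n) * sym_prod (replicate n \<theta>) xs) \<in> sym_tensors ip n"
    using sym_prod_tensor[of "replicate n \<theta>"] by (intro sym_tensors_scale) simp
  then show ?thesis by (simp add: sym_prod_replicate)
qed

section \<open>Series of symmetric tensors and continuous functionals\<close>

text \<open>Minkowski's inequality for the partial sums, then a limit over finitely many lists.
  Neither the terms nor g need be tensors, only numerical values on these lists.\<close>

lemma hs_series:
  assumes "finite E" "\<And>xs. xs \<in> lists_of E n \<Longrightarrow> (\<lambda>m. f m xs) sums g xs"
    "\<And>m. hs E n (f m) \<le> (u m)\<^sup>2" "\<And>m. 0 \<le> u m" "summable u"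
  shows "hs E n g \<le> (suminf u)\<^sup>2"
proof -
  have part: "sqrt (hs E n (\<lambda>xs. \<Sum>m<M. f m xs)) \<le> (\<Sum>m<M. u m)" for M
  proof (induction M)
    case (Suc M)
    have "sqrt (hs E n (f M)) \<le> u M" using assms(3,4) by (intro real_le_lsqrt) auto
    then show ?case
      using Suc sqrt_hs_triangle[of E n "\<lambda>xs. \<Sum>m<M. f m xs" "f M"] by simp
  qed (simp add: hs_def)
  have "hs E n (\<lambda>xs. \<Sum>m<M. f m xs) \<le> (suminf u)\<^sup>2" for M
  proof -
    have "sqrt (hs E n (\<lambda>xs. \<Sum>m<M. f m xs)) \<le> suminf u"
      using part[of M] sum_le_suminf[OF assms(5), of "{..<M}"] assms(4) by (simp add: order_trans)
    then show ?thesis by (rule sqrt_le_D)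
  qed
  moreover have "(\<lambda>M. hs E n (\<lambda>xs. \<Sum>m<M. f m xs)) \<longlonglongrightarrow> hs E n g"
    unfolding hs_def using assms(2) by (intro tendsto_intros) (auto simp: sums_def)
  ultimately show ?thesis by (intro LIMSEQ_le_const2) auto
qed

lemma sym_tensors_series_summable:
  assumes f: "\<And>m. f m \<in> sym_tensors ip n" and u: "\<And>p. summable (\<lambda>m. tn p n (f m))"
  shows "summable (\<lambda>m. f m xs)"
proof (cases "length xs = n \<and> set xs \<subseteq> dual ip")
  case True
  then obtain q where q: "set xs \<subseteq> hdual ip q" using finite_subset_dual[of "set xs" 0] by auto
  show ?thesis
  proof (rule summable_comparison_test')
    show "summable (\<lambda>m. tn q n (f m) * (\<Prod>x\<leftarrow>xs. dn q x))" by (rule summable_mult2[OF u])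
    show "cmod (f m xs) \<le> tn q n (f m) * (\<Prod>x\<leftarrow>xs. dn q x)" if "m \<ge> 0" for m
      using True q by (intro sym_tensors_eval f) auto
  qed
next
  case False
  then have "(\<lambda>m. f m xs) = (\<lambda>_. 0)" using sym_tensorsD(1)[OF f] by auto
  then show ?thesis by simp
qed

text \<open>This replaces completeness of the tensor space: a series that converges absolutely in
  every norm has its pointwise sum as a tensor.\<close>

lemma sym_tensors_series:
  assumes f: "\<And>m. f m \<in> sym_tensors ip n" and u: "\<And>p. summable (\<lambda>m. tn p n (f m))"
  shows "(\<lambda>xs. \<Sum>m. f m xs) \<in> sym_tensors ip n" "tn p n (\<lambda>xs. \<Sum>m. f m xs) \<le> (\<Sum>m. tn p n (f m))"
proof -
  note s = sym_tensors_series_summable[of f, OF f u]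
  have bound: "hs E n (\<lambda>xs. \<Sum>m. f m xs) \<le> (\<Sum>m. tn p n (f m))\<^sup>2" if "D.orthonormal p E" for p E
    by (rule hs_series[OF D.orthonormalD(1)[OF that] summable_sums[OF s]
          hs_le_tn[OF sym_tensorsD(4)[OF f] that] tn_nonneg[OF f] u])
  have ml: "multilinear n (\<lambda>xs. \<Sum>m. f m xs)"
    unfolding multilinear_def dual_linear_map_def
  proof (intro allI impI ballI)
    fix us vs :: "('n \<Rightarrow> real) list" and x z a b
    assume *: "length us + Suc (length vs) = n \<and> set us \<subseteq> dual ip \<and> set vs \<subseteq> dual ip" "x \<in> dual ip" "z \<in> dual ip"
    have "f m (us @ (a *\<^sub>R x + b *\<^sub>R z) # vs) = of_real a * f m (us @ x # vs) + of_real b * f m (us @ z # vs)" for m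
      using multilinearD[OF sym_tensorsD(3)[OF f], of us vs] * unfolding dual_linear_map_def by blast
    then show "(\<Sum>m. f m (us @ (a *\<^sub>R x + b *\<^sub>R z) # vs))
        = of_real a * (\<Sum>m. f m (us @ x # vs)) + of_real b * (\<Sum>m. f m (us @ z # vs))"
      by (simp add: suminf_add[symmetric] suminf_mult s summable_mult)
  qed
  have sym: "(\<Sum>m. f m xs) = (\<Sum>m. f m ys)" if "mset xs = mset ys" for xs ys
    using sym_tensorsD(2)[OF f that] by simp
  have out: "(\<Sum>m. f m xs) = 0" if "\<not> (length xs = n \<and> set xs \<subseteq> dual ip)" for xs
    using sym_tensorsD(1)[OF f that] by simp
  have bdd: "bdd_above (hs_sums ip p n (\<lambda>xs. \<Sum>m. f m xs))" for p by (rule hs_sums_bdd[OF bound])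
  show "(\<lambda>xs. \<Sum>m. f m xs) \<in> sym_tensors ip n"
    unfolding sym_tensors_iff using ml sym out bdd by blast
  show "tn p n (\<lambda>xs. \<Sum>m. f m xs) \<le> (\<Sum>m. tn p n (f m))"
    using bound f u by (intro tn_least suminf_nonneg) auto
qed

section \<open>Continuous functionals on symmetric tensors\<close>

lemma tensor_dual_comb:
  "T \<in> tensor_dual ip n \<Longrightarrow> f \<in> sym_tensors ip n \<Longrightarrow> g \<in> sym_tensors ip n \<Longrightarrow>
     T (\<lambda>xs. a * f xs + b * g xs) = a * T f + b * T g"
  unfolding tensor_dual_def by blast

lemma tensor_dual_scale:
  assumes "T \<in> tensor_dual ip n" "f \<in> sym_tensors ip n"
  shows "T (\<lambda>xs. a * f xs) = a * T f"
  using tensor_dual_comb[OF assms assms(2), of a 0] by simp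

lemma tensor_dual_sum:
  assumes T: "T \<in> tensor_dual ip n" and "finite I" "\<And>i. i \<in> I \<Longrightarrow> f i \<in> sym_tensors ip n"
  shows "T (\<lambda>xs. \<Sum>i\<in>I. c i * f i xs) = (\<Sum>i\<in>I. c i * T (f i))"
  using assms(2,3)
proof (induction I rule: finite_induct)
  case empty
  show ?case using tensor_dual_scale[OF T sym_tensors_zero(1), of 0] by simp
next
  case (insert i I)
  have "(\<lambda>xs. \<Sum>i\<in>I. c i * f i xs) \<in> sym_tensors ip n"
    using sym_tensors_sum[of I f n c] insert by blast
  then show ?case
    using tensor_dual_comb[OF T insert.prems[of i], of "\<lambda>xs. \<Sum>i\<in>I. c i * f i xs" "c i" 1] insert by simp
qed

lemma tensor_dual_bound:
  assumes "T \<in> tensor_dual ip n"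
  shows "\<exists>p C. 0 \<le> C \<and> (\<forall>f\<in>sym_tensors ip n. cmod (T f) \<le> C * tn p n f)"
proof -
  obtain p C where C: "\<forall>f\<in>sym_tensors ip n. cmod (T f) \<le> C * tn p n f"
    using assms unfolding tensor_dual_def by blast
  have "cmod (T f) \<le> \<bar>C\<bar> * tn p n f" if "f \<in> sym_tensors ip n" for f
    using bspec[OF C that] mult_right_mono[OF abs_ge_self tn_nonneg[OF that], of C p] by linarith
  then show ?thesis by (intro exI[of _ p] exI[of _ "\<bar>C\<bar>"]) auto
qed

text \<open>A tail of the series is again a tensor, with norm at most the tail of the norms;
  continuity of T then makes the error of the partial sums tend to 0.\<close>

lemma tensor_dual_series:
  assumes T: "T \<in> tensor_dual ip n"
    and f: "\<And>m. f m \<in> sym_tensors ip n" and u: "\<And>p. summable (\<lambda>m. tn p n (f m))"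
  shows "(\<lambda>m. T (f m)) sums T (\<lambda>xs. \<Sum>m. f m xs)"
proof -
  obtain p C where C: "0 \<le> C" "\<And>f. f \<in> sym_tensors ip n \<Longrightarrow> cmod (T f) \<le> C * tn p n f"
    using tensor_dual_bound[OF T] by blast
  note s = sym_tensors_series_summable[of f, OF f u]
  let ?g = "\<lambda>xs. \<Sum>m. f m xs"
  have bnd: "cmod ((\<Sum>m<M. T (f m)) - T ?g) \<le> C * ((\<Sum>m. tn p n (f m)) - (\<Sum>m<M. tn p n (f m)))" for M
  proof -
    let ?t = "\<lambda>xs. \<Sum>m. f (m + M) xs"
    have tu: "summable (\<lambda>m. tn p n (f (m + M)))" for p
      using u[of p] summable_iff_shift[of "\<lambda>m. tn p n (f m)" M] by simp
    note t = sym_tensors_series[of "\<lambda>m. f (m + M)", OF f tu]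
    have part: "(\<lambda>xs. \<Sum>m<M. 1 * f m xs) \<in> sym_tensors ip n"
      using sym_tensors_sum[of "{..<M}" f n "\<lambda>_. 1" p] f by blast
    have "?g = (\<lambda>xs. 1 * ?t xs + 1 * (\<Sum>m<M. 1 * f m xs))"
      using suminf_split_initial_segment[OF s, of _ M] by (auto simp: fun_eq_iff)
    then have "T ?g = 1 * T ?t + 1 * (\<Sum>m<M. 1 * T (f m))"
      using tensor_dual_comb[OF T t(1) part, of 1 1] tensor_dual_sum[OF T, of "{..<M}" f "\<lambda>_. 1"] f by simp
    then have "cmod ((\<Sum>m<M. T (f m)) - T ?g) = cmod (T ?t)" by simp
    also have "\<dots> \<le> C * tn p n ?t" by (rule C(2)[OF t(1)])
    also have "\<dots> \<le> C * (\<Sum>m. tn p n (f (m + M)))" using C(1) t(2) by (intro mult_left_mono)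
    also have "(\<Sum>m. tn p n (f (m + M))) = (\<Sum>m. tn p n (f m)) - (\<Sum>m<M. tn p n (f m))"
      by (rule suminf_minus_initial_segment[OF u])
    finally show ?thesis .
  qed
  have "(\<lambda>M. C * ((\<Sum>m. tn p n (f m)) - (\<Sum>m<M. tn p n (f m)))) \<longlonglongrightarrow> C * ((\<Sum>m. tn p n (f m)) - (\<Sum>m. tn p n (f m)))"
    by (intro tendsto_intros summable_LIMSEQ u)
  then have lim: "(\<lambda>M. C * ((\<Sum>m. tn p n (f m)) - (\<Sum>m<M. tn p n (f m)))) \<longlonglongrightarrow> 0" by simp
  have "(\<lambda>M. (\<Sum>m<M. T (f m)) - T ?g) \<longlonglongrightarrow> 0"
    by (rule Lim_null_comparison[OF _ lim]) (simp add: bnd)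
  then show ?thesis unfolding sums_def by (rule LIM_zero_cancel)
qed

text \<open>
  Testing \<open>T\<close> on the combination of the tensors \<open>f (xs @ _)\<close> with coefficients conjugate to
  the values \<open>T (f (xs @ _))\<close> avoids a choice of near-optimal orthonormal systems.
\<close>

lemma partial_contraction_bound:
  assumes T: "T \<in> tensor_dual ip k" and C: "\<And>h. h \<in> sym_tensors ip k \<Longrightarrow> cmod (T h) \<le> C * tn p k h" "0 \<le> C"
    and f: "f \<in> sym_tensors ip (n + k)" and E: "D.orthonormal p E"
  shows "hs E n (\<lambda>xs. T (\<lambda>ys. f (xs @ ys))) \<le> (C * tn p (n + k) f)\<^sup>2"
proof -
  define c where "c xs = cnj (T (\<lambda>ys. f (xs @ ys)))" for xs
  define S where "S = (\<Sum>xs\<in>lists_of E n. (cmod (c xs))\<^sup>2)"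
  define h where "h ys = (\<Sum>xs\<in>lists_of E n. c xs * f (xs @ ys))" for ys
  have S0: "0 \<le> S" by (simp add: S_def sum_nonneg)
  have fin: "finite (lists_of E n)" using D.orthonormalD(1)[OF E] by simp
  have app: "(\<lambda>ys. f (xs @ ys)) \<in> sym_tensors ip k" if "xs \<in> lists_of E n" for xs
    using sym_tensors_append[OF f] lists_of_dual[OF orthonormal_dual[OF E] that] by auto
  have hs: "h \<in> sym_tensors ip k"
    using sym_tensors_sum[OF fin app, of "\<lambda>xs. xs" c] unfolding h_def by blast
  have "tn p k h \<le> sqrt S * tn p (n + k) f"
  proof (rule tn_least)
    fix E2 assume E2: "D.orthonormal p E2"
    \<comment> \<open>One system for both groups of slots: it contains E, over which the first n
      arguments run, and spans the system used for the others.\<close>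
    obtain E' where E': "D.orthonormal p E'" "E \<subseteq> E'" "E2 \<subseteq> span E'"
      using D.orthonormal_extend[OF E, of E2] D.orthonormalD[OF E2] by blast
    have "hs E2 k h \<le> 1 ^ (2 * k) * hs E' k h"
      by (rule hs_span_le[OF E2 E'(1,3) _ _ sym_tensorsD(3)[OF hs]]) auto
    also have "\<dots> \<le> (\<Sum>ys\<in>lists_of E' k. S * (\<Sum>xs\<in>lists_of E n. (cmod (f (xs @ ys)))\<^sup>2))"
      unfolding hs_def h_def S_def by (simp add: sum_mono cmod_sum_le_cauchy_schwarz)
    also have "\<dots> = S * (\<Sum>xs\<in>lists_of E n. hs E' k (\<lambda>ys. f (xs @ ys)))"
      unfolding hs_def sum_distrib_left[symmetric] by (subst sum.swap) simp
    also have "\<dots> \<le> S * (\<Sum>xs\<in>lists_of E' n. hs E' k (\<lambda>ys. f (xs @ ys)))"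
      using S0 D.orthonormalD(1)[OF E'(1)] lists_of_mono[OF E'(2)] by (intro mult_left_mono sum_mono2) auto
    also have "\<dots> = S * hs E' (n + k) f" by (simp add: hs_append)
    also have "\<dots> \<le> S * (tn p (n + k) f)\<^sup>2"
      using S0 by (intro mult_left_mono hs_le_tn sym_tensorsD(4)[OF f] E')
    finally show "hs E2 k h \<le> (sqrt S * tn p (n + k) f)\<^sup>2" using S0 by (simp add: power_mult_distrib)
  qed (use S0 f in auto)
  then have "C * tn p k h \<le> C * (sqrt S * tn p (n + k) f)" using C(2) by (rule mult_left_mono)
  moreover have "T h = of_real S"
  proof -
    have "c xs * T (\<lambda>ys. f (xs @ ys)) = of_real ((cmod (c xs))\<^sup>2)" for xs
      unfolding c_def complex_norm_square by simp
    then show ?thesis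
      using tensor_dual_sum[OF T fin app, of "\<lambda>xs. xs" c] by (simp add: h_def[abs_def] S_def)
  qed
  ultimately have "S \<le> sqrt S * (C * tn p (n + k) f)"
    using C(1)[OF hs] S0 by (simp add: algebra_simps)
  then have "sqrt S \<le> C * tn p (n + k) f \<or> S = 0"
    using S0 by (metis mult_le_cancel_left_pos real_sqrt_gt_zero real_sqrt_mult_self le_less abs_of_nonneg)
  then have "S \<le> (C * tn p (n + k) f)\<^sup>2"
    using sqrt_le_D by auto
  then show ?thesis by (simp add: hs_def S_def c_def)
qed

section \<open>Approximation by tensors of finite rank\<close>

definition proj :: "nat \<Rightarrow> 'n set \<Rightarrow> 'n \<Rightarrow> 'n" where
  "proj s B \<xi> = (\<Sum>b\<in>B. ip s \<xi> b *\<^sub>R b)"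

lemma hn_proj_le:
  assumes "N.orthonormal s B"
  shows "hn s (proj s B \<xi>) \<le> hn s \<xi>" "hn s (\<xi> - proj s B \<xi>) \<le> hn s \<xi>"
proof -
  have 1: "ip s (proj s B \<xi>) (proj s B \<xi>) = (\<Sum>b\<in>B. (ip s \<xi> b)\<^sup>2)"
    unfolding proj_def by (rule N.sum_norm[OF assms])
  have 2: "ip s (\<xi> - proj s B \<xi>) (\<xi> - proj s B \<xi>) = ip s \<xi> \<xi> - (\<Sum>b\<in>B. (ip s \<xi> b)\<^sup>2)"
    unfolding proj_def by (rule N.residual(3)[OF assms]) simp
  have "(\<Sum>b\<in>B. (ip s \<xi> b)\<^sup>2) \<ge> 0" by (simp add: sum_nonneg)
  then have "ip s (\<xi> - proj s B \<xi>) (\<xi> - proj s B \<xi>) \<le> ip s \<xi> \<xi>" using 2 by linarith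
  then show "hn s (\<xi> - proj s B \<xi>) \<le> hn s \<xi>" by (simp add: hnorm_def)
  have "0 \<le> ip s (\<xi> - proj s B \<xi>) (\<xi> - proj s B \<xi>)" by (rule N.nonneg) simp
  then have "ip s (proj s B \<xi>) (proj s B \<xi>) \<le> ip s \<xi> \<xi>" using 1 2 by linarith
  then show "hn s (proj s B \<xi>) \<le> hn s \<xi>" by (simp add: hnorm_def)
qed

text \<open>An orthonormal system that nearly exhausts the Hilbert-Schmidt norm leaves only a small remainder.\<close>

lemma hs_embedding_projection:
  assumes "hs_embedding ip s r" "0 < \<epsilon>"
  shows "\<exists>B. N.orthonormal s B \<and> (\<forall>\<xi>. hn r (\<xi> - proj s B \<xi>) \<le> \<epsilon> * hn s \<xi>)"
proof -
  define V where "V = {\<Sum>e\<in>B. (hn r e)\<^sup>2 | B. N.orthonormal s B}"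
  obtain C where "\<And>B. N.orthonormal s B \<Longrightarrow> (\<Sum>e\<in>B. (hn r e)\<^sup>2) \<le> C"
    using assms(1) unfolding hs_embedding_def N.orthonormal_def by (auto 4 3)
  then have bdd: "bdd_above V" by (auto simp: V_def intro!: bdd_aboveI[of _ C])
  have "N.orthonormal s {}" by (simp add: N.orthonormal_def)
  then have ne: "V \<noteq> {}" by (auto simp: V_def)
  have "Sup V - \<epsilon>\<^sup>2 < Sup V" using assms(2) by simp
  then obtain B where B: "N.orthonormal s B" "Sup V - \<epsilon>\<^sup>2 < (\<Sum>e\<in>B. (hn r e)\<^sup>2)"
    unfolding less_cSup_iff[OF ne bdd] by (auto simp: V_def)
  have "hn r (\<xi> - proj s B \<xi>) \<le> \<epsilon> * hn s \<xi>" for \<xi>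
  proof (cases "\<xi> - proj s B \<xi> = 0")
    case True
    then show ?thesis using assms(2) by simp
  next
    case False
    define \<eta> where "\<eta> = \<xi> - proj s B \<xi>"
    define e where "e = (1 / sqrt (ip s \<eta> \<eta>)) *\<^sub>R \<eta>"
    have pos: "0 < hn s \<eta>" using False by (simp add: \<eta>_def hn_pos)
    \<comment> \<open>The normalized remainder e extends B to another admissible system, so its
      contribution is at most the gap below the supremum.\<close>
    have "N.orthonormal s (insert e B)" "e \<notin> B"
      using N.orthonormal_insert_residual[OF B(1), of \<xi>] False
      by (auto simp: e_def \<eta>_def proj_def)
    then have "(\<Sum>e\<in>insert e B. (hn r e)\<^sup>2) \<in> V" "(\<Sum>e\<in>insert e B. (hn r e)\<^sup>2) = (hn r e)\<^sup>2 + (\<Sum>e\<in>B. (hn r e)\<^sup>2)"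
      using N.orthonormalD(1)[OF B(1)] unfolding V_def by (blast, simp)
    then have "(\<Sum>e\<in>insert e B. (hn r e)\<^sup>2) \<le> Sup V" "(\<Sum>e\<in>insert e B. (hn r e)\<^sup>2) = (hn r e)\<^sup>2 + (\<Sum>e\<in>B. (hn r e)\<^sup>2)"
      using bdd by (auto intro: cSup_upper)
    then have "(hn r e)\<^sup>2 \<le> \<epsilon>\<^sup>2" using B(2) by linarith
    then have "hn r e \<le> \<epsilon>" using assms(2) by (simp add: abs_le_square_iff[symmetric])
    moreover have "hn r e = hn r \<eta> / hn s \<eta>"
      using pos by (simp add: e_def hn_scale hnorm_def[symmetric])
    ultimately have "hn r \<eta> \<le> \<epsilon> * hn s \<eta>" using pos by (simp add: field_simps)
    also have "\<dots> \<le> \<epsilon> * hn s \<xi>" using hn_proj_le(2)[OF B(1)] assms(2) by (simp add: \<eta>_def)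
    finally show ?thesis by (simp add: \<eta>_def)
  qed
  then show ?thesis using B(1) by blast
qed

text \<open>The transpose of \<open>proj s B\<close>: a form evaluated on arguments changed by it is
  the form of the projected tensor.\<close>

definition dproj :: "nat \<Rightarrow> 'n set \<Rightarrow> ('n \<Rightarrow> real) \<Rightarrow> 'n \<Rightarrow> real" where
  "dproj s B x = x \<circ> proj s B"

lemma linear_dproj: "linear (dproj s B)"
  by (intro linearI) (auto simp: dproj_def)

lemma dproj_hdual:
  assumes "linear x"
  shows "dproj s B x \<in> hdual ip s"
proof -
  have "dproj s B x = (\<Sum>b\<in>B. x b *\<^sub>R ip s b)"
    using assms by (auto simp: dproj_def proj_def linear_sum linear_cmul sum_fun_apply N.commute mult.commute)
  then show ?thesis by (auto intro: ip_hdual)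
qed

lemma dproj_dual: "x \<in> dual ip \<Longrightarrow> dproj s B x \<in> dual ip"
  by (rule dualI[OF dproj_hdual[OF dual_linear]])

text \<open>The recursion of \<open>hs_approx\<close>. The factors 2 come from
  \<open>(a + b)\<^sup>2 \<le> 2 a\<^sup>2 + 2 b\<^sup>2\<close>; the first summand pays for
  exchanging the other n slots, the second for projecting the first slot. Its growth in n is
  harmless because n stays fixed while \<epsilon> tends to 0.\<close>

primrec approx_const :: "real \<Rightarrow> nat \<Rightarrow> real" where
  "approx_const c 0 = 0"
| "approx_const c (Suc n) = 2 * c ^ (2 * n) + 2 * c\<^sup>2 * approx_const c n"

text \<open>The arguments are projected one after the other, and every change of a single argument
  is small by the bound with \<epsilon>. Three slot estimates are involved: for the identity, for
  the projection and for their difference, which is why E' must span both E and its projected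
  image.\<close>

lemma hs_approx:
  fixes r s :: nat
  assumes E: "D.orthonormal r E" and E': "D.orthonormal s E'"
    and span: "E \<subseteq> span E'" "dproj s B ` E \<subseteq> span E'"
    and c: "\<And>x. x \<in> hdual ip r \<Longrightarrow> dn s x \<le> c * dn r x" "0 \<le> c"
    and c': "\<And>x. x \<in> hdual ip r \<Longrightarrow> dn s (dproj s B x) \<le> c * dn r x"
    and \<epsilon>: "\<And>x. x \<in> hdual ip r \<Longrightarrow> dn s (x - dproj s B x) \<le> \<epsilon> * dn r x" "0 \<le> \<epsilon>"
  shows "multilinear n f \<Longrightarrow> hs E n (\<lambda>xs. f xs - f (map (dproj s B) xs)) \<le> approx_const c n * \<epsilon>\<^sup>2 * hs E' n f"
proof (induction n arbitrary: f)
  case 0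
  then show ?case by (simp add: hs_def)
next
  case (Suc n)
  let ?P = "dproj s B"
  note Ed = orthonormal_dual[OF E] and Ed' = orthonormal_dual[OF E']
  have ml: "dual_linear_map (\<lambda>x. f (x # xs))" if "xs \<in> lists_of (E \<union> E') n" for xs
    using that Ed Ed' by (intro multilinear_Cons[OF Suc.prems]) (auto simp: lists_of_def)
  have K0: "0 \<le> approx_const c n" using c(2) by (induction n) auto
  \<comment> \<open>The error of projecting the first argument alone; b is the error of projecting
    the others after it.\<close>
  define a where "a x xs = f ((x - ?P x) # xs)" for x xs
  define b where "b x xs = f (?P x # xs) - f (?P x # map ?P xs)" for x xs
  have split: "f (x # xs) - f (map ?P (x # xs)) = a x xs + b x xs" if "x \<in> E" "xs \<in> lists_of E n" for x xs
  proof -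
    have "f ((1 *\<^sub>R x + (-1) *\<^sub>R ?P x) # xs) = of_real 1 * f (x # xs) + of_real (- 1) * f (?P x # xs)"
      using ml[of xs] that Ed dproj_dual lists_of_mono[of E "E \<union> E'" n] unfolding dual_linear_map_def by blast
    then show ?thesis by (simp add: a_def b_def)
  qed
  have two: "(cmod (u + v))\<^sup>2 \<le> 2 * (cmod u)\<^sup>2 + 2 * (cmod v)\<^sup>2" for u v
  proof -
    have "(cmod (u + v))\<^sup>2 \<le> (cmod u + cmod v)\<^sup>2" by (intro power_mono norm_triangle_ineq) simp
    also have "\<dots> \<le> 2 * (cmod u)\<^sup>2 + 2 * (cmod v)\<^sup>2"
      using zero_le_power2[of "cmod u - cmod v"] by (simp add: power2_sum power2_diff)
    finally show ?thesis .
  qed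
  have lin: "linear (\<lambda>x. x - ?P x)" using linear_compose_sub[OF linear_id linear_dproj, of s B] by simp
  have "hs E (Suc n) (\<lambda>xs. f xs - f (map ?P xs)) = (\<Sum>x\<in>E. \<Sum>xs\<in>lists_of E n. (cmod (a x xs + b x xs))\<^sup>2)"
    unfolding hs_Suc unfolding hs_def using split by (intro sum.cong) auto
  also have "\<dots> \<le> (\<Sum>x\<in>E. \<Sum>xs\<in>lists_of E n. 2 * (cmod (a x xs))\<^sup>2 + 2 * (cmod (b x xs))\<^sup>2)"
    by (intro sum_mono two)
  also have "\<dots> = 2 * (\<Sum>x\<in>E. \<Sum>xs\<in>lists_of E n. (cmod (a x xs))\<^sup>2) + 2 * (\<Sum>x\<in>E. hs E n (b x))"
    by (simp add: hs_def sum.distrib sum_distrib_left)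
  also have "(\<Sum>x\<in>E. \<Sum>xs\<in>lists_of E n. (cmod (a x xs))\<^sup>2) \<le> \<epsilon>\<^sup>2 * (c ^ (2 * n) * hs E' (Suc n) f)"
  proof -
    have "(\<Sum>x\<in>E. \<Sum>xs\<in>lists_of E n. (cmod (a x xs))\<^sup>2) = (\<Sum>xs\<in>lists_of E n. \<Sum>x\<in>E. (cmod (a x xs))\<^sup>2)"
      by (rule sum.swap)
    also have "\<dots> \<le> (\<Sum>xs\<in>lists_of E n. \<epsilon>\<^sup>2 * (\<Sum>x\<in>E'. (cmod (f (x # xs)))\<^sup>2))"
      unfolding a_def
    proof (rule sum_mono)
      fix xs assume "xs \<in> lists_of E n"
      then have "xs \<in> lists_of (E \<union> E') n" by (auto simp: lists_of_def)
      then show "(\<Sum>x\<in>E. (cmod (f ((x - ?P x) # xs)))\<^sup>2) \<le> \<epsilon>\<^sup>2 * (\<Sum>x\<in>E'. (cmod (f (x # xs)))\<^sup>2)"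
        using span \<epsilon> by (intro hs_slot[OF E E' lin _ _ ml]) (auto intro: span_diff)
    qed
    also have "\<dots> = \<epsilon>\<^sup>2 * (\<Sum>x\<in>E'. hs E n (\<lambda>xs. f (x # xs)))"
      unfolding hs_def sum_distrib_left[symmetric] by (subst sum.swap) simp
    also have "\<dots> \<le> \<epsilon>\<^sup>2 * (\<Sum>x\<in>E'. c ^ (2 * n) * hs E' n (\<lambda>xs. f (x # xs)))"
      using Ed' by (intro mult_left_mono sum_mono hs_span_le[OF E E' span(1) c] multilinear_head[OF Suc.prems]) auto
    finally show ?thesis by (simp add: hs_Suc sum_distrib_left)
  qed
  also have "(\<Sum>x\<in>E. hs E n (b x)) \<le> approx_const c n * \<epsilon>\<^sup>2 * (c\<^sup>2 * hs E' (Suc n) f)"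
  proof -
    have "(\<Sum>x\<in>E. hs E n (b x)) \<le> (\<Sum>x\<in>E. approx_const c n * \<epsilon>\<^sup>2 * hs E' n (\<lambda>xs. f (?P x # xs)))"
      unfolding b_def using Ed dproj_dual by (intro sum_mono Suc.IH multilinear_head[OF Suc.prems]) auto
    also have "\<dots> = approx_const c n * \<epsilon>\<^sup>2 * (\<Sum>xs\<in>lists_of E' n. \<Sum>x\<in>E. (cmod (f (?P x # xs)))\<^sup>2)"
      unfolding hs_def sum_distrib_left[symmetric] by (subst sum.swap) simp
    also have "\<dots> \<le> approx_const c n * \<epsilon>\<^sup>2 * (\<Sum>xs\<in>lists_of E' n. c\<^sup>2 * (\<Sum>x\<in>E'. (cmod (f (x # xs)))\<^sup>2))"
    proof (intro mult_left_mono sum_mono)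
      fix xs assume "xs \<in> lists_of E' n"
      then have "xs \<in> lists_of (E \<union> E') n" by (auto simp: lists_of_def)
      then show "(\<Sum>x\<in>E. (cmod (f (?P x # xs)))\<^sup>2) \<le> c\<^sup>2 * (\<Sum>x\<in>E'. (cmod (f (x # xs)))\<^sup>2)"
        using span c' c(2) by (intro hs_slot[OF E E' linear_dproj _ _ ml]) auto
    qed (use K0 in auto)
    also have "(\<Sum>xs\<in>lists_of E' n. c\<^sup>2 * (\<Sum>x\<in>E'. (cmod (f (x # xs)))\<^sup>2)) = c\<^sup>2 * hs E' (Suc n) f"
      unfolding hs_Suc unfolding hs_def sum_distrib_left[symmetric] by (subst sum.swap) simp
    finally show ?thesis .
  qed
  finally show ?case by (simp add: algebra_simps)
qed

lemma multilinear_expand: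
  assumes "finite E" "\<And>e. e \<in> E \<Longrightarrow> h e \<in> dual ip" "set xs \<subseteq> D"
    and "\<And>x. x \<in> D \<Longrightarrow> P x = (\<Sum>e\<in>E. x e *\<^sub>R h e)"
  shows "multilinear (length xs) f \<Longrightarrow>
    f (map P xs) = (\<Sum>es\<in>lists_of E (length xs). of_real (list_pair xs es) * f (map h es))"
  using assms(3)
proof (induction xs arbitrary: f)
  case Nil
  then show ?case by simp
next
  case (Cons x xs)
  have d: "P z \<in> dual ip" if "z \<in> D" for z
    using assms(2) that by (auto simp: assms(4))
  have "set (map P xs) \<subseteq> dual ip" using d Cons.prems by auto
  then have "dual_linear_map (\<lambda>x. f (x # map P xs))"
    using Cons.prems by (intro multilinear_Cons) auto
  then have "f (map P (x # xs)) = (\<Sum>e\<in>E. of_real (x e) * f (h e # map P xs))"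
    using dual_linear_map_sum[of "\<lambda>x. f (x # map P xs)" E h x] assms Cons.prems by simp
  also have "\<dots> = (\<Sum>e\<in>E. of_real (x e) *
      (\<Sum>es\<in>lists_of E (length xs). of_real (list_pair xs es) * f (h e # map h es)))"
  proof (intro sum.cong arg_cong2[where f="(*)"] refl)
    fix e assume "e \<in> E"
    then have "multilinear (length xs) (\<lambda>ys. f (h e # ys))"
      using Cons.prems assms(2) by (intro multilinear_head) auto
    then show "f (h e # map P xs) =
       (\<Sum>es\<in>lists_of E (length xs). of_real (list_pair xs es) * f (h e # map h es))"
      using Cons.prems by (intro Cons.IH) auto
  qed
  finally show ?case by (simp add: sum_lists_of_Suc sum_distrib_left mult.assoc)
qed

text \<open>The cut-off is explicit because \<open>dproj s B\<close> carries every linear functional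
  into the dual, even one that lies outside it.\<close>

definition fin_rank :: "nat \<Rightarrow> 'n set \<Rightarrow> nat \<Rightarrow> 'n form \<Rightarrow> 'n form" where
  "fin_rank s B n f xs = (if length xs = n \<and> set xs \<subseteq> dual ip then f (map (dproj s B) xs) else 0)"

text \<open>The projected form sees an argument x only through the values of x on the span of B''.
  Expansion in these values gives unsymmetrized products; averaging over the permutations, harmless
  for a symmetric form, turns them into \<open>sym_prod\<close>. The system B'' is orthonormal for
  an inner product other than the one that defines the projection, so that the coefficients can be
  measured in a prescribed norm.\<close>

lemma fin_rank_expansion:
  assumes f: "f \<in> sym_tensors ip n" and B'': "N.orthonormal p B''" "B \<subseteq> span B''"
  shows "fin_rank s B n f =
     (\<lambda>xs. \<Sum>es\<in>lists_of B'' n. (fin_rank s B n f (map (ip p) es) / fact n) * sym_prod es xs)"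
proof
  fix xs
  let ?g = "fin_rank s B n f"
  have fin: "finite B''" using N.orthonormalD(1)[OF B''(1)] .
  have lin: "dproj s B x = (\<Sum>e\<in>B''. x e *\<^sub>R dproj s B (ip p e))" if "x \<in> dual ip" for x
  proof
    fix \<xi>
    have "proj s B \<xi> \<in> span B''"
      unfolding proj_def using B''(2) by (intro span_sum span_scale) auto
    then have "proj s B \<xi> = (\<Sum>e\<in>B''. ip p (proj s B \<xi>) e *\<^sub>R e)"
      by (rule N.expansion[OF B''(1)])
    then have "x (proj s B \<xi>) = x (\<Sum>e\<in>B''. ip p (proj s B \<xi>) e *\<^sub>R e)" by simp
    also have "\<dots> = (\<Sum>e\<in>B''. ip p (proj s B \<xi>) e * x e)"
      using dual_linear[OF that] by (simp add: linear_sum linear_cmul)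
    finally show "dproj s B x \<xi> = (\<Sum>e\<in>B''. x e *\<^sub>R dproj s B (ip p e)) \<xi>"
      by (simp add: dproj_def sum_fun_apply N.commute mult.commute)
  qed
  have c: "?g (map (ip p) es) = f (map (\<lambda>e. dproj s B (ip p e)) es)" if "es \<in> lists_of B'' n" for es
    using that ip_dual by (auto simp: fin_rank_def lists_of_def comp_def)
  have g: "?g xs = (\<Sum>es\<in>lists_of B'' n. of_real (list_pair xs es) * ?g (map (ip p) es))"
    if xs: "length xs = n" "set xs \<subseteq> dual ip" for xs
  proof -
    have "?g xs = f (map (dproj s B) xs)" using xs by (simp add: fin_rank_def)
    also have "\<dots> = (\<Sum>es\<in>lists_of B'' (length xs). of_real (list_pair xs es) * f (map (\<lambda>e. dproj s B (ip p e)) es))"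
      using xs sym_tensorsD(3)[OF f] lin by (intro multilinear_expand[OF fin _ xs(2)] dproj_dual ip_dual) auto
    finally show ?thesis using xs c by simp
  qed
  show "?g xs = (\<Sum>es\<in>lists_of B'' n. (?g (map (ip p) es) / fact n) * sym_prod es xs)"
  proof (cases "length xs = n \<and> set xs \<subseteq> dual ip")
    case True
    have "(\<Sum>es\<in>lists_of B'' n. ?g (map (ip p) es) * sym_prod es xs) =
       (\<Sum>es\<in>lists_of B'' n. \<Sum>\<sigma> | \<sigma> permutes {..<n}. ?g (map (ip p) es) * of_real (list_pair (permute_list \<sigma> xs) es))"
      using True by (intro sum.cong refl) (simp add: sym_prod_def symmetrize_def lists_of_def sum_distrib_left)
    also have "\<dots> = (\<Sum>\<sigma> | \<sigma> permutes {..<n}. ?g (permute_list \<sigma> xs))"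
      using True by (subst sum.swap, intro sum.cong refl) (simp add: g mult.commute)
    also have "\<dots> = (\<Sum>\<sigma> | \<sigma> permutes {..<n}. ?g xs)"
    proof (intro sum.cong refl)
      fix \<sigma> assume "\<sigma> \<in> {\<sigma>. \<sigma> permutes {..<n}}"
      then have \<sigma>: "\<sigma> permutes {..<length xs}" using True by simp
      have "f (map (dproj s B) (permute_list \<sigma> xs)) = f (map (dproj s B) xs)"
        using \<sigma> by (intro sym_tensorsD(2)[OF f]) simp
      then show "?g (permute_list \<sigma> xs) = ?g xs" using \<sigma> by (simp add: fin_rank_def)
    qed
    also have "\<dots> = fact n * ?g xs" by (simp add: card_permutations)
    finally show ?thesis by (simp add: sum_divide_distrib[symmetric])
  next
    case False
    then show ?thesis by (auto simp: fin_rank_def sym_prod_def lists_of_def intro!: sum.neutral)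
  qed
qed

lemma orthonormal_ip_image:
  assumes "N.orthonormal p B"
  shows "D.orthonormal p (ip p ` B)" "inj_on (ip p) B"
proof -
  have d: "dual_ip ip p (ip p e) (ip p e') = ip p e e'" for e e' by (rule dual_ip_ip[OF ip_hdual])
  show inj: "inj_on (ip p) B"
  proof (rule inj_onI)
    fix e e' assume "e \<in> B" "e' \<in> B" "ip p e = ip p e'"
    then show "e = e'" using N.orthonormalD(3)[OF assms] by (metis zero_neq_one)
  qed
  show "D.orthonormal p (ip p ` B)"
    using assms inj ip_hdual unfolding D.orthonormal_def N.orthonormal_def by (auto simp: d inj_on_eq_iff)
qed

lemma sum_lists_of_image:
  assumes "inj_on h E"
  shows "(\<Sum>xs\<in>lists_of (h ` E) n. k xs) = (\<Sum>es\<in>lists_of E n. k (map h es))"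
proof (induction n arbitrary: k)
  case (Suc n)
  then show ?case by (simp add: sum_lists_of_Suc sum.reindex[OF assms] comp_def)
qed simp

text \<open>Cauchy-Schwarz over the expansion: the coefficients contribute the norm of the form, the
  products of norms contribute the n-th power of a Hilbert-Schmidt sum. Neither factor depends on B,
  so the bound is uniform in the rank.\<close>

lemma fin_rank_bound:
  assumes T: "T \<in> tensor_dual ip n" and f: "f \<in> sym_tensors ip n" and B: "finite B"
    and H: "\<And>E. N.orthonormal q E \<Longrightarrow> (\<Sum>e\<in>E. (hn p e)\<^sup>2) \<le> H\<^sup>2" "0 \<le> H"
    and K: "\<And>L. length L = n \<Longrightarrow> cmod (T (sym_prod L)) \<le> fact n * K * (\<Prod>\<xi>\<leftarrow>L. hn p \<xi>)" "0 \<le> K"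
  shows "fin_rank s B n f \<in> sym_tensors ip n"
    "cmod (T (fin_rank s B n f)) \<le> K * H ^ n * tn q n (fin_rank s B n f)"
proof -
  let ?g = "fin_rank s B n f"
  have "N.orthonormal q {}" by (simp add: N.orthonormal_def)
  then obtain B'' where B'': "N.orthonormal q B''" "B \<subseteq> span B''"
    using N.orthonormal_extend[of q "{}" B] B by auto
  note fin = N.orthonormalD(1)[OF B''(1)]
  note ex = fin_rank_expansion[OF f B'', of s]
  have sp: "sym_prod es \<in> sym_tensors ip n" if "es \<in> lists_of B'' n" for es
    using sym_prod_tensor[of es] that by (simp add: lists_of_def)
  show g: "?g \<in> sym_tensors ip n"
    using sym_tensors_sum[of "lists_of B'' n" sym_prod n "\<lambda>es. ?g (map (ip q) es) / fact n",
        OF finite_lists_of[OF fin] sp]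
    unfolding ex[symmetric] by blast
  define c where "c es = ?g (map (ip q) es)" for es
  have "T ?g = (\<Sum>es\<in>lists_of B'' n. (c es / fact n) * T (sym_prod es))"
    using tensor_dual_sum[of T n "lists_of B'' n" sym_prod "\<lambda>es. ?g (map (ip q) es) / fact n",
        OF T finite_lists_of[OF fin] sp]
    unfolding ex[symmetric] c_def by blast
  then have "cmod (T ?g) \<le> (\<Sum>es\<in>lists_of B'' n. cmod (c es / fact n) * cmod (T (sym_prod es)))"
    using norm_sum[of "\<lambda>es. (c es / fact n) * T (sym_prod es)" "lists_of B'' n"] by (simp add: norm_mult norm_divide)
  also have "\<dots> \<le> (\<Sum>es\<in>lists_of B'' n. cmod (c es / fact n) * (fact n * K * (\<Prod>\<xi>\<leftarrow>es. hn p \<xi>)))"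
    by (intro sum_mono mult_left_mono K) (auto simp: lists_of_def)
  also have "\<dots> = K * (\<Sum>es\<in>lists_of B'' n. cmod (c es) * (\<Prod>\<xi>\<leftarrow>es. hn p \<xi>))"
    by (simp add: sum_distrib_left norm_divide algebra_simps)
  also have "\<dots> \<le> K * (tn q n ?g * H ^ n)"
  proof (rule mult_left_mono[OF _ K(2)])
    have pr: "(\<Prod>\<xi>\<leftarrow>es. hn p \<xi>)\<^sup>2 = (\<Prod>\<xi>\<leftarrow>es. (hn p \<xi>)\<^sup>2)" for es
      by (induction es) (auto simp: power_mult_distrib)
    have "(\<Sum>es\<in>lists_of B'' n. cmod (c es) * (\<Prod>\<xi>\<leftarrow>es. hn p \<xi>))\<^sup>2
        \<le> (\<Sum>es\<in>lists_of B'' n. (cmod (c es))\<^sup>2) * (\<Sum>es\<in>lists_of B'' n. (\<Prod>\<xi>\<leftarrow>es. hn p \<xi>)\<^sup>2)"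
      by (rule Cauchy_Schwarz_ineq_sum)
    also have "(\<Sum>es\<in>lists_of B'' n. (cmod (c es))\<^sup>2) = hs (ip q ` B'') n ?g"
      unfolding hs_def c_def sum_lists_of_image[OF orthonormal_ip_image(2)[OF B''(1)]] ..
    also have "(\<Sum>es\<in>lists_of B'' n. (\<Prod>\<xi>\<leftarrow>es. hn p \<xi>)\<^sup>2) = (\<Sum>e\<in>B''. (hn p e)\<^sup>2) ^ n"
      by (simp add: pr sum_lists_of_prod)
    also have "hs (ip q ` B'') n ?g * (\<Sum>e\<in>B''. (hn p e)\<^sup>2) ^ n \<le> (tn q n ?g)\<^sup>2 * (H\<^sup>2) ^ n"
      by (intro mult_mono power_mono hs_le_tn sym_tensorsD(4)[OF g] orthonormal_ip_image(1) B''(1) H(1))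
        (auto intro!: zero_le_power sum_nonneg)
    also have "\<dots> = (tn q n ?g * H ^ n)\<^sup>2" by (simp add: power_mult_distrib power_mult[symmetric] mult.commute)
    finally show "(\<Sum>es\<in>lists_of B'' n. cmod (c es) * (\<Prod>\<xi>\<leftarrow>es. hn p \<xi>)) \<le> tn q n ?g * H ^ n"
      by (rule power2_le_imp_le) (simp add: g H(2))
  qed
  finally show "cmod (T ?g) \<le> K * H ^ n * tn q n ?g"
    by (simp only: mult_ac)
qed

text \<open>Approximate f by forms of finite rank, for which the bound is uniform. The constant C0
  of continuity has no relation to K and H, but it only meets the approximation error and disappears
  with \<epsilon>.\<close>

theorem tensor_dual_hs_bound:
  assumes T: "T \<in> tensor_dual ip n" and f: "f \<in> sym_tensors ip n"
    and H: "\<And>E. N.orthonormal q E \<Longrightarrow> (\<Sum>e\<in>E. (hn p e)\<^sup>2) \<le> H\<^sup>2" "0 \<le> H"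
    and K: "\<And>L. length L = n \<Longrightarrow> cmod (T (sym_prod L)) \<le> fact n * K * (\<Prod>\<xi>\<leftarrow>L. hn p \<xi>)" "0 \<le> K"
  shows "cmod (T f) \<le> K * H ^ n * tn q n f"
proof -
  obtain r0 C0 where C0: "0 \<le> C0" "\<And>f. f \<in> sym_tensors ip n \<Longrightarrow> cmod (T f) \<le> C0 * tn r0 n f"
    using tensor_dual_bound[OF T] by blast
  \<comment> \<open>The error must be small in two norms, the one in which T is continuous and the
    one of the claim; a norm dominating both controls them together.\<close>
  obtain r where "dominates r r0" "dominates r q" using directed by blast
  then obtain c0 c1 where c0: "1 \<le> c0" "\<And>\<xi>. hn r0 \<xi> \<le> c0 * hn r \<xi>" and c1: "1 \<le> c1" "\<And>\<xi>. hn q \<xi> \<le> c1 * hn r \<xi>"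
    unfolding dominates_def by blast
  \<comment> \<open>The Hilbert-Schmidt embedding of H_s into H_r is approximated by
    finite-dimensional projections in operator norm.\<close>
  obtain s where s: "hs_embedding ip s r" using hs_directed by blast
  obtain c where c: "1 \<le> c" "\<And>\<xi>. hn r \<xi> \<le> c * hn s \<xi>" using hs_embedding_bound[OF s] by blast
  have c00: "0 \<le> c" using c(1) by simp
  define A where "A = (K * H ^ n * c1 ^ n + C0 * c0 ^ n) * (sqrt (approx_const c n) * tn s n f)"
  have K0: "0 \<le> approx_const c n" using c00 by (induction n) auto
  have A0: "0 \<le> A" using f K0 K(2) H(2) C0(1) c0(1) c1(1) by (simp add: A_def)
  have main: "cmod (T f) \<le> K * H ^ n * tn q n f + A * \<epsilon>" if \<epsilon>: "0 < \<epsilon>" for \<epsilon>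
  proof -
    obtain B where B: "N.orthonormal s B" "\<And>\<xi>. hn r (\<xi> - proj s B \<xi>) \<le> \<epsilon> * hn s \<xi>"
      using hs_embedding_projection[OF s \<epsilon>] by blast
    let ?g = "fin_rank s B n f"
    note g = fin_rank_bound[where s = s, OF T f N.orthonormalD(1)[OF B(1)] H K]
    define d where "d xs = 1 * f xs + (-1) * ?g xs" for xs
    have d: "d \<in> sym_tensors ip n" unfolding d_def by (rule sym_tensors_comb(1)[OF f g(1)])
    have dr: "tn r n d \<le> sqrt (approx_const c n) * \<epsilon> * tn s n f"
    proof (rule tn_least)
      fix E assume E: "D.orthonormal r E"
      have Es: "E \<subseteq> hdual ip s" using E hdual_bound(1)[OF c(2) c00] by (auto simp: D.orthonormal_def)
      have "E \<union> dproj s B ` E \<subseteq> hdual ip s"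
        using Es dproj_hdual hdual_linear by auto
      then obtain E' where E': "D.orthonormal s E'" "E \<union> dproj s B ` E \<subseteq> span E'"
        using D.orthonormal_extend[of s "{}" "E \<union> dproj s B ` E"] D.orthonormalD(1)[OF E] by auto
      have le: "dn s (dproj s B x) \<le> c * dn r x" "dn s (x - dproj s B x) \<le> \<epsilon> * dn r x" if x: "x \<in> hdual ip r" for x
      proof -
        have 1: "\<bar>dproj s B x \<xi>\<bar> \<le> (c * dn r x) * hn s \<xi>" for \<xi>
        proof -
          have "\<bar>dproj s B x \<xi>\<bar> \<le> dn r x * hn r (proj s B \<xi>)" unfolding dproj_def comp_def by (rule dn_bound[OF x])
          also have "\<dots> \<le> dn r x * (c * hn s (proj s B \<xi>))" using dn_nonneg[OF x] c by (intro mult_left_mono) auto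
          also have "\<dots> \<le> dn r x * (c * hn s \<xi>)"
            using dn_nonneg[OF x] c00 hn_proj_le(1)[OF B(1)] by (intro mult_left_mono) auto
          finally show ?thesis by (simp add: algebra_simps)
        qed
        show "dn s (dproj s B x) \<le> c * dn r x" using 1 c00 dn_nonneg[OF x] by (intro dn_least) auto
        have 2: "\<bar>(x - dproj s B x) \<xi>\<bar> \<le> (\<epsilon> * dn r x) * hn s \<xi>" for \<xi>
        proof -
          have "(x - dproj s B x) \<xi> = x (\<xi> - proj s B \<xi>)"
            using linear_diff[OF hdual_linear[OF x]] by (simp add: dproj_def)
          also have "\<bar>\<dots>\<bar> \<le> dn r x * hn r (\<xi> - proj s B \<xi>)" by (rule dn_bound[OF x])
          also have "\<dots> \<le> dn r x * (\<epsilon> * hn s \<xi>)" using dn_nonneg[OF x] B(2) by (intro mult_left_mono)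
          finally show ?thesis by (simp add: algebra_simps)
        qed
        show "dn s (x - dproj s B x) \<le> \<epsilon> * dn r x" using 2 \<epsilon> dn_nonneg[OF x] by (intro dn_least) auto
      qed
      have "hs E n d = hs E n (\<lambda>xs. f xs - f (map (dproj s B) xs))"
        unfolding hs_def d_def using lists_of_dual[OF orthonormal_dual[OF E]]
        by (intro sum.cong refl) (simp add: fin_rank_def)
      also have "\<dots> \<le> approx_const c n * \<epsilon>\<^sup>2 * hs E' n f"
        using E' le hdual_bound(2)[OF c(2) c00] c00 \<epsilon> by (intro hs_approx[OF E E'(1)] sym_tensorsD(3)[OF f]) auto
      also have "\<dots> \<le> approx_const c n * \<epsilon>\<^sup>2 * (tn s n f)\<^sup>2"
        using K0 by (intro mult_left_mono hs_le_tn sym_tensorsD(4)[OF f] E') auto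
      also have "\<dots> = (sqrt (approx_const c n) * \<epsilon> * tn s n f)\<^sup>2" using K0 by (simp add: power_mult_distrib)
      finally show "hs E n d \<le> (sqrt (approx_const c n) * \<epsilon> * tn s n f)\<^sup>2" .
    qed (use K0 \<epsilon> f in auto)
    have dr0: "tn r0 n d \<le> c0 ^ n * tn r n d" using c0 by (intro tn_dominated[OF d]) auto
    have dq: "tn q n d \<le> c1 ^ n * tn r n d" using c1 by (intro tn_dominated[OF d]) auto
    have "T d = 1 * T f + (-1) * T ?g" unfolding d_def by (rule tensor_dual_comb[OF T f g(1)])
    then have "cmod (T f) \<le> cmod (T ?g) + cmod (T d)"
      using norm_triangle_ineq[of "T ?g" "T d"] by simp
    also have "\<dots> \<le> K * H ^ n * tn q n ?g + C0 * tn r0 n d"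
      by (intro add_mono g(2) C0(2)[OF d])
    also have "\<dots> \<le> K * H ^ n * (tn q n f + c1 ^ n * tn r n d) + C0 * (c0 ^ n * tn r n d)"
    proof (intro add_mono mult_left_mono dr0 C0(1))
      have "?g = (\<lambda>xs. 1 * f xs + (-1) * d xs)" by (auto simp: d_def)
      then have "tn q n ?g \<le> cmod 1 * tn q n f + cmod (-1) * tn q n d"
        using sym_tensors_comb(2)[OF f d, where a = 1 and b = "-1" and p = q] by simp
      then show "tn q n ?g \<le> tn q n f + c1 ^ n * tn r n d" using dq by simp
    qed (use K(2) H(2) in auto)
    also have "\<dots> = K * H ^ n * tn q n f + (K * H ^ n * c1 ^ n + C0 * c0 ^ n) * tn r n d"
      by (simp add: algebra_simps)
    also have "\<dots> \<le> K * H ^ n * tn q n f + (K * H ^ n * c1 ^ n + C0 * c0 ^ n) * (sqrt (approx_const c n) * \<epsilon> * tn s n f)"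
      using dr K(2) H(2) C0(1) c0(1) c1(1) by (intro add_left_mono mult_left_mono) auto
    also have "\<dots> = K * H ^ n * tn q n f + A * \<epsilon>" by (simp add: A_def algebra_simps)
    finally show ?thesis .
  qed
  show ?thesis
  proof (rule field_le_epsilon)
    fix e :: real assume e: "0 < e"
    \<comment> \<open>Dividing by A + 1 instead of A covers the case A = 0.\<close>
    have "A * (e / (A + 1)) \<le> e" using A0 e by (simp add: field_simps)
    then show "cmod (T f) \<le> K * H ^ n * tn q n f + e"
      using main[of "e / (A + 1)"] A0 e by auto
  qed
qed

end

section \<open>The Mittag-Leffler function\<close>

text \<open>Compactness on the interval from 1 to 2; beyond it the functional equation multiplies by
  x - 1 > 1. The bound keeps the Mittag-Leffler coefficients bounded, which suffices for a positive
  radius of convergence.\<close>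

lemma Gamma_lower_bound: "\<exists>\<delta>>0. \<forall>x\<ge>1. \<delta> \<le> Gamma (x::real)"
proof -
  have cont: "continuous_on {1..2} (Gamma :: real \<Rightarrow> real)"
    by (intro continuous_on_Gamma) (auto elim!: nonpos_Ints_cases)
  obtain z :: real where z: "z \<in> {1..2}" "\<forall>y\<in>{1..2}. Gamma z \<le> Gamma y"
    using continuous_attains_inf[OF _ _ cont] by auto
  have "Gamma z \<le> Gamma x" if "1 \<le> x" "x \<le> real n + 2" for x n
    using that
  proof (induction n arbitrary: x)
    case 0
    then show ?case using z by auto
  next
    case (Suc n)
    show ?case
    proof (cases "x \<le> 2")
      case True
      then show ?thesis using z Suc by auto
    next
      case False
      then have x: "x - 1 > 1" by simp
      then have "x - 1 \<notin> \<int>\<^sub>\<le>\<^sub>0" by (auto elim!: nonpos_Ints_cases)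
      then have "Gamma x = (x - 1) * Gamma (x - 1)" using Gamma_plus1[of "x - 1"] by simp
      moreover have "1 * Gamma (x - 1) \<le> (x - 1) * Gamma (x - 1)"
        using x by (intro mult_right_mono) auto
      moreover have "Gamma z \<le> Gamma (x - 1)" using Suc.prems x by (intro Suc.IH) auto
      ultimately show ?thesis by simp
    qed
  qed
  moreover have "\<exists>n. x \<le> real n + 2" for x :: real
  proof -
    obtain n where "x \<le> real n" using real_arch_simple by blast
    then have "x \<le> real n + 2" by linarith
    then show ?thesis ..
  qed
  moreover have "Gamma z > 0" using z by simp
  ultimately show ?thesis by blast
qed

definition ml_fps :: "real \<Rightarrow> complex fps" where
  "ml_fps \<beta> = Abs_fps (\<lambda>n. 1 / of_real (Gamma (\<beta> * real n + 1)))"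

lemma ml_fps_nth_0 [simp]: "fps_nth (ml_fps \<beta>) 0 = 1"
  by (simp add: ml_fps_def)

lemma mittag_leffler_has_fps_expansion:
  assumes "0 < \<beta>"
  shows "mittag_leffler \<beta> has_fps_expansion ml_fps \<beta>"
  unfolding has_fps_expansion_def
proof
  obtain \<delta> where \<delta>: "\<delta> > 0" "\<And>x. x \<ge> 1 \<Longrightarrow> \<delta> \<le> Gamma (x::real)" using Gamma_lower_bound by blast
  have "summable (\<lambda>n. fps_nth (ml_fps \<beta>) n * (1/2) ^ n)"
  proof (rule summable_comparison_test')
    show "summable (\<lambda>n. (1 / \<delta>) * (1/2::real) ^ n)" by (intro summable_mult summable_geometric) auto
    fix n :: nat
    have g: "\<delta> \<le> Gamma (\<beta> * real n + 1)" using assms by (intro \<delta>) auto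
    then have "norm (fps_nth (ml_fps \<beta>) n) \<le> 1 / \<delta>"
      using \<delta>(1) by (simp add: ml_fps_def norm_divide frac_le)
    then show "norm (fps_nth (ml_fps \<beta>) n * (1/2) ^ n) \<le> (1 / \<delta>) * (1/2) ^ n"
      using mult_right_mono[of _ "1 / \<delta>" "(1/2) ^ n"] by (simp add: norm_mult norm_power norm_divide)
  qed
  then have "ereal (norm (1/2 :: complex)) \<le> fps_conv_radius (ml_fps \<beta>)"
    unfolding fps_conv_radius_def by (rule conv_radius_geI)
  moreover have "0 < ereal (norm (1/2 :: complex))" by simp
  ultimately show "0 < fps_conv_radius (ml_fps \<beta>)" by (rule less_le_trans[rotated])
  show "\<forall>\<^sub>F z in nhds 0. eval_fps (ml_fps \<beta>) z = mittag_leffler \<beta> z"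
    by (simp add: eval_fps_def ml_fps_def mittag_leffler_def)
qed

section \<open>The reciprocal of the Mittag-Leffler function\<close>

definition ml_inv :: "real \<Rightarrow> complex fps" where
  "ml_inv \<beta> = inverse (ml_fps \<beta>)"

lemma ml_inv_has_fps_expansion:
  "0 < \<beta> \<Longrightarrow> (\<lambda>z. inverse (mittag_leffler \<beta> z)) has_fps_expansion ml_inv \<beta>"
  unfolding ml_inv_def by (intro has_fps_expansion_inverse mittag_leffler_has_fps_expansion) auto

lemma ml_inv_bound:
  assumes "0 < \<beta>"
  shows "\<exists>\<kappa>\<ge>1. \<forall>m. cmod (fps_nth (ml_inv \<beta>) m) \<le> \<kappa> ^ m"
proof -
  have "0 < fps_conv_radius (ml_inv \<beta>)"
    using ml_inv_has_fps_expansion[OF assms] by (simp add: has_fps_expansion_def)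
  then obtain r where r: "0 < r" "ereal r < fps_conv_radius (ml_inv \<beta>)"
    using ereal_dense2[of 0 "fps_conv_radius (ml_inv \<beta>)"] by (auto simp: zero_ereal_def)
  then have "summable (\<lambda>n. fps_nth (ml_inv \<beta>) n * of_real r ^ n)"
    by (intro summable_fps) auto
  then obtain A where A: "\<And>n. norm (fps_nth (ml_inv \<beta>) n * of_real r ^ n) \<le> A"
    using summable_imp_bounded[of "\<lambda>n. fps_nth (ml_inv \<beta>) n * of_real r ^ n"] unfolding bounded_iff by blast
  \<comment> \<open>For m > 0 the factor A is absorbed into the m-th power; for m = 0 the
    coefficient is exactly 1, so a pure power bounds all of them.\<close>
  define \<kappa> where "\<kappa> = max 1 A * max 1 (1 / r)"
  have \<kappa>: "1 \<le> \<kappa>" using mult_mono[of 1 "max 1 A" 1 "max 1 (1 / r)"] by (simp add: \<kappa>_def)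
  have "cmod (fps_nth (ml_inv \<beta>) m) \<le> \<kappa> ^ m" for m
  proof (cases "m = 0")
    case True
    then show ?thesis by (simp add: ml_inv_def)
  next
    case False
    have "cmod (fps_nth (ml_inv \<beta>) m) * r ^ m \<le> A"
      using A[of m] r(1) by (simp add: norm_mult norm_power)
    then have "cmod (fps_nth (ml_inv \<beta>) m) \<le> A * (1 / r) ^ m"
      using r(1) by (simp add: pos_le_divide_eq power_one_over)
    also have "\<dots> \<le> max 1 A * max 1 (1 / r) ^ m"
      using r(1) by (intro mult_mono power_mono) auto
    also have "\<dots> \<le> max 1 A ^ m * max 1 (1 / r) ^ m"
      using False self_le_power[of "max 1 A" m] by (intro mult_right_mono) auto
    finally show ?thesis by (simp add: \<kappa>_def power_mult_distrib)
  qed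
  then show ?thesis using \<kappa> by blast
qed

definition ml_inv_sq :: "real \<Rightarrow> complex \<Rightarrow> complex fps" where
  "ml_inv_sq \<beta> s = Abs_fps (\<lambda>n. if even n then fps_nth (ml_inv \<beta>) (n div 2) * s ^ (n div 2) else 0)"

lemma ml_inv_sq_has_fps_expansion:
  assumes "0 < \<beta>"
  shows "(\<lambda>t. inverse (mittag_leffler \<beta> (s * t\<^sup>2))) has_fps_expansion ml_inv_sq \<beta> s"
proof (rule has_fps_expansionI)
  note ex = ml_inv_has_fps_expansion[OF assms, unfolded has_fps_expansion_def]
  let ?h = "\<lambda>t::complex. s * t\<^sup>2"
  have "(?h \<longlongrightarrow> s * 0\<^sup>2) (nhds 0)" by (intro tendsto_intros filterlim_ident)
  then have lim: "(?h \<longlongrightarrow> 0) (nhds 0)" by simp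
  have "0 \<in> eball (0::complex) (fps_conv_radius (ml_inv \<beta>))"
    using ex by (simp add: in_eball_iff zero_ereal_def[symmetric])
  then have "\<forall>\<^sub>F z in nhds (0::complex). z \<in> eball 0 (fps_conv_radius (ml_inv \<beta>))"
    by (rule eventually_nhds_in_open[OF open_eball])
  then have "\<forall>\<^sub>F z in nhds 0. (\<lambda>m. fps_nth (ml_inv \<beta>) m * z ^ m) sums inverse (mittag_leffler \<beta> z)"
    using ex[THEN conjunct2]
  proof eventually_elim
    case (elim z)
    then show ?case using sums_eval_fps[of z "ml_inv \<beta>"] by (simp add: in_eball_iff)
  qed
  then have "\<forall>\<^sub>F t in nhds 0. (\<lambda>m. fps_nth (ml_inv \<beta>) m * (?h t) ^ m) sums inverse (mittag_leffler \<beta> (?h t))"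
    using lim by (rule eventually_compose_filterlim)
  then show "\<forall>\<^sub>F t in nhds 0. (\<lambda>n. fps_nth (ml_inv_sq \<beta> s) n * t ^ n) sums inverse (mittag_leffler \<beta> (s * t\<^sup>2))"
  proof eventually_elim
    case (elim t)
    have "(\<lambda>m. fps_nth (ml_inv_sq \<beta> s) (2 * m) * t ^ (2 * m)) sums inverse (mittag_leffler \<beta> (s * t\<^sup>2))"
      using elim by (simp add: ml_inv_sq_def power_mult_distrib power_mult mult.assoc)
    moreover have "strict_mono (\<lambda>m::nat. 2 * m)" by (simp add: strict_mono_def)
    moreover have "fps_nth (ml_inv_sq \<beta> s) n * t ^ n = 0" if "n \<notin> range (\<lambda>m. 2 * m)" for n
      using that by (auto simp: ml_inv_sq_def elim!: evenE)
    ultimately show ?case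
      using sums_mono_reindex[of "\<lambda>m. 2 * m" "\<lambda>n. fps_nth (ml_inv_sq \<beta> s) n * t ^ n"] by blast
  qed
qed

text \<open>The generating function along the line t \<mapsto> t\<theta>, as a power series in t,
  with w the pairing of \<omega> and \<theta>, and s half the square of \<theta>.\<close>

definition appell_fps :: "real \<Rightarrow> complex \<Rightarrow> complex \<Rightarrow> complex fps" where
  "appell_fps \<beta> w s = fps_exp w * ml_inv_sq \<beta> s"

lemma appell_fps_add: "appell_fps \<beta> (w + v) s = fps_exp v * appell_fps \<beta> w s"
  by (simp add: appell_fps_def fps_exp_add_mult mult_ac)

lemma appell_fps_nth:
  "fps_nth (appell_fps \<beta> w s) n =
    (\<Sum>m\<le>n div 2. fps_nth (ml_inv \<beta>) m * s ^ m * (w ^ (n - 2 * m) / fact (n - 2 * m)))"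
proof -
  have "fps_nth (appell_fps \<beta> w s) n = (\<Sum>i=0..n. fps_nth (ml_inv_sq \<beta> s) i * (w ^ (n - i) / fact (n - i)))"
    unfolding appell_fps_def by (subst mult.commute) (simp add: fps_mult_nth)
  also have "\<dots> = (\<Sum>m\<le>n div 2. fps_nth (ml_inv \<beta>) m * s ^ m * (w ^ (n - 2 * m) / fact (n - 2 * m)))"
  proof -
    let ?g = "\<lambda>i. fps_nth (ml_inv_sq \<beta> s) i * (w ^ (n - i) / fact (n - i))"
    have "?g i = 0" if "i \<in> {0..n} - (*) 2 ` {..n div 2}" for i
    proof -
      have "odd i" using that by (auto elim!: evenE)
      then show ?thesis by (simp add: ml_inv_sq_def)
    qed
    then have "sum ?g {0..n} = sum ?g ((*) 2 ` {..n div 2})"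
      by (intro sum.mono_neutral_right) auto
    also have "\<dots> = (\<Sum>m\<le>n div 2. ?g (2 * m))"
      by (subst sum.reindex) (auto simp: inj_on_def)
    finally show ?thesis by (simp add: ml_inv_sq_def)
  qed
  finally show ?thesis .
qed

section \<open>The Appell kernels\<close>

text \<open>The pairing of the m-th tensor power of the trace, times a power of w, with the product
  of L, without symmetrization: the first 2m vectors are paired with each other, the rest with w.
  Lists shorter than 2m get 0.\<close>

fun trace_pair :: "('n \<Rightarrow> 'n \<Rightarrow> real) \<Rightarrow> ('n \<Rightarrow> real) \<Rightarrow> nat \<Rightarrow> 'n list \<Rightarrow> real" where
  "trace_pair B w 0 L = (\<Prod>\<xi>\<leftarrow>L. w \<xi>)"
| "trace_pair B w (Suc m) (\<xi> # \<eta> # L) = B \<xi> \<eta> * trace_pair B w m L"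
| "trace_pair B w (Suc m) _ = 0"

lemma trace_pair_replicate:
  "2 * m \<le> n \<Longrightarrow> trace_pair B w m (replicate n \<theta>) = B \<theta> \<theta> ^ m * w \<theta> ^ (n - 2 * m)"
proof (induction m arbitrary: n)
  case 0
  then show ?case by (induction n) auto
next
  case (Suc m)
  then have "n = Suc (Suc (n - 2))" by simp
  then obtain k where "n = Suc (Suc k)" by blast
  then show ?case using Suc by simp
qed

lemma trace_pair_abs_le:
  assumes "\<And>\<xi>. \<bar>w \<xi>\<bar> \<le> h \<xi>" "\<And>\<xi> \<eta>. \<bar>B \<xi> \<eta>\<bar> \<le> h \<xi> * h \<eta>"
  shows "\<bar>trace_pair B w m L\<bar> \<le> (\<Prod>\<xi>\<leftarrow>L. h \<xi>)"
proof -
  have h: "0 \<le> h \<xi>" for \<xi> using assms(1)[of \<xi>] by linarith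
  then have hL: "0 \<le> (\<Prod>\<xi>\<leftarrow>L. h \<xi>)" for L by (induction L) auto
  show ?thesis
  proof (induction m arbitrary: L)
    case 0
    show ?case
    proof (induction L)
      case (Cons \<xi> L)
      then show ?case
        using assms(1)[of \<xi>] h hL[of L] by (auto simp: abs_mult intro!: mult_mono)
    qed simp
  next
    case (Suc m)
    consider "L = []" | \<xi> where "L = [\<xi>]" | \<xi> \<eta> M where "L = \<xi> # \<eta> # M"
      by (metis list.exhaust)
    then show ?case
    proof cases
      case 3
      have "\<bar>B \<xi> \<eta>\<bar> * \<bar>trace_pair B w m M\<bar> \<le> (h \<xi> * h \<eta>) * (\<Prod>\<xi>\<leftarrow>M. h \<xi>)"
        using assms(2)[of \<xi> \<eta>] h Suc.IH[of M] by (intro mult_mono) auto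
      then show ?thesis using 3 by (simp add: abs_mult mult.assoc)
    qed (use h in auto)
  qed
qed

lemma trace_pair_multilinear:
  assumes w: "linear w" and B: "bilinear B"
  shows "trace_pair B w m (us @ (a *\<^sub>R \<xi> + b *\<^sub>R \<eta>) # vs)
    = a * trace_pair B w m (us @ \<xi> # vs) + b * trace_pair B w m (us @ \<eta> # vs)"
proof (induction m arbitrary: us)
  case 0
  then show ?case using w by (simp add: linear_add linear_cmul algebra_simps)
next
  case (Suc m)
  note Bl = bilinear_ladd[OF B] bilinear_lmul[OF B] bilinear_radd[OF B] bilinear_rmul[OF B]
  consider "us = []" | u where "us = [u]" | u v us' where "us = u # v # us'"
    by (metis list.exhaust)
  then show ?case
  proof cases
    case 1
    then show ?thesis by (cases vs) (simp_all add: Bl algebra_simps)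
  next
    case 2
    then show ?thesis by (simp add: Bl algebra_simps)
  next
    case 3
    then show ?thesis using Suc by (simp add: algebra_simps)
  qed
qed

context nuclear_triple
begin

lemma hs_embedding_const:
  assumes "hs_embedding ip q p"
  shows "\<exists>H\<ge>0. \<forall>E. N.orthonormal q E \<longrightarrow> (\<Sum>e\<in>E. (hn p e)\<^sup>2) \<le> H\<^sup>2"
proof -
  obtain C where C: "\<And>E. N.orthonormal q E \<Longrightarrow> (\<Sum>e\<in>E. (hn p e)\<^sup>2) \<le> C"
    using assms unfolding hs_embedding_def N.orthonormal_def by (auto 4 3)
  have "(\<Sum>e\<in>E. (hn p e)\<^sup>2) \<le> (sqrt (max 0 C))\<^sup>2" if "N.orthonormal q E" for E
    using C[OF that] by simp
  then show ?thesis by (intro exI[of _ "sqrt (max 0 C)"]) simp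
qed

lemma tensor_dual_sym_prod:
  assumes T: "T \<in> tensor_dual ip n"
  shows "multilinear_on UNIV n (\<lambda>L. T (sym_prod L))" "symmetric_on UNIV n (\<lambda>L. T (sym_prod L))"
proof -
  have t: "sym_prod L \<in> sym_tensors ip n" if "length L = n" for L
    using sym_prod_tensor[of L] that by simp
  show "multilinear_on UNIV n (\<lambda>L. T (sym_prod L))"
    unfolding multilinear_on_def
  proof (intro allI impI)
    fix us vs :: "'n list" and \<xi> \<eta> :: 'n and a b
    assume "length us + Suc (length vs) = n \<and> set us \<subseteq> UNIV \<and> set vs \<subseteq> UNIV \<and> \<xi> \<in> UNIV \<and> \<eta> \<in> UNIV"
    then show "T (sym_prod (us @ (a *\<^sub>R \<xi> + b *\<^sub>R \<eta>) # vs)) =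
        of_real a * T (sym_prod (us @ \<xi> # vs)) + of_real b * T (sym_prod (us @ \<eta> # vs))"
      unfolding sym_prod_comb by (intro tensor_dual_comb[OF T] t) auto
  qed
  show "symmetric_on UNIV n (\<lambda>L. T (sym_prod L))"
    unfolding symmetric_on_def using sym_prod_cong by metis
qed

lemma tensor_dual_sym_prod_diag:
  assumes T: "T \<in> tensor_dual ip n"
  shows "T (sym_prod (replicate n \<theta>)) = fact n * T (tensor_power ip n (\<theta>, 0))"
  unfolding sym_prod_replicate by (rule tensor_dual_scale[OF T tensor_power_tensor])

text \<open>Polarization annihilates T on all products of vectors, and then
  \<open>tensor_dual_hs_bound\<close> applies with K = 0. Density of the span of the tensor powers
  is thus a case of the quantitative bound.\<close>

lemma tensor_dual_eq_zero:
  assumes T: "T \<in> tensor_dual ip n" and "\<And>\<theta>. T (tensor_power ip n (\<theta>, 0)) = 0"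
    and f: "f \<in> sym_tensors ip n"
  shows "T f = 0"
proof -
  obtain q where q: "hs_embedding ip q 0" using hs_directed by blast
  obtain H where H: "0 \<le> H" "\<forall>E. N.orthonormal q E \<longrightarrow> (\<Sum>e\<in>E. (hn 0 e)\<^sup>2) \<le> H\<^sup>2"
    using hs_embedding_const[OF q] by blast
  have "T (sym_prod L) = 0" if "length L = n" for L
    using polarization[OF subspace_UNIV tensor_dual_sym_prod[OF T], of L] that assms(2)
    by (simp add: tensor_dual_sym_prod_diag[OF T])
  then have "cmod (T f) \<le> 0 * H ^ n * tn q n f"
    using H by (intro tensor_dual_hs_bound[OF T f, where p = 0]) auto
  then show ?thesis by simp
qed

text \<open>On the complex line through a real vector the defining series becomes an ordinary power
  series in t, and its coefficients are compared with those of the product of the exponential and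
  the reciprocal.\<close>

lemma appell_coeff:
  assumes P: "appell_system ip \<beta> P" and \<beta>: "0 < \<beta>" and \<omega>: "\<omega> \<in> dual ip"
  shows "P n \<omega> (tensor_power ip n (\<theta>, 0)) =
    fact n * fps_nth (appell_fps \<beta> (of_real (\<omega> \<theta>)) (of_real (ip 0 \<theta> \<theta> / 2))) n"
proof -
  have T: "\<And>n. P n \<omega> \<in> tensor_dual ip n" using P \<omega> by (simp add: appell_system_def)
  obtain p \<epsilon> where p: "\<epsilon> > 0" "\<And>\<theta>. cnorm ip p \<theta> < \<epsilon> \<Longrightarrow>
           (\<lambda>n. 1 / fact n * P n \<omega> (tensor_power ip n \<theta>)) sums
             (exp (cpair \<omega> \<theta>) / mittag_leffler \<beta> (1 / 2 * cbilin ip \<theta> \<theta>))"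
    using P \<omega> unfolding appell_system_def by blast
  \<comment> \<open>The pair that encodes t\<theta> for complex t and real \<theta>.\<close>
  define \<Theta> where "\<Theta> t = (Re t *\<^sub>R \<theta>, Im t *\<^sub>R \<theta>)" for t
  define w s :: complex where "w = of_real (\<omega> \<theta>)" and "s = of_real (ip 0 \<theta> \<theta> / 2)"
  have cp: "cpair x (\<Theta> t) = t * of_real (x \<theta>)" if "x \<in> dual ip" for x t
    using linear_cmul[OF dual_linear[OF that]] by (simp add: cpair_def \<Theta>_def complex_eq_iff)
  have cp0: "cpair x (\<theta>, 0) = of_real (x \<theta>)" if "x \<in> dual ip" for x
    using linear_0[OF dual_linear[OF that]] by (simp add: cpair_def complex_eq_iff)
  have tp: "tensor_power ip n (\<Theta> t) = (\<lambda>xs. t ^ n * tensor_power ip n (\<theta>, 0) xs)" for n t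
  proof
    fix xs
    have "(\<Prod>x\<leftarrow>xs. cpair x (\<Theta> t)) = t ^ length xs * (\<Prod>x\<leftarrow>xs. cpair x (\<theta>, 0))" if "set xs \<subseteq> dual ip"
      using that by (induction xs) (auto simp: cp cp0)
    then show "tensor_power ip n (\<Theta> t) xs = t ^ n * tensor_power ip n (\<theta>, 0) xs"
      by (auto simp: tensor_power_def)
  qed
  have cb: "1 / 2 * cbilin ip (\<Theta> t) (\<Theta> t) = s * t\<^sup>2" for t
    by (simp add: cbilin_def \<Theta>_def s_def N.scale_left N.scale_right complex_eq_iff power2_eq_square algebra_simps)
  have cn: "cnorm ip p (\<Theta> t) = cmod t * hn p \<theta>" for t
  proof -
    have "(\<bar>Re t\<bar> * hn p \<theta>)\<^sup>2 + (\<bar>Im t\<bar> * hn p \<theta>)\<^sup>2 = (cmod t * hn p \<theta>)\<^sup>2"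
      by (simp add: power_mult_distrib cmod_power2 algebra_simps)
    then show ?thesis by (simp add: cnorm_def \<Theta>_def hn_scale)
  qed
  define F where "F = Abs_fps (\<lambda>n. P n \<omega> (tensor_power ip n (\<theta>, 0)) / fact n)"
  have "(\<lambda>t. exp (w * t) * inverse (mittag_leffler \<beta> (s * t\<^sup>2))) has_fps_expansion F"
  proof (rule has_fps_expansionI)
    have "((\<lambda>t. cmod t * hn p \<theta>) \<longlongrightarrow> cmod 0 * hn p \<theta>) (nhds 0)"
      by (intro tendsto_intros filterlim_ident)
    then have "\<forall>\<^sub>F t in nhds 0. cmod t * hn p \<theta> < \<epsilon>"
      using p(1) by (intro order_tendstoD) auto
    then show "\<forall>\<^sub>F t in nhds 0. (\<lambda>n. fps_nth F n * t ^ n) sums (exp (w * t) * inverse (mittag_leffler \<beta> (s * t\<^sup>2)))"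
    proof eventually_elim
      case (elim t)
      then have "(\<lambda>n. 1 / fact n * P n \<omega> (tensor_power ip n (\<Theta> t))) sums
          (exp (cpair \<omega> (\<Theta> t)) / mittag_leffler \<beta> (s * t\<^sup>2))"
        using p(2)[of "\<Theta> t"] unfolding cb by (simp add: cn)
      moreover have "1 / fact n * P n \<omega> (tensor_power ip n (\<Theta> t)) = fps_nth F n * t ^ n" for n
        unfolding tp using tensor_dual_scale[OF T tensor_power_tensor] by (simp add: F_def)
      ultimately show ?case by (simp add: cp[OF \<omega>] w_def field_simps)
    qed
  qed
  moreover have "(\<lambda>t. exp (w * t) * inverse (mittag_leffler \<beta> (s * t\<^sup>2))) has_fps_expansion appell_fps \<beta> w s"
    unfolding appell_fps_def
    by (intro has_fps_expansion_mult has_fps_expansion_exp ml_inv_sq_has_fps_expansion \<beta>)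
  ultimately have "fps_nth F n = fps_nth (appell_fps \<beta> w s) n"
    using fps_nth_fps_expansion by metis
  then show ?thesis by (simp add: F_def w_def s_def field_simps)
qed

text \<open>The point is that q and K are the same for all degrees. Only the symmetrization of an
  explicit trace formula has to be estimated on products, which one norm p does for all n. The
  domination of p1 lets q be taken so large that further functionals lie in
  \<open>hdual ip q\<close>.\<close>

theorem appell_growth:
  assumes P: "appell_system ip \<beta> P" and \<beta>: "0 < \<beta>" and \<omega>: "\<omega> \<in> dual ip"
  shows "\<exists>q K. dominates q p1 \<and> 1 \<le> K \<and>
    (\<forall>n. \<forall>f\<in>sym_tensors ip n. cmod (P n \<omega> f) \<le> fact n * K ^ n * tn q n f)"
proof -
  have T: "\<And>n. P n \<omega> \<in> tensor_dual ip n" using P \<omega> by (simp add: appell_system_def)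
  obtain \<kappa> where \<kappa>: "1 \<le> \<kappa>" "\<And>m. cmod (fps_nth (ml_inv \<beta>) m) \<le> \<kappa> ^ m" using ml_inv_bound[OF \<beta>] by blast
  obtain p0 where p0: "dominates p0 p1" "\<omega> \<in> hdual ip p0" using finite_subset_dual[of "{\<omega>}" p1] \<omega> by auto
  \<comment> \<open>This norm controls both ingredients of the kernels: \<omega>, and the trace,
    which is the inner product of H.\<close>
  obtain p where p: "dominates p p0" "dominates p 0" using directed by blast
  obtain q where q: "hs_embedding ip q p" "dominates q p" using hs_directed by blast
  obtain H where H: "0 \<le> H" "\<And>E. N.orthonormal q E \<Longrightarrow> (\<Sum>e\<in>E. (hn p e)\<^sup>2) \<le> H\<^sup>2"
    using hs_embedding_const[OF q(1)] by blast
  have \<omega>p: "\<omega> \<in> hdual ip p" using dominates_hdual[OF p(1)] p0(2) by blast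
  obtain c where c: "1 \<le> c" "\<And>\<xi>. hn 0 \<xi> \<le> c * hn p \<xi>" using p(2) unfolding dominates_def by blast
  define a where "a = max c (dn p \<omega>)"
  have a: "1 \<le> a" "c \<le> a" "dn p \<omega> \<le> a" using c(1) by (auto simp: a_def)
  have wb: "\<bar>\<omega> \<xi>\<bar> \<le> a * hn p \<xi>" for \<xi>
    using dn_bound[OF \<omega>p, of \<xi>] mult_right_mono[OF a(3) hn_nonneg, of p \<xi>] by linarith
  have h0: "hn 0 \<xi> \<le> a * hn p \<xi>" for \<xi>
    using c(2)[of \<xi>] mult_right_mono[OF a(2) hn_nonneg, of p \<xi>] by linarith
  have bb: "\<bar>ip 0 \<xi> \<eta>\<bar> \<le> (a * hn p \<xi>) * (a * hn p \<eta>)" for \<xi> \<eta>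
    by (rule order_trans[OF ip_le mult_mono[OF h0 h0]]) (use a(1) in simp_all)
  \<comment> \<open>One factor n! comes from \<open>sym_prod\<close> on the diagonal, the other from
    the normalization of the generating function.\<close>
  define \<Psi> :: "nat \<Rightarrow> 'n list \<Rightarrow> complex" where "\<Psi> n L = fact n * fact n * (\<Sum>m\<le>n div 2.
      fps_nth (ml_inv \<beta>) m * (1/2) ^ m / fact (n - 2 * m) * of_real (trace_pair (ip 0) \<omega> m L))" for n L
  have ml: "multilinear_on UNIV n (\<Psi> n)" for n
    unfolding multilinear_on_def \<Psi>_def trace_pair_multilinear[OF hdual_linear[OF \<omega>p] ip_bilinear]
    by (simp add: algebra_simps sum.distrib sum_distrib_left)
  have diag: "P n \<omega> (sym_prod (replicate n \<theta>)) = \<Psi> n (replicate n \<theta>)" for n \<theta>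
  proof -
    have "P n \<omega> (sym_prod (replicate n \<theta>)) = fact n * (fact n * (\<Sum>m\<le>n div 2. fps_nth (ml_inv \<beta>) m *
        of_real (ip 0 \<theta> \<theta> / 2) ^ m * (of_real (\<omega> \<theta>) ^ (n - 2 * m) / fact (n - 2 * m))))"
      by (simp only: tensor_dual_sym_prod_diag[OF T] appell_coeff[OF P \<beta> \<omega>] appell_fps_nth)
    also have "(\<Sum>m\<le>n div 2. fps_nth (ml_inv \<beta>) m *
        of_real (ip 0 \<theta> \<theta> / 2) ^ m * (of_real (\<omega> \<theta>) ^ (n - 2 * m) / fact (n - 2 * m))) =
      (\<Sum>m\<le>n div 2. fps_nth (ml_inv \<beta>) m * (1/2) ^ m / fact (n - 2 * m) *
        of_real (trace_pair (ip 0) \<omega> m (replicate n \<theta>)))"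
      by (intro sum.cong refl) (simp add: trace_pair_replicate power_divide)
    also have "fact n * (fact n * \<dots>) = \<Psi> n (replicate n \<theta>)"
      by (simp only: \<Psi>_def mult.assoc)
    finally show ?thesis .
  qed
  have prod_a: "(\<Prod>\<xi>\<leftarrow>L. a * hn p \<xi>) = a ^ length L * (\<Prod>\<xi>\<leftarrow>L. hn p \<xi>)" for L
    by (induction L) auto
  have pos: "0 \<le> (\<Prod>\<xi>\<leftarrow>L. hn p \<xi>)" for L by (induction L) auto
  have \<Psi>b: "cmod (\<Psi> n L) \<le> fact n * fact n * (2 * \<kappa> * a) ^ n * (\<Prod>\<xi>\<leftarrow>L. hn p \<xi>)" if "length L = n" for n L
  proof -
    have "cmod (\<Sum>m\<le>n div 2. fps_nth (ml_inv \<beta>) m * (1/2) ^ m / fact (n - 2 * m) * of_real (trace_pair (ip 0) \<omega> m L))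
        \<le> (\<Sum>m\<le>n div 2. \<kappa> ^ n * (\<Prod>\<xi>\<leftarrow>L. a * hn p \<xi>))"
    proof (rule order_trans[OF norm_sum], rule sum_mono)
      fix m assume m: "m \<in> {..n div 2}"
      have "cmod (fps_nth (ml_inv \<beta>) m * (1/2) ^ m / fact (n - 2 * m)) \<le> \<kappa> ^ m * 1 / 1"
        using \<kappa> unfolding norm_divide norm_mult
        by (intro frac_le mult_mono) (auto simp: norm_power norm_divide power_le_one)
      also have "\<dots> \<le> \<kappa> ^ n" using \<kappa>(1) m by (simp add: power_increasing)
      finally show "cmod (fps_nth (ml_inv \<beta>) m * (1/2) ^ m / fact (n - 2 * m) * of_real (trace_pair (ip 0) \<omega> m L))
          \<le> \<kappa> ^ n * (\<Prod>\<xi>\<leftarrow>L. a * hn p \<xi>)"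
        using trace_pair_abs_le[of \<omega> "\<lambda>\<xi>. a * hn p \<xi>" "ip 0" m L, OF wb bb] \<kappa>(1)
        unfolding norm_mult[of _ "of_real _"] by (intro mult_mono) auto
    qed
    \<comment> \<open>The number of summands is at most n + 1, hence at most 2^n, and is absorbed
      into the base of the power.\<close>
    also have "\<dots> \<le> real (n + 1) * (\<kappa> ^ n * (\<Prod>\<xi>\<leftarrow>L. a * hn p \<xi>))"
      using \<kappa>(1) pos[of L] a(1) by (simp add: prod_a mult_right_mono)
    also have "\<dots> \<le> 2 ^ n * (\<kappa> ^ n * (\<Prod>\<xi>\<leftarrow>L. a * hn p \<xi>))"
    proof (rule mult_right_mono)
      have "n + 1 \<le> 2 ^ n" unfolding Suc_eq_plus1[symmetric] by (rule Suc_leI[OF less_exp])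
      then show "real (n + 1) \<le> 2 ^ n" by (metis of_nat_le_iff of_nat_numeral of_nat_power)
    qed (use \<kappa>(1) pos[of L] a(1) in \<open>simp add: prod_a\<close>)
    also have "\<dots> = (2 * \<kappa> * a) ^ n * (\<Prod>\<xi>\<leftarrow>L. hn p \<xi>)"
      using that by (simp add: prod_a power_mult_distrib)
    finally have *: "fact n * fact n * cmod (\<Sum>m\<le>n div 2. fps_nth (ml_inv \<beta>) m * (1/2) ^ m / fact (n - 2 * m) *
        of_real (trace_pair (ip 0) \<omega> m L)) \<le> fact n * fact n * ((2 * \<kappa> * a) ^ n * (\<Prod>\<xi>\<leftarrow>L. hn p \<xi>))"
      by (intro mult_left_mono) auto
    then show ?thesis unfolding \<Psi>_def norm_mult norm_fact by (simp only: mult.assoc)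
  qed
  have sp: "cmod (P n \<omega> (sym_prod L)) \<le> fact n * (fact n * (2 * \<kappa> * a) ^ n) * (\<Prod>\<xi>\<leftarrow>L. hn p \<xi>)"
    if L: "length L = n" for n L
  proof -
    \<comment> \<open>The n! on the left cancels the number of permutations on the right, so the
      passage from the diagonal to arbitrary products costs nothing.\<close>
    have "fact n * P n \<omega> (sym_prod L) = symmetrize n (\<Psi> n) L"
      using L by (intro symmetric_eq_symmetrize[OF subspace_UNIV tensor_dual_sym_prod[OF T] ml]) (auto simp: diag)
    then have "fact n * cmod (P n \<omega> (sym_prod L)) = cmod (symmetrize n (\<Psi> n) L)"
      by (metis norm_mult norm_fact)
    also have "\<dots> \<le> (\<Sum>\<sigma> | \<sigma> permutes {..<n}. fact n * fact n * (2 * \<kappa> * a) ^ n * (\<Prod>\<xi>\<leftarrow>L. hn p \<xi>))"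
      unfolding symmetrize_def
    proof (rule order_trans[OF norm_sum], rule sum_mono)
      fix \<sigma> assume "\<sigma> \<in> {\<sigma>. \<sigma> permutes {..<n}}"
      then have "mset (permute_list \<sigma> L) = mset L" using L by simp
      then have "(\<Prod>\<xi>\<leftarrow>permute_list \<sigma> L. hn p \<xi>) = (\<Prod>\<xi>\<leftarrow>L. hn p \<xi>)" by (rule prod_list_permute)
      then show "cmod (\<Psi> n (permute_list \<sigma> L)) \<le> fact n * fact n * (2 * \<kappa> * a) ^ n * (\<Prod>\<xi>\<leftarrow>L. hn p \<xi>)"
        using \<Psi>b[of "permute_list \<sigma> L" n] L by simp
    qed
    also have "\<dots> = fact n * (fact n * fact n * (2 * \<kappa> * a) ^ n * (\<Prod>\<xi>\<leftarrow>L. hn p \<xi>))"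
      by (simp add: card_permutations)
    finally show ?thesis by (simp add: mult.assoc)
  qed
  define K where "K = max 1 (2 * \<kappa> * a * H)"
  have "cmod (P n \<omega> f) \<le> fact n * K ^ n * tn q n f" if f: "f \<in> sym_tensors ip n" for n f
  proof -
    have "cmod (P n \<omega> f) \<le> (fact n * (2 * \<kappa> * a) ^ n) * H ^ n * tn q n f"
      using sp H \<kappa>(1) a(1) by (intro tensor_dual_hs_bound[OF T f, where p = p]) auto
    also have "\<dots> = fact n * (2 * \<kappa> * a * H) ^ n * tn q n f" by (simp add: power_mult_distrib)
    also have "\<dots> \<le> fact n * K ^ n * tn q n f"
      using \<kappa>(1) a(1) H(1) f by (intro mult_right_mono mult_left_mono power_mono) (auto simp: K_def)
    finally show ?thesis .
  qed
  moreover have "1 \<le> K" by (simp add: K_def)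
  moreover have "dominates q p1" using dominates_trans[OF q(2) dominates_trans[OF p(1) p0(1)]] .
  ultimately show ?thesis by blast
qed

section \<open>Operations on continuous functionals\<close>

lemma tensor_dualI:
  assumes "\<And>f g a b. f \<in> sym_tensors ip n \<Longrightarrow> g \<in> sym_tensors ip n \<Longrightarrow>
      T (\<lambda>xs. a * f xs + b * g xs) = a * T f + b * T g"
    and "\<And>f. f \<in> sym_tensors ip n \<Longrightarrow> cmod (T f) \<le> C * tn p n f"
  shows "T \<in> tensor_dual ip n"
  unfolding tensor_dual_def using assms by blast

lemma tensor_dual_bound_dominating:
  assumes C: "0 \<le> C" "\<And>f. f \<in> sym_tensors ip n \<Longrightarrow> cmod (T f) \<le> C * tn p n f" and "dominates q p"
  shows "\<exists>C'\<ge>0. \<forall>f\<in>sym_tensors ip n. cmod (T f) \<le> C' * tn q n f"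
proof -
  obtain c where c: "1 \<le> c" "\<And>\<xi>. hn p \<xi> \<le> c * hn q \<xi>" using assms(3) unfolding dominates_def by blast
  have "cmod (T f) \<le> (C * c ^ n) * tn q n f" if f: "f \<in> sym_tensors ip n" for f
  proof -
    have "tn p n f \<le> c ^ n * tn q n f" using c by (intro tn_dominated[OF f]) auto
    then have "C * tn p n f \<le> C * (c ^ n * tn q n f)" using C(1) by (rule mult_left_mono)
    then show ?thesis using C(2)[OF f] by (simp add: mult.assoc)
  qed
  then show ?thesis using C(1) c(1) by (intro exI[of _ "C * c ^ n"]) auto
qed

lemma tensor_dual_add:
  assumes S: "S \<in> tensor_dual ip n" and T: "T \<in> tensor_dual ip n"
  shows "(\<lambda>f. c * S f + d * T f) \<in> tensor_dual ip n"
proof -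
  obtain p C where p: "0 \<le> C" "\<And>f. f \<in> sym_tensors ip n \<Longrightarrow> cmod (S f) \<le> C * tn p n f"
    using tensor_dual_bound[OF S] by blast
  obtain q D where q: "0 \<le> D" "\<And>f. f \<in> sym_tensors ip n \<Longrightarrow> cmod (T f) \<le> D * tn q n f"
    using tensor_dual_bound[OF T] by blast
  obtain r where "dominates r p" "dominates r q" using directed by blast
  then obtain C' D' where r: "\<forall>f\<in>sym_tensors ip n. cmod (S f) \<le> C' * tn r n f"
      "\<forall>f\<in>sym_tensors ip n. cmod (T f) \<le> D' * tn r n f"
    using tensor_dual_bound_dominating[OF p] tensor_dual_bound_dominating[OF q] by meson
  show ?thesis
  proof (rule tensor_dualI)
    fix f g a b assume "f \<in> sym_tensors ip n" "g \<in> sym_tensors ip n"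
    then show "c * S (\<lambda>xs. a * f xs + b * g xs) + d * T (\<lambda>xs. a * f xs + b * g xs) =
        a * (c * S f + d * T f) + b * (c * S g + d * T g)"
      by (simp add: tensor_dual_comb[OF S] tensor_dual_comb[OF T] algebra_simps)
  next
    fix f assume f: "f \<in> sym_tensors ip n"
    have "cmod (c * S f + d * T f) \<le> cmod c * cmod (S f) + cmod d * cmod (T f)"
      using norm_triangle_ineq[of "c * S f" "d * T f"] by (simp add: norm_mult)
    also have "\<dots> \<le> cmod c * (C' * tn r n f) + cmod d * (D' * tn r n f)"
      using r f by (intro add_mono mult_left_mono) auto
    finally show "cmod (c * S f + d * T f) \<le> (cmod c * C' + cmod d * D') * tn r n f"
      by (simp add: algebra_simps)
  qed
qed

lemma tensor_dual_zero: "(\<lambda>_. 0) \<in> tensor_dual ip n"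
  by (rule tensor_dualI[where C = 0]) auto

lemma tensor_dual_sum_functionals:
  assumes "finite I" "\<And>i. i \<in> I \<Longrightarrow> T i \<in> tensor_dual ip n"
  shows "(\<lambda>f. \<Sum>i\<in>I. c i * T i f) \<in> tensor_dual ip n"
  using assms
proof (induction I rule: finite_induct)
  case (insert i I)
  then show ?case
    using tensor_dual_add[of "T i" n "\<lambda>f. \<Sum>i\<in>I. c i * T i f" "c i" 1] by simp
qed (simp add: tensor_dual_zero)

lemma tensor_dual_contract:
  assumes T: "T \<in> tensor_dual ip k" and y: "y \<in> dual ip"
  shows "(\<lambda>f. T (contract m y f)) \<in> tensor_dual ip (m + k)"
proof -
  obtain p C where p: "0 \<le> C" "\<And>f. f \<in> sym_tensors ip k \<Longrightarrow> cmod (T f) \<le> C * tn p k f"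
    using tensor_dual_bound[OF T] by blast
  obtain q where q: "dominates q p" "y \<in> hdual ip q" using finite_subset_dual[of "{y}" p] y by auto
  obtain C' where C': "0 \<le> C'" "\<forall>f\<in>sym_tensors ip k. cmod (T f) \<le> C' * tn q k f"
    using tensor_dual_bound_dominating[OF p q(1)] by blast
  show ?thesis
  proof (rule tensor_dualI)
    fix f g a b assume fg: "f \<in> sym_tensors ip (m + k)" "g \<in> sym_tensors ip (m + k)"
    have "contract m y (\<lambda>xs. a * f xs + b * g xs) = (\<lambda>xs. a * contract m y f xs + b * contract m y g xs)"
      by (simp add: contract_def)
    then show "T (contract m y (\<lambda>xs. a * f xs + b * g xs)) = a * T (contract m y f) + b * T (contract m y g)"
      using tensor_dual_comb[OF T] sym_tensors_contract(1)[OF _ y] fg by simp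
  next
    fix f assume f: "f \<in> sym_tensors ip (m + k)"
    note c = sym_tensors_contract[OF f y]
    have "cmod (T (contract m y f)) \<le> C' * tn q k (contract m y f)" using C' c(1) by blast
    also have "\<dots> \<le> C' * (dn q y ^ m * tn q (m + k) f)" using C'(1) c(2)[OF q(2)] by (intro mult_left_mono)
    finally show "cmod (T (contract m y f)) \<le> (C' * dn q y ^ m) * tn q (m + k) f" by (simp add: mult.assoc)
  qed
qed

lemma contract_tensor_power:
  assumes y: "y \<in> dual ip"
  shows "contract m y (tensor_power ip (m + k) (\<theta>, 0)) = (\<lambda>xs. of_real (y \<theta>) ^ m * tensor_power ip k (\<theta>, 0) xs)"
proof
  fix xs
  have "cpair y (\<theta>, 0) = of_real (y \<theta>)"
    using linear_0[OF dual_linear[OF y]] by (simp add: cpair_def complex_eq_iff)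
  then have "(\<Prod>x\<leftarrow>replicate m y. cpair x (\<theta>, 0)) = of_real (y \<theta>) ^ m"
    by (induction m) auto
  then show "contract m y (tensor_power ip (m + k) (\<theta>, 0)) xs = of_real (y \<theta>) ^ m * tensor_power ip k (\<theta>, 0) xs"
    using y by (cases "m = 0") (auto simp: contract_def tensor_power_def)
qed

text \<open>The right-hand side is a continuous functional because contraction with y is bounded for
  suitable norms, so \<open>tensor_dual_eq_zero\<close> reduces the claim to tensor powers. There a
  shift by y multiplies the series by \<open>fps_exp\<close>, and the Cauchy product yields the
  binomial coefficients.\<close>

theorem appell_translate:
  assumes P: "appell_system ip \<beta> P" and \<beta>: "0 < \<beta>" and \<omega>: "\<omega> \<in> dual ip" and y: "y \<in> dual ip"
    and f: "f \<in> sym_tensors ip n"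
  shows "P n (\<omega> + y) f = (\<Sum>k\<le>n. of_nat (n choose k) * P k \<omega> (contract (n - k) y f))"
proof -
  have \<omega>y: "\<omega> + y \<in> dual ip" using \<omega> y by (rule dual_closed)
  have T: "P k \<omega> \<in> tensor_dual ip k" for k using P \<omega> by (simp add: appell_system_def)
  have Ty: "P n (\<omega> + y) \<in> tensor_dual ip n" using P \<omega>y by (simp add: appell_system_def)
  define S where "S f = (\<Sum>k\<le>n. of_nat (n choose k) * P k \<omega> (contract (n - k) y f))" for f
  have S: "S \<in> tensor_dual ip n"
    unfolding S_def
  proof (rule tensor_dual_sum_functionals)
    fix k assume "k \<in> {..n}"
    then show "(\<lambda>f. P k \<omega> (contract (n - k) y f)) \<in> tensor_dual ip n"
      using tensor_dual_contract[OF T y, of k "n - k"] by simp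
  qed simp
  have "1 * P n (\<omega> + y) f + (-1) * S f = 0"
  proof (rule tensor_dual_eq_zero[OF tensor_dual_add[OF Ty S, of 1 "-1"] _ f])
    fix \<theta>
    let ?s = "of_real (ip 0 \<theta> \<theta> / 2) :: complex" and ?tp = "tensor_power ip n (\<theta>, 0)"
    let ?G = "\<lambda>k. fps_nth (appell_fps \<beta> (of_real (\<omega> \<theta>)) ?s) k"
    have summand: "of_nat (n choose k) * P k \<omega> (contract (n - k) y ?tp) = fact n * (of_real (y \<theta>) ^ (n - k) / fact (n - k) * ?G k)"
      if "k \<le> n" for k
    proof -
      have "P k \<omega> (contract (n - k) y ?tp) = of_real (y \<theta>) ^ (n - k) * P k \<omega> (tensor_power ip k (\<theta>, 0))"
        using contract_tensor_power[OF y, of "n - k" k \<theta>] that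
        by (simp add: tensor_dual_scale[OF T tensor_power_tensor])
      also have "\<dots> = of_real (y \<theta>) ^ (n - k) * (fact k * ?G k)"
        by (simp only: appell_coeff[OF P \<beta> \<omega>])
      finally show ?thesis
        using binomial_fact[OF that, where ?'a = complex] by (simp add: field_simps)
    qed
    have "P n (\<omega> + y) ?tp = fact n * fps_nth (appell_fps \<beta> (of_real (\<omega> \<theta>) + of_real (y \<theta>)) ?s) n"
      using appell_coeff[OF P \<beta> \<omega>y] by simp
    also have "\<dots> = fact n * (\<Sum>i=0..n. of_real (y \<theta>) ^ i / fact i * ?G (n - i))"
      unfolding appell_fps_add by (simp add: fps_mult_nth)
    also have "(\<Sum>i=0..n. of_real (y \<theta>) ^ i / fact i * ?G (n - i)) = (\<Sum>k\<le>n. of_real (y \<theta>) ^ (n - k) / fact (n - k) * ?G k)"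
      by (rule sum.reindex_bij_witness[of _ "\<lambda>k. n - k" "\<lambda>k. n - k"]) auto
    also have "fact n * \<dots> = S ?tp"
      unfolding S_def sum_distrib_left using summand by (intro sum.cong) auto
    finally have eq: "P n (\<omega> + y) ?tp = S ?tp" .
    show "1 * P n (\<omega> + y) ?tp + (-1) * S ?tp = 0" unfolding eq by simp
  qed
  then show ?thesis by (simp add: S_def)
qed

end

section \<open>Double series\<close>

text \<open>The geometric majorant makes the family summable. Rows, columns and antidiagonals are
  three groupings of the same total, which the given antidiagonal sum identifies as s.\<close>

lemma double_series:
  fixes a :: "nat \<Rightarrow> nat \<Rightarrow> complex"
  assumes bound: "\<And>n k. cmod (a n k) \<le> D * (1/2) ^ (n + k)"
    and s: "(\<lambda>N. \<Sum>k\<le>N. a (N - k) k) sums s"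
  shows "summable (\<lambda>n. a n k)" "summable (\<lambda>k. a n k)"
    "(\<lambda>k. \<Sum>n. a n k) sums s" "(\<lambda>n. \<Sum>k. a n k) sums s"
proof -
  define f where "f x = a (fst x) (snd x)" for x
  have D: "0 \<le> D" using order_trans[OF norm_ge_zero bound[of 0 0]] by simp
  have geom: "(\<Sum>n\<le>N. (1/2) ^ n) \<le> (2::real)" for N
    using sum_le_suminf[OF summable_geometric[of "1/2::real"], of "{..N}"] suminf_geometric[of "1/2::real"] by simp
  have "(\<lambda>x. norm (f x)) summable_on (UNIV \<times> UNIV)"
  proof (rule nonneg_bdd_above_summable_on)
    show "bdd_above (sum (\<lambda>x. norm (f x)) ` {F. F \<subseteq> UNIV \<times> UNIV \<and> finite F})"
    proof (rule bdd_aboveI)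
      fix v assume "v \<in> sum (\<lambda>x. norm (f x)) ` {F. F \<subseteq> UNIV \<times> UNIV \<and> finite F}"
      then obtain F where F: "finite F" "v = (\<Sum>x\<in>F. norm (f x))" by auto
      obtain N where N: "fst ` F \<union> snd ` F \<subseteq> {..N}"
        using F(1) finite_nat_set_iff_bounded_le[of "fst ` F \<union> snd ` F"] by auto
      have "v \<le> (\<Sum>x\<in>{..N} \<times> {..N}. norm (f x))"
        unfolding F(2) using N by (intro sum_mono2) force+
      also have "\<dots> = (\<Sum>n\<le>N. \<Sum>k\<le>N. cmod (a n k))"
        by (simp add: f_def sum.cartesian_product split_def)
      also have "\<dots> \<le> (\<Sum>n\<le>N. \<Sum>k\<le>N. D * ((1/2) ^ n * (1/2) ^ k))"
        using bound by (intro sum_mono) (simp add: power_add)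
      also have "\<dots> = D * ((\<Sum>n\<le>N. (1/2) ^ n) * (\<Sum>k\<le>N. (1/2) ^ k))"
        by (subst sum_product) (simp only: sum_distrib_left)
      also have "\<dots> \<le> D * (2 * 2)"
        using D geom by (intro mult_left_mono mult_mono) (auto intro: sum_nonneg)
      finally show "v \<le> D * (2 * 2)" .
    qed
  qed auto
  then have "f summable_on (UNIV \<times> UNIV)" by (rule abs_summable_summable)
  then obtain S where S: "(f has_sum S) (UNIV \<times> UNIV)" by (auto simp: summable_on_def)
  have geo: "summable (\<lambda>n. D * (1/2) ^ (n + k))" for k
    unfolding power_add by (intro summable_mult summable_mult2 summable_geometric) auto
  have s1: "summable (\<lambda>n. norm (a n k))" for k
    by (rule summable_comparison_test'[OF geo[of k], of 0]) (use bound in simp)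
  have s2: "summable (\<lambda>k. norm (a n k))" for n
    by (rule summable_comparison_test'[OF geo[of n], of 0]) (use bound[of n] in \<open>simp add: add.commute\<close>)
  from s1 show s1': "summable (\<lambda>n. a n k)" for k by (rule summable_norm_cancel)
  from s2 show s2': "summable (\<lambda>k. a n k)" for n by (rule summable_norm_cancel)
  have "((\<lambda>n. \<Sum>k. a n k) has_sum S) UNIV"
    by (rule has_sum_SigmaD[OF S])
      (simp only: f_def fst_conv snd_conv norm_summable_imp_has_sum[OF s2 summable_sums[OF s2']])
  then have "(\<lambda>n. \<Sum>k. a n k) sums S" by (rule has_sum_imp_sums)
  moreover have S': "((\<lambda>x. a (snd x) (fst x)) has_sum S) (UNIV \<times> UNIV)"
    using S by (subst has_sum_reindex_bij_witness[of _ prod.swap prod.swap]) (auto simp: f_def)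
  have "((\<lambda>k. \<Sum>n. a n k) has_sum S) UNIV"
    by (rule has_sum_SigmaD[OF S'])
      (simp only: fst_conv snd_conv norm_summable_imp_has_sum[OF s1 summable_sums[OF s1']])
  then have "(\<lambda>k. \<Sum>n. a n k) sums S" by (rule has_sum_imp_sums)
  \<comment> \<open>The index pair (n, k) is replaced by (n + k, k), which turns the quadrant into
    the triangle k \<le> N.\<close>
  moreover have "((\<lambda>x. a (fst x - snd x) (snd x)) has_sum S) (Sigma UNIV (\<lambda>N. {..N}))"
    using S
    by (subst has_sum_reindex_bij_witness[of _ "\<lambda>x. (fst x + snd x, snd x)" "\<lambda>x. (fst x - snd x, snd x)"])
      (auto simp: f_def)
  then have "((\<lambda>N. \<Sum>k\<le>N. a (N - k) k) has_sum S) UNIV"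
    by (rule has_sum_SigmaD) (simp only: fst_conv snd_conv has_sum_finite finite_atMost)
  then have "(\<lambda>N. \<Sum>k\<le>N. a (N - k) k) sums S" by (rule has_sum_imp_sums)
  ultimately show "(\<lambda>k. \<Sum>n. a n k) sums s" "(\<lambda>n. \<Sum>k. a n k) sums s"
    using sums_unique2[OF _ s] by auto
qed

text \<open>Once the lower coefficients vanish, division by x^n leaves a series that is 0 for x
  \<noteq> 0; its limit at 0 is the n-th coefficient.\<close>

lemma real_power_series_zero:
  fixes a :: "nat \<Rightarrow> real"
  assumes "\<And>x. (\<lambda>n. a n * x ^ n) sums 0"
  shows "a n = 0"
proof (induction n rule: less_induct)
  case (less n)
  have "(\<lambda>k. a (k + n) * x ^ k) sums 0" if "x \<noteq> 0" for x
  proof -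
    have "(\<lambda>k. a (k + n) * x ^ (k + n)) sums 0"
      using assms[of x] less sums_iff_shift[of "\<lambda>k. a k * x ^ k" n 0] by simp
    then have "(\<lambda>k. (a (k + n) * x ^ (k + n)) / x ^ n) sums (0 / x ^ n)" by (rule sums_divide)
    then show ?thesis using that by (simp add: power_add)
  qed
  then have "((\<lambda>_. 0) \<longlongrightarrow> a (0 + n)) (at (0::real))"
    by (intro powser_limit_0_strong[of 1 "\<lambda>k. a (k + n)"]) auto
  then show ?case by (simp add: tendsto_const_iff)
qed

text \<open>Only real t is available, since the dual space on which test functions live is real;
  hence the split into real and imaginary part.\<close>

lemma complex_power_series_zero:
  fixes b :: "nat \<Rightarrow> complex"
  assumes "\<And>t::real. (\<lambda>n. of_real t ^ n * b n) sums 0"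
  shows "b n = 0"
proof -
  have "(\<lambda>n. Re (b n) * t ^ n) sums 0" "(\<lambda>n. Im (b n) * t ^ n) sums 0" for t
    using sums_Re[OF assms[of t]] sums_Im[OF assms[of t]]
    by (simp_all add: mult.commute flip: of_real_power)
  then have "Re (b n) = 0" "Im (b n) = 0"
    using real_power_series_zero[of "\<lambda>n. Re (b n)"] real_power_series_zero[of "\<lambda>n. Im (b n)"] by blast+
  then show ?thesis by (simp add: complex_eq_iff)
qed

lemma binomial_fact_eq: "real ((n + k) choose k) * fact k * fact n = fact (n + k)"
proof -
  have "((n + k) choose k) * fact k * fact n = (fact (n + k) :: nat)"
    using binomial_fact_lemma[of k "n + k"] by (simp add: mult_ac)
  then have "real (((n + k) choose k) * fact k * fact n) = real (fact (n + k))" by simp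
  then show ?thesis by simp
qed

lemma binomial_fact_le: "real ((n + k) choose k) * fact k \<le> fact (n + k)"
  using mult_left_mono[OF fact_ge_1[of n, where ?'a = real], of "real ((n + k) choose k) * fact k"]
  by (simp add: binomial_fact_eq)

section \<open>Translation of test functions\<close>

context nuclear_triple
begin

text \<open>Finiteness of the weighted sums for every q means that n! times the norm decays faster
  than every geometric sequence. In this form the decay can absorb any factor K^n.\<close>

lemma test_kernels_iff:
  "\<phi> \<in> test_kernels ip \<longleftrightarrow> (\<forall>n. \<phi> n \<in> sym_tensors ip n) \<and>
     (\<forall>p \<rho>. 0 < \<rho> \<longrightarrow> (\<exists>D\<ge>0. \<forall>n. fact n * tn p n (\<phi> n) \<le> D * \<rho> ^ n))"
  (is "_ \<longleftrightarrow> ?S \<and> ?B")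
proof
  assume \<phi>: "\<phi> \<in> test_kernels ip"
  then have S: ?S by (simp add: test_kernels_def)
  have ?B
  proof (intro allI impI)
    fix p and \<rho> :: real assume \<rho>: "0 < \<rho>"
    \<comment> \<open>With 2^q above the square of 1 / \<rho> the weight in the convergent series
      beats the rate \<rho>.\<close>
    obtain q where q: "(1 / \<rho>)\<^sup>2 < 2 ^ q" using real_arch_pow[of 2 "(1 / \<rho>)\<^sup>2"] by auto
    have "summable (\<lambda>n. (fact n)\<^sup>2 * 2 ^ (n * q) * (tn p n (\<phi> n))\<^sup>2)"
      using \<phi> by (simp add: test_kernels_def)
    then obtain A where A: "\<And>n. norm ((fact n)\<^sup>2 * 2 ^ (n * q) * (tn p n (\<phi> n))\<^sup>2) \<le> A"
      using summable_imp_bounded[of "\<lambda>n. (fact n)\<^sup>2 * 2 ^ (n * q) * (tn p n (\<phi> n))\<^sup>2"] unfolding bounded_iff by blast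
    have "fact n * tn p n (\<phi> n) \<le> sqrt A * \<rho> ^ n" for n
    proof -
      define v where "v = (fact n * tn p n (\<phi> n))\<^sup>2"
      have v: "0 \<le> v" by (simp add: v_def)
      have "1 \<le> \<rho>\<^sup>2 * 2 ^ q" using q \<rho> by (simp add: field_simps)
      then have "1 \<le> (\<rho>\<^sup>2 * 2 ^ q) ^ n" by (rule one_le_power)
      then have "v \<le> v * (\<rho>\<^sup>2 * 2 ^ q) ^ n" using v mult_left_mono by fastforce
      also have "\<dots> = \<rho> ^ (2 * n) * ((fact n)\<^sup>2 * 2 ^ (n * q) * (tn p n (\<phi> n))\<^sup>2)"
        by (simp add: v_def power_mult_distrib power_mult[symmetric] mult.commute mult.left_commute)
      also have "\<dots> \<le> \<rho> ^ (2 * n) * A" using A[of n] \<rho> by (intro mult_left_mono) auto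
      finally have "sqrt v \<le> sqrt (\<rho> ^ (2 * n) * A)" by (rule real_sqrt_le_mono)
      moreover have "sqrt v = fact n * tn p n (\<phi> n)" using S by (simp add: v_def)
      moreover have "sqrt (\<rho> ^ (2 * n) * A) = \<rho> ^ n * sqrt A"
        using \<rho> by (simp add: real_sqrt_mult power_even_eq)
      ultimately show ?thesis by (simp add: mult.commute)
    qed
    moreover have "0 \<le> sqrt A" using order_trans[OF norm_ge_zero A] by simp
    ultimately show "\<exists>D\<ge>0. \<forall>n. fact n * tn p n (\<phi> n) \<le> D * \<rho> ^ n" by blast
  qed
  with S show "?S \<and> ?B" by blast
next
  assume SB: "?S \<and> ?B"
  have "summable (\<lambda>n. (fact n)\<^sup>2 * 2 ^ (n * q) * (tn p n (\<phi> n))\<^sup>2)" for p q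
  proof -
    \<comment> \<open>Chosen so that the weight 2^q times the square of \<rho> is 1/2, which leaves
      a geometric series.\<close>
    define \<rho> :: real where "\<rho> = sqrt (1 / 2 ^ Suc q)"
    have \<rho>: "0 < \<rho>" "\<rho>\<^sup>2 * 2 ^ q = 1/2" by (auto simp: \<rho>_def)
    obtain D where D: "0 \<le> D" "\<And>n. fact n * tn p n (\<phi> n) \<le> D * \<rho> ^ n" using SB \<rho>(1) by blast
    show ?thesis
    proof (rule summable_comparison_test')
      show "summable (\<lambda>n. D\<^sup>2 * (1/2::real) ^ n)" by (intro summable_mult summable_geometric) auto
      fix n :: nat
      have "(fact n * tn p n (\<phi> n))\<^sup>2 \<le> (D * \<rho> ^ n)\<^sup>2" using SB D by (intro power_mono) auto
      then have "(fact n * tn p n (\<phi> n))\<^sup>2 * 2 ^ (n * q) \<le> (D * \<rho> ^ n)\<^sup>2 * 2 ^ (n * q)" by (intro mult_right_mono) auto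
      also have "\<dots> = D\<^sup>2 * (\<rho>\<^sup>2 * 2 ^ q) ^ n"
        by (simp add: power_mult_distrib power_mult[symmetric] mult.commute)
      finally show "norm ((fact n)\<^sup>2 * 2 ^ (n * q) * (tn p n (\<phi> n))\<^sup>2) \<le> D\<^sup>2 * (1/2) ^ n"
        by (simp add: \<rho>(2) power_mult_distrib mult_ac)
    qed
  qed
  then show "\<phi> \<in> test_kernels ip" using SB by (simp add: test_kernels_def)
qed

text \<open>The kernel of degree k in that part of \<open>F (\<omega> + y)\<close> which is
  homogeneous of degree n in y.\<close>

definition taylor_form :: "nat \<Rightarrow> nat \<Rightarrow> ('n \<Rightarrow> real) \<Rightarrow> (nat \<Rightarrow> 'n form) \<Rightarrow> 'n form" where
  "taylor_form k n y \<phi> = (\<lambda>xs. of_nat ((n + k) choose k) * contract n y (\<phi> (n + k)) xs)"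

lemma taylor_form_tensor:
  assumes \<phi>: "\<phi> \<in> test_kernels ip" and y: "y \<in> dual ip"
  shows "taylor_form k n y \<phi> \<in> sym_tensors ip k"
    "y \<in> hdual ip q \<Longrightarrow>
      tn q k (taylor_form k n y \<phi>) \<le> real ((n + k) choose k) * (dn q y ^ n * tn q (n + k) (\<phi> (n + k)))"
proof -
  have f: "\<phi> (n + k) \<in> sym_tensors ip (n + k)" using \<phi> by (simp add: test_kernels_def)
  note c = sym_tensors_contract[OF f y]
  show "taylor_form k n y \<phi> \<in> sym_tensors ip k"
    unfolding taylor_form_def by (rule sym_tensors_scale(1)[OF c(1)])
  assume yq: "y \<in> hdual ip q"
  have "tn q k (taylor_form k n y \<phi>) \<le> real ((n + k) choose k) * tn q k (contract n y (\<phi> (n + k)))"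
    using sym_tensors_scale(2)[OF c(1), where p = q and a = "of_nat ((n + k) choose k)"]
    unfolding taylor_form_def by simp
  also have "real ((n + k) choose k) * tn q k (contract n y (\<phi> (n + k)))
      \<le> real ((n + k) choose k) * (dn q y ^ n * tn q (n + k) (\<phi> (n + k)))"
    by (intro mult_left_mono c(2) yq) auto
  finally show "tn q k (taylor_form k n y \<phi>) \<le> real ((n + k) choose k) * (dn q y ^ n * tn q (n + k) (\<phi> (n + k)))" .
qed

lemma taylor_form_bound:
  assumes \<phi>: "\<phi> \<in> test_kernels ip" and y: "y \<in> hdual ip q" and \<sigma>: "0 < \<sigma>"
  shows "\<exists>D\<ge>0. \<forall>n k. fact k * tn q k (taylor_form k n y \<phi>) \<le> D * \<sigma> ^ (n + k)"
proof -
  \<comment> \<open>The powers of \<open>dn q y\<close> are absorbed by lowering the decay rate to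
    \<sigma> / M. The maximum with 1 makes M^n \<le> M^(n + k), matching the total degree of the
    kernel.\<close>
  define M where "M = max 1 (dn q y)"
  have M: "1 \<le> M" "dn q y \<le> M" by (auto simp: M_def)
  have "0 < \<sigma> / M" using \<sigma> M(1) by simp
  then obtain D where D: "0 \<le> D" "\<And>n. fact n * tn q n (\<phi> n) \<le> D * (\<sigma> / M) ^ n"
    using \<phi> unfolding test_kernels_iff by blast
  have "fact k * tn q k (taylor_form k n y \<phi>) \<le> D * \<sigma> ^ (n + k)" for n k
  proof -
    let ?t = "tn q (n + k) (\<phi> (n + k))"
    have t0: "0 \<le> ?t" using \<phi> by (simp add: test_kernels_def)
    have "fact k * tn q k (taylor_form k n y \<phi>) \<le> fact k * (real ((n + k) choose k) * (dn q y ^ n * ?t))"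
      using taylor_form_tensor(2)[OF \<phi> dualI[OF y] y] by (intro mult_left_mono) auto
    also have "\<dots> = (real ((n + k) choose k) * fact k) * (dn q y ^ n * ?t)" by (simp add: mult_ac)
    also have "\<dots> \<le> fact (n + k) * (M ^ (n + k) * ?t)"
    proof (intro mult_mono binomial_fact_le)
      have "dn q y ^ n \<le> M ^ n" using M dn_nonneg[OF y] by (intro power_mono)
      also have "\<dots> \<le> M ^ (n + k)" using M by (intro power_increasing) auto
      finally show "dn q y ^ n \<le> M ^ (n + k)" .
    qed (use t0 dn_nonneg[OF y] M(1) in auto)
    also have "\<dots> = M ^ (n + k) * (fact (n + k) * ?t)" by (simp add: mult_ac)
    also have "\<dots> \<le> M ^ (n + k) * (D * (\<sigma> / M) ^ (n + k))" using M D by (intro mult_left_mono) auto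
    also have "\<dots> = D * \<sigma> ^ (n + k)" using M by (simp add: power_divide)
    finally show ?thesis .
  qed
  then show ?thesis using D(1) by blast
qed

definition translated_kernels :: "('n \<Rightarrow> real) \<Rightarrow> (nat \<Rightarrow> 'n form) \<Rightarrow> nat \<Rightarrow> 'n form" where
  "translated_kernels y \<phi> k = (\<lambda>xs. \<Sum>n. taylor_form k n y \<phi> xs)"

lemma taylor_form_decay:
  assumes \<phi>: "\<phi> \<in> test_kernels ip" and y: "y \<in> dual ip" and \<rho>: "0 < \<rho>"
  shows "\<exists>D\<ge>0. \<forall>n k. fact k * tn p k (taylor_form k n y \<phi>) \<le> D * \<rho> ^ k * (1/2) ^ n"
proof -
  obtain q where q: "dominates q p" "y \<in> hdual ip q" using finite_subset_dual[of "{y}" p] y by auto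
  obtain c where c: "1 \<le> c" "\<And>\<xi>. hn p \<xi> \<le> c * hn q \<xi>" using q(1) unfolding dominates_def by blast
  \<comment> \<open>The bound \<rho> / c pays for the factor c^k of the change of norm, the bound
    1/2 gives summability in n.\<close>
  define \<sigma> where "\<sigma> = min (1/2) (\<rho> / c)"
  have \<sigma>: "0 < \<sigma>" "\<sigma> \<le> 1/2" "c * \<sigma> \<le> \<rho>"
    using \<rho> c(1) by (auto simp: \<sigma>_def min_def field_simps)
  obtain D where D: "0 \<le> D" "\<And>n k. fact k * tn q k (taylor_form k n y \<phi>) \<le> D * \<sigma> ^ (n + k)"
    using taylor_form_bound[OF \<phi> q(2) \<sigma>(1)] by blast
  have "fact k * tn p k (taylor_form k n y \<phi>) \<le> D * \<rho> ^ k * (1/2) ^ n" for n k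
  proof -
    have "fact k * tn p k (taylor_form k n y \<phi>) \<le> fact k * (c ^ k * tn q k (taylor_form k n y \<phi>))"
      using c by (intro mult_left_mono tn_dominated taylor_form_tensor(1)[OF \<phi> y]) auto
    also have "\<dots> = c ^ k * (fact k * tn q k (taylor_form k n y \<phi>))" by simp
    also have "\<dots> \<le> c ^ k * (D * \<sigma> ^ (n + k))" using c(1) D(2) by (intro mult_left_mono) auto
    also have "\<dots> = D * ((c * \<sigma>) ^ k * \<sigma> ^ n)" by (simp add: power_add power_mult_distrib)
    also have "\<dots> \<le> D * (\<rho> ^ k * (1/2) ^ n)"
      using D(1) \<sigma> \<rho> c(1) by (intro mult_left_mono mult_mono power_mono) auto
    finally show ?thesis by simp
  qed
  then show ?thesis using D(1) by blast
qed

lemma taylor_form_summable: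
  assumes \<phi>: "\<phi> \<in> test_kernels ip" and y: "y \<in> dual ip"
  shows "summable (\<lambda>n. tn p k (taylor_form k n y \<phi>))"
proof -
  obtain D where D: "0 \<le> D" "\<And>n k. fact k * tn p k (taylor_form k n y \<phi>) \<le> D * 1 ^ k * (1/2) ^ n"
    using taylor_form_decay[OF \<phi> y, of 1 p] by auto
  show ?thesis
  proof (rule summable_comparison_test')
    show "summable (\<lambda>n. D * (1/2::real) ^ n)" by (intro summable_mult summable_geometric) auto
    fix n :: nat
    have t: "0 \<le> tn p k (taylor_form k n y \<phi>)" using taylor_form_tensor(1)[OF \<phi> y] by simp
    then have "1 * tn p k (taylor_form k n y \<phi>) \<le> fact k * tn p k (taylor_form k n y \<phi>)"
      by (intro mult_right_mono fact_ge_1)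
    then show "norm (tn p k (taylor_form k n y \<phi>)) \<le> D * (1/2) ^ n" using D(2)[of k n] t by simp
  qed
qed

lemma translated_kernels_test:
  assumes \<phi>: "\<phi> \<in> test_kernels ip" and y: "y \<in> dual ip"
  shows "translated_kernels y \<phi> \<in> test_kernels ip"
    "tn p k (translated_kernels y \<phi> k) \<le> (\<Sum>n. tn p k (taylor_form k n y \<phi>))"
proof -
  note s = sym_tensors_series[of "\<lambda>n. taylor_form _ n y \<phi>", OF taylor_form_tensor(1)[OF \<phi> y] taylor_form_summable[OF \<phi> y]]
  show le: "tn p k (translated_kernels y \<phi> k) \<le> (\<Sum>n. tn p k (taylor_form k n y \<phi>))" for p k
    unfolding translated_kernels_def by (rule s(2))
  show "translated_kernels y \<phi> \<in> test_kernels ip"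
    unfolding test_kernels_iff
  proof (intro conjI allI impI)
    show "translated_kernels y \<phi> n \<in> sym_tensors ip n" for n
      unfolding translated_kernels_def by (rule s(1))
    fix p and \<rho> :: real assume \<rho>: "0 < \<rho>"
    obtain D where D: "0 \<le> D" "\<And>n k. fact k * tn p k (taylor_form k n y \<phi>) \<le> D * \<rho> ^ k * (1/2) ^ n"
      using taylor_form_decay[OF \<phi> y \<rho>, of p] by blast
    have "fact k * tn p k (translated_kernels y \<phi> k) \<le> (2 * D) * \<rho> ^ k" for k
    proof -
      have g: "summable (\<lambda>n. D * \<rho> ^ k * (1/2::real) ^ n)" by (intro summable_mult summable_geometric) auto
      have "fact k * tn p k (translated_kernels y \<phi> k) \<le> fact k * (\<Sum>n. tn p k (taylor_form k n y \<phi>))"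
        using le by (intro mult_left_mono) auto
      also have "\<dots> = (\<Sum>n. fact k * tn p k (taylor_form k n y \<phi>))"
        by (rule suminf_mult[OF taylor_form_summable[OF \<phi> y], symmetric])
      also have "\<dots> \<le> (\<Sum>n. D * \<rho> ^ k * (1/2) ^ n)"
        using D(2) by (intro suminf_le g summable_mult taylor_form_summable[OF \<phi> y])
      also have "\<dots> = D * \<rho> ^ k * 2"
        using suminf_mult[OF summable_geometric[of "1/2::real"], of "D * \<rho> ^ k"] suminf_geometric[of "1/2::real"] by simp
      finally show ?thesis by simp
    qed
    then show "\<exists>D\<ge>0. \<forall>n. fact n * tn p n (translated_kernels y \<phi> n) \<le> D * \<rho> ^ n"
      using D(1) by (intro exI[of _ "2 * D"]) auto
  qed
qed

text \<open>The growth k! K^k of the Appell kernels meets kernels decaying at the rate 1 / (2K) per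
  degree, which leaves the majorant D (1/2)^(n + k). The antidiagonal n + k = N adds up to the N-th
  term of the expansion of F at \<omega> + y.\<close>

theorem translation_series:
  assumes P: "appell_system ip \<beta> P" and \<beta>: "0 < \<beta>" and \<omega>: "\<omega> \<in> dual ip" and y: "y \<in> dual ip"
    and F: "appell_expansion ip P F \<phi>"
  shows "summable (\<lambda>n. P k \<omega> (taylor_form k n y \<phi>))" "summable (\<lambda>k. P k \<omega> (taylor_form k n y \<phi>))"
    "(\<lambda>k. \<Sum>n. P k \<omega> (taylor_form k n y \<phi>)) sums F (\<omega> + y)"
    "(\<lambda>n. \<Sum>k. P k \<omega> (taylor_form k n y \<phi>)) sums F (\<omega> + y)"
proof -
  have \<phi>: "\<phi> \<in> test_kernels ip" using F by (simp add: appell_expansion_def)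
  then have \<phi>s: "\<phi> n \<in> sym_tensors ip n" for n by (simp add: test_kernels_def)
  obtain p where p: "y \<in> hdual ip p" using y by (auto simp: dual_def)
  obtain q K where q: "dominates q p" "1 \<le> K" "\<And>n f. f \<in> sym_tensors ip n \<Longrightarrow> cmod (P n \<omega> f) \<le> fact n * K ^ n * tn q n f"
    using appell_growth[OF P \<beta> \<omega>, of p] by blast
  have yq: "y \<in> hdual ip q" using dominates_hdual[OF q(1)] p by blast
  have "0 < 1 / (2 * K)" using q(2) by simp
  then obtain D where D: "0 \<le> D" "\<And>n k. fact k * tn q k (taylor_form k n y \<phi>) \<le> D * (1 / (2 * K)) ^ (n + k)"
    using taylor_form_bound[OF \<phi> yq] by blast
  have bound: "cmod (P k \<omega> (taylor_form k n y \<phi>)) \<le> D * (1/2) ^ (n + k)" for n k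
  proof -
    have "cmod (P k \<omega> (taylor_form k n y \<phi>)) \<le> fact k * K ^ k * tn q k (taylor_form k n y \<phi>)"
      by (rule q(3)[OF taylor_form_tensor(1)[OF \<phi> y]])
    also have "\<dots> = K ^ k * (fact k * tn q k (taylor_form k n y \<phi>))" by simp
    also have "\<dots> \<le> K ^ (n + k) * (D * (1 / (2 * K)) ^ (n + k))"
      by (rule mult_mono[OF power_increasing D(2)]) (use q(2) taylor_form_tensor(1)[OF \<phi> y] in auto)
    also have "\<dots> = D * (1/2) ^ (n + k)" using q(2) by (simp add: power_divide power_mult_distrib)
    finally show ?thesis .
  qed
  have diag: "(\<Sum>k\<le>N. P k \<omega> (taylor_form k (N - k) y \<phi>)) = P N (\<omega> + y) (\<phi> N)" for N
  proof -
    have "P k \<omega> (taylor_form k (N - k) y \<phi>) = of_nat (N choose k) * P k \<omega> (contract (N - k) y (\<phi> N))" if "k \<le> N" for k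
    proof -
      have "P k \<omega> \<in> tensor_dual ip k" using P \<omega> by (simp add: appell_system_def)
      moreover have "contract (N - k) y (\<phi> N) \<in> sym_tensors ip k"
        using sym_tensors_contract(1)[OF _ y, of "\<phi> N" "N - k" k] \<phi>s[of N] that by simp
      ultimately show ?thesis using that unfolding taylor_form_def by (simp add: tensor_dual_scale)
    qed
    then show ?thesis unfolding appell_translate[OF P \<beta> \<omega> y \<phi>s] by (intro sum.cong) auto
  qed
  have "\<omega> + y \<in> dual ip" using \<omega> y by (rule dual_closed)
  then have "(\<lambda>N. P N (\<omega> + y) (\<phi> N)) sums F (\<omega> + y)" using F by (simp only: appell_expansion_def)
  then have s: "(\<lambda>N. \<Sum>k\<le>N. P k \<omega> (taylor_form k (N - k) y \<phi>)) sums F (\<omega> + y)" by (simp only: diag)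
  note d = double_series[of "\<lambda>n k. P k \<omega> (taylor_form k n y \<phi>)", OF bound s]
  from d show "summable (\<lambda>n. P k \<omega> (taylor_form k n y \<phi>))" "summable (\<lambda>k. P k \<omega> (taylor_form k n y \<phi>))"
    "(\<lambda>k. \<Sum>n. P k \<omega> (taylor_form k n y \<phi>)) sums F (\<omega> + y)"
    "(\<lambda>n. \<Sum>k. P k \<omega> (taylor_form k n y \<phi>)) sums F (\<omega> + y)" by blast+
qed

text \<open>Continuity of \<open>P k \<omega>\<close> exchanges it with the inner series, whose sum
  is the k-th kernel of the translate.\<close>

theorem translated_expansion:
  assumes P: "appell_system ip \<beta> P" and \<beta>: "0 < \<beta>" and y: "y \<in> dual ip"
    and F: "appell_expansion ip P F \<phi>"
  shows "appell_expansion ip P (\<lambda>\<omega>. F (\<omega> + y)) (translated_kernels y \<phi>)"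
  unfolding appell_expansion_def
proof (intro conjI ballI)
  have \<phi>: "\<phi> \<in> test_kernels ip" using F by (simp add: appell_expansion_def)
  show "translated_kernels y \<phi> \<in> test_kernels ip" by (rule translated_kernels_test(1)[OF \<phi> y])
  fix \<omega> assume \<omega>: "\<omega> \<in> dual ip"
  have "P k \<omega> (translated_kernels y \<phi> k) = (\<Sum>n. P k \<omega> (taylor_form k n y \<phi>))" for k
  proof -
    have "P k \<omega> \<in> tensor_dual ip k" using P \<omega> by (simp add: appell_system_def)
    then have "(\<lambda>n. P k \<omega> (taylor_form k n y \<phi>)) sums P k \<omega> (translated_kernels y \<phi> k)"
      unfolding translated_kernels_def
      by (rule tensor_dual_series[OF _ taylor_form_tensor(1)[OF \<phi> y] taylor_form_summable[OF \<phi> y]])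
    then show ?thesis by (rule sums_unique)
  qed
  then show "(\<lambda>k. P k \<omega> (translated_kernels y \<phi> k)) sums F (\<omega> + y)"
    using translation_series(3)[OF P \<beta> \<omega> y F] by simp
qed

section \<open>Uniqueness of the kernels\<close>

lemma sym_tensors_append_norm:
  assumes "f \<in> sym_tensors ip (n + k)" "length xs = n" "set xs \<subseteq> hdual ip p"
  shows "tn p k (\<lambda>ys. f (xs @ ys)) \<le> (\<Prod>x\<leftarrow>xs. dn p x) * tn p (n + k) f"
  using assms
proof (induction xs arbitrary: n f)
  case (Cons x xs)
  have n: "n = Suc (length xs)" using Cons.prems(2) by simp
  have f: "f \<in> sym_tensors ip (Suc (length xs + k))" and x: "x \<in> hdual ip p" and xs: "set xs \<subseteq> hdual ip p"
    using Cons.prems(1,3) by (simp_all add: n)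
  note h = sym_tensors_head[OF f dualI[OF x]]
  have pos: "0 \<le> (\<Prod>x\<leftarrow>xs. dn p x)" using xs by (induction xs) (auto simp: dn_nonneg)
  have "tn p k (\<lambda>ys. f (x # xs @ ys)) \<le> (\<Prod>x\<leftarrow>xs. dn p x) * tn p (length xs + k) (\<lambda>ys. f (x # ys))"
    by (rule Cons.IH[OF h(1) refl xs])
  also have "\<dots> \<le> (\<Prod>x\<leftarrow>xs. dn p x) * (dn p x * tn p (Suc (length xs + k)) f)"
    using pos h(2)[OF x] by (intro mult_left_mono)
  finally show ?case by (simp add: n mult_ac)
qed simp

lemma append_comb:
  assumes f: "f \<in> sym_tensors ip (n + k)" and "length us + Suc (length vs) = n" "set us \<subseteq> dual ip" "set vs \<subseteq> dual ip"
    "x \<in> dual ip" "z \<in> dual ip"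
  shows "f ((us @ (a *\<^sub>R x + b *\<^sub>R z) # vs) @ ys) =
    of_real a * f ((us @ x # vs) @ ys) + of_real b * f ((us @ z # vs) @ ys)"
proof (cases "length ys = k \<and> set ys \<subseteq> dual ip")
  case True
  then show ?thesis
    using multilinearD[OF sym_tensorsD(3)[OF f], of us "vs @ ys"] assms
    unfolding dual_linear_map_def by simp
next
  case False
  have "f ((us @ w # vs) @ ys) = 0" for w
    using False assms(2) by (intro sym_tensorsD(1)[OF f]) auto
  then show ?thesis by simp
qed

text \<open>Tensors of degree 0 are scalars and the constant term of the generating function is 1.
  This isolates the kernel of lowest degree in a Taylor coefficient.\<close>

lemma appell_degree_zero:
  assumes P: "appell_system ip \<beta> P" and \<beta>: "0 < \<beta>" and \<omega>: "\<omega> \<in> dual ip" and f: "f \<in> sym_tensors ip 0"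
  shows "P 0 \<omega> f = f []"
proof -
  have T: "P 0 \<omega> \<in> tensor_dual ip 0" using P \<omega> by (simp add: appell_system_def)
  have "f = (\<lambda>xs. f [] * tensor_power ip 0 (0, 0) xs)"
    using sym_tensorsD(1)[OF f] by (auto simp: tensor_power_def fun_eq_iff)
  then have "P 0 \<omega> f = f [] * P 0 \<omega> (tensor_power ip 0 (0, 0))"
    using tensor_dual_scale[OF T tensor_power_tensor[of 0 0], of "f []"] by simp
  also have "P 0 \<omega> (tensor_power ip 0 (0, 0)) = 1"
    unfolding appell_coeff[OF P \<beta> \<omega>] appell_fps_nth by (simp add: ml_inv_def)
  finally show ?thesis by simp
qed

lemma taylor_form_scale:
  assumes \<phi>: "\<phi> \<in> test_kernels ip" and y: "y \<in> dual ip"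
  shows "taylor_form k n (t *\<^sub>R y) \<phi> = (\<lambda>xs. of_real t ^ n * taylor_form k n y \<phi> xs)"
proof
  fix xs
  have f: "\<phi> (n + k) \<in> sym_tensors ip (n + k)" using \<phi> by (simp add: test_kernels_def)
  \<comment> \<open>The list \<open>us\<close> holds the copies of y from which the scalar has
    already been extracted.\<close>
  have "\<phi> (n + k) (xs @ us @ replicate m (t *\<^sub>R y)) = of_real t ^ m * \<phi> (n + k) (xs @ us @ replicate m y)"
    if "length us + m = n" "set us \<subseteq> dual ip" "length xs = k" "set xs \<subseteq> dual ip" for us m
    using that
  proof (induction m arbitrary: us)
    case (Suc m)
    have "dual_linear_map (\<lambda>x. \<phi> (n + k) ((xs @ us) @ x # replicate m (t *\<^sub>R y)))"
      using Suc.prems y by (intro multilinearD[OF sym_tensorsD(3)[OF f]]) (auto simp: set_replicate_conv_if)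
    then have "\<phi> (n + k) ((xs @ us) @ (t *\<^sub>R y + 0 *\<^sub>R y) # replicate m (t *\<^sub>R y)) =
        of_real t * \<phi> (n + k) ((xs @ us) @ y # replicate m (t *\<^sub>R y)) + of_real 0 * \<phi> (n + k) ((xs @ us) @ y # replicate m (t *\<^sub>R y))"
      using y unfolding dual_linear_map_def by blast
    moreover have "\<phi> (n + k) (xs @ (us @ [y]) @ replicate m (t *\<^sub>R y)) = of_real t ^ m * \<phi> (n + k) (xs @ (us @ [y]) @ replicate m y)"
      using Suc.prems y by (intro Suc.IH) auto
    ultimately have "\<phi> (n + k) (xs @ us @ replicate (Suc m) (t *\<^sub>R y)) =
        of_real t ^ Suc m * \<phi> (n + k) (xs @ us @ replicate (Suc m) y)"
      by simp
    then show ?case .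
  qed simp
  note * = this[of "[]" n]
  show "taylor_form k n (t *\<^sub>R y) \<phi> xs = of_real t ^ n * taylor_form k n y \<phi> xs"
  proof (cases "length xs = k \<and> set xs \<subseteq> dual ip")
    case True
    then show ?thesis using * by (simp add: taylor_form_def contract_def)
  next
    case False
    then have "\<phi> (n + k) (xs @ replicate n (s *\<^sub>R y)) = 0" for s
      by (intro sym_tensorsD(1)[OF f]) auto
    from this[of t] this[of 1] show ?thesis by (simp add: taylor_form_def contract_def)
  qed
qed

text \<open>At \<omega> = 0 and with y replaced by ty, grouping the double series by the degree n in
  y gives a power series in t that sums to 0.\<close>

lemma taylor_coefficient_zero:
  assumes P: "appell_system ip \<beta> P" and \<beta>: "0 < \<beta>" and \<delta>: "appell_expansion ip P (\<lambda>_. 0) \<delta>"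
    and y: "y \<in> dual ip"
  shows "(\<Sum>k. P k 0 (taylor_form k n y \<delta>)) = 0"
proof -
  have \<delta>t: "\<delta> \<in> test_kernels ip" using \<delta> by (simp add: appell_expansion_def)
  have z: "0 \<in> dual ip" by (rule dual_closed)
  have "(\<lambda>n. of_real t ^ n * (\<Sum>k. P k 0 (taylor_form k n y \<delta>))) sums 0" for t :: real
  proof -
    have "P k 0 (taylor_form k n (t *\<^sub>R y) \<delta>) = of_real t ^ n * P k 0 (taylor_form k n y \<delta>)" for k n
    proof -
      have "P k 0 \<in> tensor_dual ip k" using P z by (simp add: appell_system_def)
      then show ?thesis
        unfolding taylor_form_scale[OF \<delta>t y] by (rule tensor_dual_scale[OF _ taylor_form_tensor(1)[OF \<delta>t y]])
    qed
    then have "(\<Sum>k. P k 0 (taylor_form k n (t *\<^sub>R y) \<delta>)) = of_real t ^ n * (\<Sum>k. P k 0 (taylor_form k n y \<delta>))" for n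
      using suminf_mult[OF translation_series(2)[OF P \<beta> z y \<delta>]] by simp
    then show ?thesis using translation_series(4)[OF P \<beta> z _ \<delta>, of "t *\<^sub>R y"] y by simp
  qed
  then show ?thesis by (rule complex_power_series_zero)
qed

lemma taylor_term_summable:
  assumes \<delta>: "\<delta> \<in> test_kernels ip"
    and K: "1 \<le> K" "\<And>k f. f \<in> sym_tensors ip k \<Longrightarrow> cmod (T k f) \<le> fact k * K ^ k * tn q k f"
    and xs: "length xs = n" "set xs \<subseteq> hdual ip q"
  shows "summable (\<lambda>k. of_nat ((n + k) choose k) * T k (\<lambda>ys. \<delta> (n + k) (xs @ ys)))"
proof -
  have d: "\<delta> N \<in> sym_tensors ip N" for N using \<delta> by (simp add: test_kernels_def)
  have xd: "set xs \<subseteq> dual ip" using xs(2) dualI by blast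
  have "0 < 1 / (2 * K)" using K(1) by simp
  then obtain D where D: "0 \<le> D" "\<And>N. fact N * tn q N (\<delta> N) \<le> D * (1 / (2 * K)) ^ N"
    using \<delta> unfolding test_kernels_iff by blast
  define X where "X = (\<Prod>x\<leftarrow>xs. dn q x)"
  have X: "0 \<le> X" unfolding X_def using xs(2) by (induction xs) (auto simp: dn_nonneg)
  show ?thesis
  proof (rule summable_comparison_test')
    show "summable (\<lambda>k. X * D * (1/2::real) ^ k)" by (intro summable_mult summable_geometric) auto
    fix k :: nat
    let ?t = "tn q (n + k) (\<delta> (n + k))"
    have "cmod (T k (\<lambda>ys. \<delta> (n + k) (xs @ ys))) \<le> fact k * K ^ k * tn q k (\<lambda>ys. \<delta> (n + k) (xs @ ys))"
      by (rule K(2)[OF sym_tensors_append[OF d xs(1) xd]])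
    also have "\<dots> \<le> fact k * K ^ k * (X * ?t)"
      using K(1) sym_tensors_append_norm[OF d xs, of k] by (intro mult_left_mono) (auto simp: X_def)
    finally have "real ((n + k) choose k) * cmod (T k (\<lambda>ys. \<delta> (n + k) (xs @ ys)))
        \<le> real ((n + k) choose k) * (fact k * K ^ k * (X * ?t))" by (rule mult_left_mono) simp
    also have "\<dots> = X * ((real ((n + k) choose k) * fact k) * ?t * K ^ k)" by (simp add: mult_ac)
    also have "\<dots> \<le> X * (fact (n + k) * ?t * K ^ k)"
      using X d K(1) by (intro mult_left_mono mult_right_mono binomial_fact_le) auto
    also have "\<dots> \<le> X * ((D * (1 / (2 * K)) ^ (n + k)) * K ^ k)"
      using X K(1) by (intro mult_left_mono mult_right_mono D(2)) auto
    also have "\<dots> = X * D * (1 / (2 * K)) ^ n * (1/2) ^ k"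
      using K(1) by (simp add: power_add power_divide power_mult_distrib)
    also have "\<dots> \<le> X * D * 1 * (1/2) ^ k"
      using X D(1) K(1) by (intro mult_left_mono mult_right_mono power_le_one) auto
    finally show "norm (of_nat ((n + k) choose k) * T k (\<lambda>ys. \<delta> (n + k) (xs @ ys))) \<le> X * D * (1/2) ^ k"
      by (simp add: norm_mult)
  qed
qed

text \<open>The n-th Taylor coefficient at 0 is the diagonal of a symmetric n-linear map of
  functionals. Once it vanishes, polarization gives the relation for arbitrary arguments, as
  required for Hilbert-Schmidt sums.\<close>

lemma taylor_polarized_zero:
  assumes P: "appell_system ip \<beta> P" and \<beta>: "0 < \<beta>" and \<delta>: "appell_expansion ip P (\<lambda>_. 0) \<delta>"
    and xs: "length xs = n" "set xs \<subseteq> dual ip"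
  shows "(\<lambda>k. of_nat ((n + k) choose k) * P k 0 (\<lambda>ys. \<delta> (n + k) (xs @ ys))) sums 0"
proof -
  have \<delta>t: "\<delta> \<in> test_kernels ip" using \<delta> by (simp add: appell_expansion_def)
  then have d: "\<delta> N \<in> sym_tensors ip N" for N by (simp add: test_kernels_def)
  have z: "0 \<in> dual ip" by (rule dual_closed)
  have T: "P k 0 \<in> tensor_dual ip k" for k using P z by (simp add: appell_system_def)
  have summ: "summable (\<lambda>k. of_nat ((n + k) choose k) * P k 0 (\<lambda>ys. \<delta> (n + k) (zs @ ys)))"
    if zs: "length zs = n" "set zs \<subseteq> dual ip" for zs
  proof -
    obtain p where p: "set zs \<subseteq> hdual ip p" using finite_subset_dual[of "set zs" 0] zs(2) by auto
    obtain q K where q: "dominates q p" "1 \<le> K" "\<And>k f. f \<in> sym_tensors ip k \<Longrightarrow> cmod (P k 0 f) \<le> fact k * K ^ k * tn q k f"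
      using appell_growth[OF P \<beta> z, of p] by blast
    have "set zs \<subseteq> hdual ip q" using p dominates_hdual[OF q(1)] by blast
    from taylor_term_summable[where T = "\<lambda>k. P k 0", OF \<delta>t q(2,3) zs(1) this] show ?thesis .
  qed
  define \<Phi> where "\<Phi> zs = (\<Sum>k. of_nat ((n + k) choose k) * P k 0 (\<lambda>ys. \<delta> (n + k) (zs @ ys)))" for zs
  have "multilinear_on (dual ip) n \<Phi>"
    unfolding multilinear_on_def
  proof (intro allI impI)
    fix us vs x w a b
    assume *: "length us + Suc (length vs) = n \<and> set us \<subseteq> dual ip \<and> set vs \<subseteq> dual ip \<and> x \<in> dual ip \<and> w \<in> dual ip"
    have s: "summable (\<lambda>k. of_nat ((n + k) choose k) * P k 0 (\<lambda>ys. \<delta> (n + k) ((us @ u # vs) @ ys)))" if "u \<in> dual ip" for u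
      using * that by (intro summ) auto
    have e: "P k 0 (\<lambda>ys. \<delta> (n + k) ((us @ (a *\<^sub>R x + b *\<^sub>R w) # vs) @ ys)) =
        of_real a * P k 0 (\<lambda>ys. \<delta> (n + k) ((us @ x # vs) @ ys)) + of_real b * P k 0 (\<lambda>ys. \<delta> (n + k) ((us @ w # vs) @ ys))" for k
    proof -
      have "(\<lambda>ys. \<delta> (n + k) ((us @ (a *\<^sub>R x + b *\<^sub>R w) # vs) @ ys)) =
        (\<lambda>ys. of_real a * \<delta> (n + k) ((us @ x # vs) @ ys) + of_real b * \<delta> (n + k) ((us @ w # vs) @ ys))"
        by (intro ext append_comb[OF d]) (use * in auto)
      moreover have "(\<lambda>ys. \<delta> (n + k) ((us @ u # vs) @ ys)) \<in> sym_tensors ip k" if "u \<in> dual ip" for u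
        using * that by (intro sym_tensors_append[OF d]) auto
      ultimately show ?thesis using tensor_dual_comb[OF T] * by simp
    qed
    have "(\<lambda>k. of_nat ((n + k) choose k) * P k 0 (\<lambda>ys. \<delta> (n + k) ((us @ (a *\<^sub>R x + b *\<^sub>R w) # vs) @ ys))) =
      (\<lambda>k. of_real a * (of_nat ((n + k) choose k) * P k 0 (\<lambda>ys. \<delta> (n + k) ((us @ x # vs) @ ys))) +
        of_real b * (of_nat ((n + k) choose k) * P k 0 (\<lambda>ys. \<delta> (n + k) ((us @ w # vs) @ ys))))"
      unfolding e by (simp add: algebra_simps)
    then show "\<Phi> (us @ (a *\<^sub>R x + b *\<^sub>R w) # vs) = of_real a * \<Phi> (us @ x # vs) + of_real b * \<Phi> (us @ w # vs)"
      unfolding \<Phi>_def using s[of x] s[of w] *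
      by (simp only: suminf_add[symmetric] suminf_mult summable_mult)
  qed
  moreover have "symmetric_on (dual ip) n \<Phi>"
    unfolding symmetric_on_def
  proof (intro allI impI)
    fix us vs assume "mset us = mset vs \<and> length us = n \<and> set us \<subseteq> dual ip"
    then have "\<delta> N (us @ ys) = \<delta> N (vs @ ys)" for N ys by (intro sym_tensorsD(2)[OF d]) simp
    then show "\<Phi> us = \<Phi> vs" by (simp add: \<Phi>_def)
  qed
  moreover have "\<Phi> (replicate n y) = 0" if y: "y \<in> dual ip" for y
  proof -
    have "of_nat ((n + k) choose k) * P k 0 (\<lambda>ys. \<delta> (n + k) (replicate n y @ ys)) = P k 0 (taylor_form k n y \<delta>)" for k
    proof -
      have c: "contract n y (\<delta> (n + k)) \<in> sym_tensors ip k" by (rule sym_tensors_contract(1)[OF d y])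
      have "(\<lambda>ys. \<delta> (n + k) (replicate n y @ ys)) = contract n y (\<delta> (n + k))"
        unfolding contract_def by (intro ext sym_tensorsD(2)[OF d]) simp
      then show ?thesis unfolding taylor_form_def tensor_dual_scale[OF T c] by simp
    qed
    then show ?thesis using taylor_coefficient_zero[OF P \<beta> \<delta> y] by (simp add: \<Phi>_def)
  qed
  ultimately have "\<Phi> xs = 0" using polarization[OF subspace_dual, of n \<Phi> xs] xs by blast
  then show ?thesis using summable_sums[OF summ[OF xs]] by (simp add: \<Phi>_def)
qed

text \<open>
  The constant term of the polarized Taylor coefficients is \<open>\<delta> n\<close> itself, the remaining terms
  only involve kernels of higher degree. As these decay superexponentially, iterating the
  resulting estimate shows that all kernels vanish.
\<close>

theorem appell_expansion_zero:
  assumes P: "appell_system ip \<beta> P" and \<beta>: "0 < \<beta>" and \<delta>: "appell_expansion ip P (\<lambda>_. 0) \<delta>"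
  shows "\<delta> n = (\<lambda>_. 0)"
proof
  fix xs
  have \<delta>t: "\<delta> \<in> test_kernels ip" using \<delta> by (simp add: appell_expansion_def)
  then have d: "\<delta> N \<in> sym_tensors ip N" for N by (simp add: test_kernels_def)
  have z: "0 \<in> dual ip" by (rule dual_closed)
  have T: "P k 0 \<in> tensor_dual ip k" for k using P z by (simp add: appell_system_def)
  show "\<delta> n xs = 0"
  proof (cases "length xs = n \<and> set xs \<subseteq> dual ip")
    case False
    then show ?thesis by (rule sym_tensorsD(1)[OF d])
  next
    case True
    obtain p where p: "set xs \<subseteq> hdual ip p" using finite_subset_dual[of "set xs" 0] True by auto
    obtain q K where q: "dominates q p" "1 \<le> K" "\<And>k f. f \<in> sym_tensors ip k \<Longrightarrow> cmod (P k 0 f) \<le> fact k * K ^ k * tn q k f"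
      using appell_growth[OF P \<beta> z, of p] by blast
    define v where "v N = fact N * tn q N (\<delta> N)" for N
    \<comment> \<open>With K / R = 1/3 the terms of higher degree sum to 1/3 + 1/9 + ... = 1/2, so
      the estimate contracts.\<close>
    define R where "R = 3 * K"
    have R: "0 < R" "K / R = 1/3" using q(2) by (auto simp: R_def)
    have v0: "0 \<le> v N" for N using d by (simp add: v_def)
    have step: "v N \<le> (A / 2) * (1 / R) ^ N" if A: "0 \<le> A" "\<And>N. v N \<le> A * (1 / R) ^ N" for A N
    proof -
      define u where "u k = real ((N + Suc k) choose Suc k) * (fact (Suc k) * K ^ Suc k * tn q (N + Suc k) (\<delta> (N + Suc k)))" for k
      \<comment> \<open>The polarized relation solved for its term of index 0, which is the kernel
        of degree N itself; the remaining terms are shifted by one and change sign.\<close>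
      define g where "g k zs = - (of_nat ((N + Suc k) choose Suc k) * P (Suc k) 0 (\<lambda>ys. \<delta> (N + Suc k) (zs @ ys)))" for k zs
      have u0: "0 \<le> u k" for k using d q(2) by (simp add: u_def)
      have uv: "fact N * u k = K ^ Suc k * v (N + Suc k)" for k
      proof -
        have "fact N * u k = (real ((N + Suc k) choose Suc k) * fact (Suc k) * fact N) * K ^ Suc k *
            tn q (N + Suc k) (\<delta> (N + Suc k))"
          unfolding u_def by (simp only: mult_ac)
        then show ?thesis unfolding binomial_fact_eq v_def by (simp only: mult_ac)
      qed
      have ub: "fact N * u k \<le> (A * (1 / R) ^ N / 3) * (1/3) ^ k" for k
      proof -
        have "fact N * u k \<le> K ^ Suc k * (A * (1 / R) ^ (N + Suc k))"
          unfolding uv by (rule mult_left_mono[OF A(2)]) (use q(2) in simp)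
        also have "\<dots> = A * (1 / R) ^ N * (K / R) ^ Suc k"
          by (simp only: power_add power_divide power_one) (simp add: field_simps)
        finally show ?thesis by (simp add: R(2))
      qed
      have g3: "summable (\<lambda>k. (A * (1 / R) ^ N / 3) * (1/3::real) ^ k)" by (intro summable_mult summable_geometric) auto
      have fu: "summable (\<lambda>k. fact N * u k)"
        by (rule summable_comparison_test'[OF g3, of 0]) (use ub u0 in simp)
      then have us: "summable u" by (simp add: summable_cmult_iff)
      have "tn q N (\<delta> N) \<le> suminf u"
      proof (rule tn_least)
        fix E assume E: "D.orthonormal q E"
        show "hs E N (\<delta> N) \<le> (suminf u)\<^sup>2"
        proof (rule hs_series[OF D.orthonormalD(1)[OF E] _ _ u0 us])
          fix zs assume "zs \<in> lists_of E N"
          then have zs: "length zs = N" "set zs \<subseteq> dual ip" using lists_of_dual[OF orthonormal_dual[OF E]] by auto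
          have "(\<lambda>ys. \<delta> (N + 0) (zs @ ys)) \<in> sym_tensors ip 0"
            using zs by (intro sym_tensors_append[OF d]) auto
          then have h0: "P 0 0 (\<lambda>ys. \<delta> (N + 0) (zs @ ys)) = \<delta> N zs"
            using appell_degree_zero[OF P \<beta> z] by simp
          have "(\<lambda>k. of_nat ((N + Suc k) choose Suc k) * P (Suc k) 0 (\<lambda>ys. \<delta> (N + Suc k) (zs @ ys))) sums (0 - \<delta> N zs)"
            using taylor_polarized_zero[OF P \<beta> \<delta> zs] h0
            by (subst sums_Suc_iff) simp
          then show "(\<lambda>k. g k zs) sums \<delta> N zs"
            unfolding g_def using sums_minus by fastforce
        next
          fix k
          \<comment> \<open>Both sides are measured with the same q. Without loss of index or
            constant in the degree-N slots, the estimate can be iterated.\<close>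
          have "hs E N (\<lambda>zs. P (Suc k) 0 (\<lambda>ys. \<delta> (N + Suc k) (zs @ ys)))
              \<le> (fact (Suc k) * K ^ Suc k * tn q (N + Suc k) (\<delta> (N + Suc k)))\<^sup>2"
            by (rule partial_contraction_bound[OF T q(3) _ d E]) (use q(2) in simp_all)
          then have "(real ((N + Suc k) choose Suc k))\<^sup>2 * hs E N (\<lambda>zs. P (Suc k) 0 (\<lambda>ys. \<delta> (N + Suc k) (zs @ ys)))
              \<le> (real ((N + Suc k) choose Suc k))\<^sup>2 * (fact (Suc k) * K ^ Suc k * tn q (N + Suc k) (\<delta> (N + Suc k)))\<^sup>2"
            by (rule mult_left_mono) simp
          moreover have "hs E N (g k) = (real ((N + Suc k) choose Suc k))\<^sup>2 * hs E N (\<lambda>zs. P (Suc k) 0 (\<lambda>ys. \<delta> (N + Suc k) (zs @ ys)))"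
            unfolding hs_def g_def norm_minus_cancel norm_mult norm_of_nat power_mult_distrib sum_distrib_left ..
          ultimately show "hs E N (g k) \<le> (u k)\<^sup>2" unfolding u_def by (simp only: power_mult_distrib)
        qed
      qed (use u0 us in \<open>simp add: suminf_nonneg\<close>)
      then have "v N \<le> fact N * suminf u" by (simp add: v_def)
      also have "\<dots> = (\<Sum>k. fact N * u k)" by (rule suminf_mult[OF us, symmetric])
      also have "\<dots> \<le> (\<Sum>k. (A * (1 / R) ^ N / 3) * (1/3) ^ k)" by (rule suminf_le[OF ub fu g3])
      also have "\<dots> = (A * (1 / R) ^ N / 3) * (3/2)"
        using suminf_mult[OF summable_geometric[of "1/3::real"], of "A * (1 / R) ^ N / 3"] suminf_geometric[of "1/3::real"] by simp
      finally show ?thesis by simp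
    qed
    obtain D where D: "0 \<le> D" "\<And>N. v N \<le> D * (1 / R) ^ N"
      using \<delta>t R(1) unfolding test_kernels_iff v_def by (meson divide_pos_pos zero_less_one)
    have "\<forall>N. v N \<le> D / 2 ^ j * (1 / R) ^ N" for j
    proof (induction j)
      case 0
      then show ?case using D by simp
    next
      case (Suc j)
      then show ?case using step[of "D / 2 ^ j"] D(1) by (simp add: mult.commute)
    qed
    then have le: "v n \<le> (1/2) ^ j * (D * (1 / R) ^ n)" for j
      by (simp add: power_divide)
    have "(\<lambda>j. (1/2) ^ j * (D * (1 / R) ^ n)) \<longlonglongrightarrow> 0 * (D * (1 / R) ^ n)"
      by (intro tendsto_intros LIMSEQ_power_zero) auto
    then have "v n \<le> 0" using le by (intro LIMSEQ_le_const[of _ 0]) auto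
    then have "tn q n (\<delta> n) = 0" 
      using tn_nonneg[OF d[of n], of q] fact_gt_zero[of n, where ?'a = real] unfolding v_def mult_le_0_iff by linarith
    moreover have "set xs \<subseteq> hdual ip q" using p dominates_hdual[OF q(1)] by blast
    ultimately have "cmod (\<delta> n xs) \<le> 0" using sym_tensors_eval[OF d, of xs n q] True by simp
    then show ?thesis by simp
  qed
qed

lemma test_kernels_diff:
  assumes "\<phi> \<in> test_kernels ip" "\<psi> \<in> test_kernels ip"
  shows "(\<lambda>n xs. 1 * \<phi> n xs + (-1) * \<psi> n xs) \<in> test_kernels ip"
  unfolding test_kernels_iff
proof (intro conjI allI impI)
  have s: "\<phi> n \<in> sym_tensors ip n" "\<psi> n \<in> sym_tensors ip n" for n
    using assms by (simp_all add: test_kernels_def)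
  show "(\<lambda>xs. 1 * \<phi> n xs + (-1) * \<psi> n xs) \<in> sym_tensors ip n" for n
    by (rule sym_tensors_comb(1)[OF s])
  fix p and \<rho> :: real assume \<rho>: "0 < \<rho>"
  obtain C where C: "0 \<le> C" "\<And>n. fact n * tn p n (\<phi> n) \<le> C * \<rho> ^ n"
    using assms(1) \<rho> unfolding test_kernels_iff by blast
  obtain D where D: "0 \<le> D" "\<And>n. fact n * tn p n (\<psi> n) \<le> D * \<rho> ^ n"
    using assms(2) \<rho> unfolding test_kernels_iff by blast
  have "fact n * tn p n (\<lambda>xs. 1 * \<phi> n xs + (-1) * \<psi> n xs) \<le> (C + D) * \<rho> ^ n" for n
  proof -
    have "tn p n (\<lambda>xs. 1 * \<phi> n xs + (-1) * \<psi> n xs) \<le> tn p n (\<phi> n) + tn p n (\<psi> n)"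
      using sym_tensors_comb(2)[OF s(1)[of n] s(2)[of n], where a = 1 and b = "-1" and p = p] by simp
    then have "fact n * tn p n (\<lambda>xs. 1 * \<phi> n xs + (-1) * \<psi> n xs) \<le> fact n * (tn p n (\<phi> n) + tn p n (\<psi> n))"
      by (rule mult_left_mono) simp
    then show ?thesis using C(2)[of n] D(2)[of n] by (simp only: distrib_left distrib_right)
  qed
  then show "\<exists>D\<ge>0. \<forall>n. fact n * tn p n (\<lambda>xs. 1 * \<phi> n xs + (-1) * \<psi> n xs) \<le> D * \<rho> ^ n"
    using C(1) D(1) by (intro exI[of _ "C + D"]) auto
qed

theorem appell_expansion_unique:
  assumes P: "appell_system ip \<beta> P" and \<beta>: "0 < \<beta>"
    and \<phi>: "appell_expansion ip P F \<phi>" and \<psi>: "appell_expansion ip P F \<psi>"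
  shows "\<phi> = \<psi>"
proof (intro ext)
  fix n xs
  let ?\<delta> = "\<lambda>n xs. 1 * \<phi> n xs + (-1) * \<psi> n xs"
  have t: "\<phi> \<in> test_kernels ip" "\<psi> \<in> test_kernels ip" using \<phi> \<psi> by (simp_all add: appell_expansion_def)
  then have s: "\<phi> n \<in> sym_tensors ip n" "\<psi> n \<in> sym_tensors ip n" for n by (simp_all add: test_kernels_def)
  have "appell_expansion ip P (\<lambda>_. 0) ?\<delta>"
    unfolding appell_expansion_def
  proof (intro conjI ballI test_kernels_diff t)
    fix \<omega> assume \<omega>: "\<omega> \<in> dual ip"
    have T: "P n \<omega> \<in> tensor_dual ip n" for n using P \<omega> by (simp add: appell_system_def)
    have "(\<lambda>n. P n \<omega> (\<phi> n) - P n \<omega> (\<psi> n)) sums (F \<omega> - F \<omega>)"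
      using \<phi> \<psi> \<omega> unfolding appell_expansion_def by (intro sums_diff) auto
    moreover have "P n \<omega> (?\<delta> n) = P n \<omega> (\<phi> n) - P n \<omega> (\<psi> n)" for n
      using tensor_dual_comb[OF T s, of n 1 "-1"] by simp
    ultimately show "(\<lambda>n. P n \<omega> (?\<delta> n)) sums 0" by simp
  qed
  then have "?\<delta> n xs = 0" using appell_expansion_zero[OF P \<beta>, of ?\<delta> n] by meson
  then show "\<phi> n xs = \<psi> n xs" by simp
qed

text \<open>By uniqueness the definite description denotes the given kernels, so
  \<open>test_norm\<close> can be computed from any known expansion.\<close>

corollary appell_kernels_eq:
  assumes "appell_system ip \<beta> P" "0 < \<beta>" "appell_expansion ip P F \<phi>"
  shows "appell_kernels ip P F = \<phi>"
  unfolding appell_kernels_def using assms appell_expansion_unique by (intro the_equality) blast+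

section \<open>The norm estimate\<close>

lemma test_norm_summable:
  assumes \<phi>: "\<phi> \<in> test_kernels ip"
  shows "summable (\<lambda>n. fact n * (tn r n (\<phi> n))\<^sup>2)"
proof (rule summable_comparison_test')
  show "summable (\<lambda>n. (fact n)\<^sup>2 * 2 ^ (n * 0) * (tn r n (\<phi> n))\<^sup>2)"
    using \<phi> unfolding test_kernels_def by blast
  fix n :: nat
  have "fact n * 1 * (tn r n (\<phi> n))\<^sup>2 \<le> fact n * fact n * (tn r n (\<phi> n))\<^sup>2"
    by (intro mult_right_mono mult_left_mono fact_ge_1) auto
  then show "norm (fact n * (tn r n (\<phi> n))\<^sup>2) \<le> (fact n)\<^sup>2 * 2 ^ (n * 0) * (tn r n (\<phi> n))\<^sup>2"
    by (simp add: power2_eq_square)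
qed

text \<open>
  Cauchy-Schwarz in \<open>n\<close> with weights \<open>(Y\<^sup>2 / s)\<^sup>n / n!\<close>, where \<open>s = 1 - h\<^sup>2\<close>; the binomial
  theorem for \<open>(h\<^sup>2 + s)\<^sup>N = 1\<close> then collects the terms of equal total degree.
\<close>

lemma translation_cauchy_schwarz:
  fixes t :: "nat \<Rightarrow> real"
  assumes h: "0 \<le> h" "h\<^sup>2 < 1" and t: "summable (\<lambda>N. fact N * (t N)\<^sup>2)"
  shows "(\<Sum>k<l. fact k * (\<Sum>n<m. real ((n + k) choose k) * (h ^ k * (Y ^ n * t (n + k))))\<^sup>2)
    \<le> exp (Y\<^sup>2 / (1 - h\<^sup>2)) * (\<Sum>N. fact N * (t N)\<^sup>2)"
proof -
  define s where "s = 1 - h\<^sup>2"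
  have s: "0 < s" using h by (simp add: s_def)
  \<comment> \<open>With N = n + k, this is the share of \<open>fact N * (t N)\<^sup>2\<close> that
    the binomial law with parameter \<open>h\<^sup>2\<close> assigns to k.\<close>
  define \<beta> where "\<beta> k n = s ^ n * real ((n + k) choose k) * (h\<^sup>2) ^ k * (fact (n + k) * (t (n + k))\<^sup>2)" for k n
  have \<beta>0: "0 \<le> \<beta> k n" for k n using s h by (simp add: \<beta>_def)
  have row: "fact k * (\<Sum>n<m. real ((n + k) choose k) * (h ^ k * (Y ^ n * t (n + k))))\<^sup>2
      \<le> exp (Y\<^sup>2 / s) * (\<Sum>n<m. \<beta> k n)" for k
  proof -
    define g where "g n = real ((n + k) choose k) * (h ^ k * (Y ^ n * t (n + k)))" for n
    have "\<bar>sqrt (fact k) * g n\<bar> = sqrt ((Y\<^sup>2 / s) ^ n / fact n) * sqrt (\<beta> k n)" for n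
    proof -
      have bf: "real ((n + k) choose k) * fact k * fact n = fact (n + k)" by (rule binomial_fact_eq)
      have "(sqrt (fact k) * g n)\<^sup>2 = (Y\<^sup>2 / s) ^ n / fact n * \<beta> k n"
      proof -
        have "(sqrt (fact k) * g n)\<^sup>2 = real ((n + k) choose k) * fact k * (real ((n + k) choose k) * (h\<^sup>2) ^ k * ((Y\<^sup>2) ^ n * (t (n + k))\<^sup>2))"
          by (simp add: g_def power_mult_distrib power2_eq_square mult_ac)
        moreover have "(Y\<^sup>2 / s) ^ n / fact n * \<beta> k n = fact (n + k) / fact n * (real ((n + k) choose k) * (h\<^sup>2) ^ k * ((Y\<^sup>2) ^ n * (t (n + k))\<^sup>2))"
          using s by (simp add: \<beta>_def power_divide)
        moreover have "real ((n + k) choose k) * fact k = fact (n + k) / fact n"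
          using bf by (simp add: field_simps)
        ultimately show ?thesis by simp
      qed
      then have "sqrt ((sqrt (fact k) * g n)\<^sup>2) = sqrt ((Y\<^sup>2 / s) ^ n / fact n * \<beta> k n)" by simp
      then show ?thesis by (simp only: real_sqrt_abs real_sqrt_mult)
    qed
    note g = this
    have "fact k * (\<Sum>n<m. g n)\<^sup>2 = (\<Sum>n<m. sqrt (fact k) * g n)\<^sup>2"
      by (simp add: power_mult_distrib sum_distrib_left[symmetric])
    also have "\<dots> = \<bar>\<Sum>n<m. sqrt (fact k) * g n\<bar>\<^sup>2" by simp
    also have "\<dots> \<le> (\<Sum>n<m. sqrt ((Y\<^sup>2 / s) ^ n / fact n) * sqrt (\<beta> k n))\<^sup>2"
      using sum_abs[of "\<lambda>n. sqrt (fact k) * g n" "{..<m}"] unfolding g by (intro power_mono) auto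
    also have "\<dots> \<le> (\<Sum>n<m. (sqrt ((Y\<^sup>2 / s) ^ n / fact n))\<^sup>2) * (\<Sum>n<m. (sqrt (\<beta> k n))\<^sup>2)"
      by (rule Cauchy_Schwarz_ineq_sum)
    also have "\<dots> = (\<Sum>n<m. (Y\<^sup>2 / s) ^ n / fact n) * (\<Sum>n<m. \<beta> k n)"
      using \<beta>0 s by simp
    also have "\<dots> \<le> exp (Y\<^sup>2 / s) * (\<Sum>n<m. \<beta> k n)"
    proof (rule mult_right_mono)
      have e: "(\<lambda>n. (Y\<^sup>2 / s) ^ n / fact n) sums exp (Y\<^sup>2 / s)"
        using exp_converges[of "Y\<^sup>2 / s"] by (simp add: field_simps)
      then show "(\<Sum>n<m. (Y\<^sup>2 / s) ^ n / fact n) \<le> exp (Y\<^sup>2 / s)"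
        using s sum_le_suminf[OF sums_summable[OF e], of "{..<m}"] sums_unique[OF e] by simp
    qed (use \<beta>0 in \<open>simp add: sum_nonneg\<close>)
    finally show ?thesis by (simp add: g_def)
  qed
  have "(\<Sum>k<l. \<Sum>n<m. \<beta> k n) \<le> (\<Sum>N. fact N * (t N)\<^sup>2)"
  proof -
    let ?G = "\<lambda>x. \<beta> (snd x) (fst x - snd x)"
    have "(\<Sum>k<l. \<Sum>n<m. \<beta> k n) = (\<Sum>x\<in>{..<l} \<times> {..<m}. \<beta> (fst x) (snd x))"
      by (simp add: sum.cartesian_product split_def)
    \<comment> \<open>The substitution N = n + k places the rectangle inside the triangle k \<le> N
      < l + m; the added terms are nonnegative.\<close>
    also have "\<dots> = (\<Sum>x\<in>(\<lambda>x. (fst x + snd x, fst x)) ` ({..<l} \<times> {..<m}). ?G x)"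
      by (subst sum.reindex) (auto simp: inj_on_def)
    also have "\<dots> \<le> (\<Sum>x\<in>Sigma {..<l + m} (\<lambda>N. {..N}). ?G x)"
      using \<beta>0 by (intro sum_mono2) auto
    also have "\<dots> = (\<Sum>N<l + m. \<Sum>k\<le>N. \<beta> k (N - k))"
      by (simp add: sum.Sigma split_def)
    also have "\<dots> = (\<Sum>N<l + m. fact N * (t N)\<^sup>2)"
    proof (rule sum.cong[OF refl])
      fix N
      have "(\<Sum>k\<le>N. \<beta> k (N - k)) = fact N * (t N)\<^sup>2 * (\<Sum>k\<le>N. real (N choose k) * (h\<^sup>2) ^ k * s ^ (N - k))"
        unfolding sum_distrib_left by (intro sum.cong refl) (simp add: \<beta>_def mult_ac)
      also have "(\<Sum>k\<le>N. real (N choose k) * (h\<^sup>2) ^ k * s ^ (N - k)) = (h\<^sup>2 + s) ^ N"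
        by (simp only: binomial_ring)
      finally show "(\<Sum>k\<le>N. \<beta> k (N - k)) = fact N * (t N)\<^sup>2" by (simp add: s_def)
    qed
    also have "\<dots> \<le> (\<Sum>N. fact N * (t N)\<^sup>2)" by (intro sum_le_suminf t) auto
    finally show ?thesis .
  qed
  then have "exp (Y\<^sup>2 / s) * (\<Sum>k<l. \<Sum>n<m. \<beta> k n) \<le> exp (Y\<^sup>2 / s) * (\<Sum>N. fact N * (t N)\<^sup>2)"
    by (intro mult_left_mono) auto
  moreover have "(\<Sum>k<l. fact k * (\<Sum>n<m. real ((n + k) choose k) * (h ^ k * (Y ^ n * t (n + k))))\<^sup>2)
      \<le> exp (Y\<^sup>2 / s) * (\<Sum>k<l. \<Sum>n<m. \<beta> k n)"
    by (subst sum_distrib_left) (rule sum_mono[OF row])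
  ultimately show ?thesis unfolding s_def by (rule order_trans[rotated])
qed

text \<open>The contraction is estimated in the norm r, where y is bounded, and only the k remaining
  slots pass to the norm p, each gaining a factor h. The inequality is proved for finite rectangles
  and both limits are taken afterwards.\<close>

theorem translated_kernels_norm:
  assumes \<phi>: "\<phi> \<in> test_kernels ip" and y: "y \<in> hdual ip r"
    and h: "0 \<le> h" "h\<^sup>2 < 1" "\<And>\<xi>. hn p \<xi> \<le> h * hn r \<xi>"
  shows "(\<Sum>k. fact k * (tn p k (translated_kernels y \<phi> k))\<^sup>2)
    \<le> exp ((dn r y)\<^sup>2 / (1 - h\<^sup>2)) * (\<Sum>N. fact N * (tn r N (\<phi> N))\<^sup>2)"
proof -
  note yd = dualI[OF y]
  note \<psi> = translated_kernels_test[OF \<phi> yd]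
  let ?t = "\<lambda>N. tn r N (\<phi> N)" and ?Y = "dn r y"
  let ?C = "exp (?Y\<^sup>2 / (1 - h\<^sup>2)) * (\<Sum>N. fact N * (?t N)\<^sup>2)"
  have term_le: "tn p k (taylor_form k n y \<phi>) \<le> real ((n + k) choose k) * (h ^ k * (?Y ^ n * ?t (n + k)))" for k n
  proof -
    have "tn p k (taylor_form k n y \<phi>) \<le> h ^ k * tn r k (taylor_form k n y \<phi>)"
      by (rule tn_dominated[OF taylor_form_tensor(1)[OF \<phi> yd] h(3,1)])
    also have "\<dots> \<le> h ^ k * (real ((n + k) choose k) * (?Y ^ n * ?t (n + k)))"
      using h(1) by (intro mult_left_mono taylor_form_tensor(2)[OF \<phi> yd y]) auto
    finally show ?thesis by (simp add: mult_ac)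
  qed
  have t0: "0 \<le> tn p k (taylor_form k n y \<phi>)" for k n using taylor_form_tensor(1)[OF \<phi> yd] by simp
  have part: "(\<Sum>k<l. fact k * (\<Sum>n<m. tn p k (taylor_form k n y \<phi>))\<^sup>2) \<le> ?C" for l m
  proof -
    have "(\<Sum>k<l. fact k * (\<Sum>n<m. tn p k (taylor_form k n y \<phi>))\<^sup>2)
        \<le> (\<Sum>k<l. fact k * (\<Sum>n<m. real ((n + k) choose k) * (h ^ k * (?Y ^ n * ?t (n + k))))\<^sup>2)"
      using term_le t0 by (intro sum_mono mult_left_mono power_mono sum_nonneg) auto
    also have "\<dots> \<le> ?C" by (rule translation_cauchy_schwarz[OF h(1,2) test_norm_summable[OF \<phi>]])
    finally show ?thesis .
  qed
  have "(\<Sum>k<l. fact k * (\<Sum>n. tn p k (taylor_form k n y \<phi>))\<^sup>2) \<le> ?C" for l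
  proof (rule LIMSEQ_le_const2)
    show "(\<lambda>m. \<Sum>k<l. fact k * (\<Sum>n<m. tn p k (taylor_form k n y \<phi>))\<^sup>2)
        \<longlonglongrightarrow> (\<Sum>k<l. fact k * (\<Sum>n. tn p k (taylor_form k n y \<phi>))\<^sup>2)"
      by (intro tendsto_intros summable_LIMSEQ taylor_form_summable[OF \<phi> yd])
  qed (use part in auto)
  moreover have "(\<Sum>k<l. fact k * (tn p k (translated_kernels y \<phi> k))\<^sup>2)
      \<le> (\<Sum>k<l. fact k * (\<Sum>n. tn p k (taylor_form k n y \<phi>))\<^sup>2)" for l
    using \<psi>(1) unfolding test_kernels_def
    by (intro sum_mono mult_left_mono power_mono \<psi>(2)) auto
  ultimately have "(\<Sum>k<l. fact k * (tn p k (translated_kernels y \<phi> k))\<^sup>2) \<le> ?C" for l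
    by (rule order_trans[rotated])
  then show ?thesis by (intro suminf_le_const test_norm_summable[OF \<psi>(1)])
qed

end

section \<open>The translation formula and its norm estimate\<close>

theorem proposition31:
  fixes ip :: "nat \<Rightarrow> 'n::real_vector \<Rightarrow> 'n \<Rightarrow> real"
    and \<beta> :: real
    and P :: "nat \<Rightarrow> ('n \<Rightarrow> real) \<Rightarrow> 'n form \<Rightarrow> complex"
    and y :: "'n \<Rightarrow> real"
    and F :: "('n \<Rightarrow> real) \<Rightarrow> complex"
    and \<phi> :: "nat \<Rightarrow> 'n form"
  assumes "nuclear_triple ip"
    and "0 < \<beta>" and "\<beta> \<le> 1"
    and "appell_system ip \<beta> P"
    and "y \<in> dual ip"
    and "appell_expansion ip P F \<phi>"
  shows "(\<forall>\<omega>\<in>dual ip.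
            (\<forall>k. summable (\<lambda>n. of_nat ((n + k) choose k) * P k \<omega> (contract n y (\<phi> (n + k))))) \<and>
            (\<lambda>k. \<Sum>n. of_nat ((n + k) choose k) * P k \<omega> (contract n y (\<phi> (n + k))))
              sums translate y F \<omega>) \<and>
         translate y F \<in> test_functions ip P \<and>
         (\<forall>p q. q > 0 \<and> y \<in> hdual ip (p + q) \<and>
              (\<forall>\<xi>. hnorm ip p \<xi> \<le> 2 powr (- real q) * hnorm ip (p + q) \<xi>) \<longrightarrow>
            test_norm ip P p (translate y F) \<le>
              test_norm ip P (p + q) F / sqrt (1 - 2 powr (- 2 * real q)) *
              exp ((dual_norm ip (p + q) y)\<^sup>2 / (2 * (1 - 2 powr (- 2 * real q)))))"
proof -
  interpret nuclear_triple ip by fact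
  note \<beta> = assms(2) and P = assms(4) and y = assms(5) and F = assms(6)
  have \<phi>: "\<phi> \<in> test_kernels ip" using F by (simp add: appell_expansion_def)
  have tr: "translate y F = (\<lambda>\<omega>. F (\<omega> + y))" by (simp add: translate_def plus_fun_def)
  have ex: "appell_expansion ip P (translate y F) (translated_kernels y \<phi>)"
    unfolding tr by (rule translated_expansion[OF P \<beta> y F])
  have 1: "summable (\<lambda>n. of_nat ((n + k) choose k) * P k \<omega> (contract n y (\<phi> (n + k))))"
    "(\<lambda>k. \<Sum>n. of_nat ((n + k) choose k) * P k \<omega> (contract n y (\<phi> (n + k)))) sums translate y F \<omega>"
    if \<omega>: "\<omega> \<in> dual ip" for \<omega> k
  proof -
    have eq: "of_nat ((n + k) choose k) * P k \<omega> (contract n y (\<phi> (n + k))) = P k \<omega> (taylor_form k n y \<phi>)" for n k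
    proof -
      have "P k \<omega> \<in> tensor_dual ip k" using P \<omega> by (simp add: appell_system_def)
      moreover have "contract n y (\<phi> (n + k)) \<in> sym_tensors ip k"
        using \<phi> y by (intro sym_tensors_contract(1)) (auto simp: test_kernels_def)
      ultimately show ?thesis unfolding taylor_form_def by (simp add: tensor_dual_scale)
    qed
    show "summable (\<lambda>n. of_nat ((n + k) choose k) * P k \<omega> (contract n y (\<phi> (n + k))))"
      unfolding eq by (rule translation_series(1)[OF P \<beta> \<omega> y F])
    show "(\<lambda>k. \<Sum>n. of_nat ((n + k) choose k) * P k \<omega> (contract n y (\<phi> (n + k)))) sums translate y F \<omega>"
      unfolding eq tr by (rule translation_series(3)[OF P \<beta> \<omega> y F])
  qed
  have 2: "test_norm ip P p (translate y F) \<le> test_norm ip P (p + q) F / sqrt (1 - 2 powr (- 2 * real q)) *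
      exp ((dn (p + q) y)\<^sup>2 / (2 * (1 - 2 powr (- 2 * real q))))"
    if q: "q > 0" and yr: "y \<in> hdual ip (p + q)" and emb: "\<And>\<xi>. hn p \<xi> \<le> 2 powr (- real q) * hn (p + q) \<xi>" for p q
  proof -
    \<comment> \<open>The assumed bound on the embedding of H_(p+q) into H_p, which supplies the
      weight \<open>1 - h\<^sup>2\<close>.\<close>
    define h :: real where "h = 2 powr (- real q)"
    have h2: "h\<^sup>2 = 2 powr (- 2 * real q)"
      by (simp add: h_def power2_eq_square powr_add[symmetric])
    have "2 powr (- 2 * real q) < 2 powr (0::real)" using q by (intro powr_less_mono) auto
    then have h: "0 \<le> h" "h\<^sup>2 < 1" unfolding h2 by (simp_all add: h_def)
    let ?N = "\<Sum>N. fact N * (tn (p + q) N (\<phi> N))\<^sup>2" and ?e = "(dn (p + q) y)\<^sup>2 / (1 - h\<^sup>2)"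
    have N0: "0 \<le> ?N" by (intro suminf_nonneg test_norm_summable[OF \<phi>]) simp
    have "(\<Sum>k. fact k * (tn p k (translated_kernels y \<phi> k))\<^sup>2) \<le> exp ?e * ?N"
      using emb by (intro translated_kernels_norm[OF \<phi> yr h]) (simp add: h_def)
    then have "sqrt (\<Sum>k. fact k * (tn p k (translated_kernels y \<phi> k))\<^sup>2) \<le> sqrt (exp ?e * ?N)"
      by (rule real_sqrt_le_mono)
    also have "\<dots> = sqrt ?N * exp (?e / 2)"
    proof -
      have "sqrt (exp v) = exp (v / 2)" for v :: real
        using exp_double[of "v / 2"] by simp
      then show ?thesis by (simp only: real_sqrt_mult mult.commute)
    qed
    \<comment> \<open>The square root of \<open>1 - h\<^sup>2\<close> lies between 0 and 1, so
      dividing by it only enlarges the bound.\<close>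
    also have "\<dots> \<le> sqrt ?N / sqrt (1 - h\<^sup>2) * exp (?e / 2)"
    proof (rule mult_right_mono)
      have "sqrt (1 - h\<^sup>2) \<le> 1" "0 < sqrt (1 - h\<^sup>2)" using h by auto
      then show "sqrt ?N \<le> sqrt ?N / sqrt (1 - h\<^sup>2)"
        using N0 by (simp add: pos_le_divide_eq mult_left_le)
    qed simp
    also have "?e / 2 = (dn (p + q) y)\<^sup>2 / (2 * (1 - h\<^sup>2))" by (simp only: divide_divide_eq_left mult.commute)
    finally show ?thesis
      unfolding test_norm_def appell_kernels_eq[OF P \<beta> ex] appell_kernels_eq[OF P \<beta> F] h2 .
  qed
  have 3: "translate y F \<in> test_functions ip P" using ex by (auto simp: test_functions_def)
  show ?thesis
    by (intro conjI ballI allI impI 1 2 3) blast+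
qed

end
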